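(* For $t=(t_{11},t_{12},t_{21},t_{22},t_{31},t_{32})\in\mathbb{C}^6$ let $M_t=(\mathbb{I}_3,J_t)$ be Nakamura's deformation of the Iwasawa manifold $\mathbb{I}_3$ (defined in the context), with $J_0$ the standard complex structure. Then: (a) There exists $\varepsilon>0$ such that for every $t\in\mathbb{C}^6$ with $|t|<\varepsilon$ the complex manifold $M_t$ admits no SKT metric. (b) The family of deformations with $t_{11}=t_{22}=0$, $t_{12}=-t_{21}$ and $t_{31}=t_{32}=0$ connects the standard complex structure ($t_{21}=0$) on the Iwasawa manifold to the circle of complex structures $\{J_t : |t_{21}|^2=2-\sqrt3\}$, each of which admits SKT metrics. (c) Within the same family ($t_{11}=t_{22}=0$, $t_{12}=-t_{21}$, $t_{31}=t_{32}=0$), each complex structure of the circle $\{J_t: |t_{21}|^2=2+\sqrt3\}$ also admits SKT metrics.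
   Context: SKT: a Hermitian metric with fundamental form $\omega(\cdot,\cdot)=g(J\cdot,\cdot)$ is SKT (strong K\"ahler with torsion) if $\partial\overline{\partial}\omega=0$. Iwasawa manifold: $\mathbb{I}_3=\Gamma\backslash\mathbb{H}(3;\mathbb{C})$, where $\mathbb{H}(3;\mathbb{C})\cong\mathbb{C}^3$ is the group of matrices $\begin{pmatrix}1&z_1&z_3\\0&1&z_2\\0&0&1\end{pmatrix}$, $z_i\in\mathbb{C}$, and $\Gamma=\mathbb{H}(3;\mathbb{C})\cap \mathrm{GL}(3;\mathbb{Z}[i])$ acts by left multiplication. The standard complex structure is the one induced by the holomorphic coordinates $z_1,z_2,z_3$. Nakamura's deformations: for $t=(t_{11},t_{12},t_{21},t_{22},t_{31},t_{32})\in\mathbb{C}^6$ put $D(t)=t_{11}t_{22}-t_{12}t_{21}$, $A(\overline{\mathbf z})=\tfrac12\left(t_{11}t_{21}\overline z_1^2+2t_{11}t_{22}\overline z_1\overline z_2+t_{12}t_{22}\overline z_2^2\right)$ and $$\zeta_1^t=z_1+\sum_{j=1}^2t_{1j}\overline z_j,\qquad \zeta_2^t=z_2+\sum_{j=1}^2t_{2j}\overline z_j,\qquad \zeta_3^t=z_3+\sum_{j=1}^2(t_{3j}+t_{2j}z_1)\overline z_j+A(\overline{\mathbf z})-D(t)\overline z_3 .$$ Whenever $(\zeta_1^t,\zeta_2^t,\zeta_3^t)$ is a local complex coordinate system on the universal cover $\mathbb{C}^3$ (e.g. for $t$ small, and, in the family $t_{11}=t_{22}=0$, $t_{12}=-t_{21}$,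 $t_{31}=t_{32}=0$, whenever $|t_{21}|\ne1$), the complex structure on $\mathbb{C}^3$ for which the $\zeta_i^t$ are holomorphic is $\Gamma$-invariant and descends to a complex structure $J_t$ on $\mathbb{I}_3$; $M_t=(\mathbb{I}_3,J_t)$. *)

theory Defs
  imports "HOL-Analysis.Analysis"
begin

section \<open>Smooth maps and smooth manifolds\<close>

text \<open>Meant for open \<open>U\<close> in a finite-dimensional space, where controlling all directional
  derivatives along constant vectors is the same as controlling the total derivative.\<close>

primrec Ck_on :: "nat \<Rightarrow> 'a::real_normed_vector set \<Rightarrow> ('a \<Rightarrow> 'b::real_normed_vector) \<Rightarrow> bool" where
  "Ck_on 0 U f \<longleftrightarrow> continuous_on U f"
| "Ck_on (Suc k) U f \<longleftrightarrow>
     (\<forall>x\<in>U. f differentiable (at x)) \<and> (\<forall>v. Ck_on k U (\<lambda>x. frechet_derivative f (at x) v))"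

definition smooth_on :: "'a::real_normed_vector set \<Rightarrow> ('a \<Rightarrow> 'b::real_normed_vector) \<Rightarrow> bool" where
  "smooth_on U f \<longleftrightarrow> (\<forall>k. Ck_on k U f)"

type_synonym ('m, 'e) chart = "'m set \<times> ('m \<Rightarrow> 'e)"

definition chart_image :: "('m, 'e) chart \<Rightarrow> 'e set" where
  "chart_image c = snd c ` fst c"

definition overlap :: "('m, 'e) chart \<Rightarrow> ('m, 'e) chart \<Rightarrow> 'e set" where
  "overlap c c' = snd c ` (fst c \<inter> fst c')"

definition transition :: "('m, 'e) chart \<Rightarrow> ('m, 'e) chart \<Rightarrow> 'e \<Rightarrow> 'e" where
  "transition c c' = snd c' \<circ> inv_into (fst c) (snd c)"

definition smooth_manifold :: "'m topology \<Rightarrow> ('m, 'e::euclidean_space) chart set \<Rightarrow> bool" where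
  "smooth_manifold X \<A> \<longleftrightarrow>
     Hausdorff_space X \<and> second_countable X \<and>
     \<Union> (fst ` \<A>) = topspace X \<and>
     (\<forall>c\<in>\<A>. openin X (fst c) \<and> open (chart_image c) \<and>
        homeomorphic_map (subtopology X (fst c)) (top_of_set (chart_image c)) (snd c)) \<and>
     (\<forall>c\<in>\<A>. \<forall>c'\<in>\<A>. smooth_on (overlap c c') (transition c c'))"


section \<open>Complex structures\<close>

text \<open>A tensor field on a manifold is given by its local expressions in all charts of the atlas,
  subject to the usual transformation rule.  The model space is \<open>complex ^ 'n\<close>, regarded as a
  \<^emph>\<open>real\<close> vector space (of real dimension \<open>2 * CARD('n)\<close>); its multiplication by \<open>\<i>\<close>
  plays no role for the smooth manifold itself, and derivatives are real derivatives.\<close>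

type_synonym ('m, 'e) endo_field = "('m, 'e) chart \<Rightarrow> 'e \<Rightarrow> 'e \<Rightarrow> 'e"
type_synonym ('m, 'e) metric_field = "('m, 'e) chart \<Rightarrow> 'e \<Rightarrow> 'e \<Rightarrow> 'e \<Rightarrow> real"

definition almost_complex_structure ::
  "('m, complex ^ 'n) chart set \<Rightarrow> ('m, complex ^ 'n) endo_field \<Rightarrow> bool" where
  "almost_complex_structure \<A> J \<longleftrightarrow>
     (\<forall>c\<in>\<A>.
        (\<forall>x\<in>chart_image c. linear (J c x) \<and> (\<forall>v. J c x (J c x v) = - v)) \<and>
        (\<forall>v. smooth_on (chart_image c) (\<lambda>x. J c x v))) \<and>
     (\<forall>c\<in>\<A>. \<forall>c'\<in>\<A>. \<forall>x\<in>overlap c c'. \<forall>v.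
        frechet_derivative (transition c c') (at x) (J c x v) =
          J c' (transition c c' x) (frechet_derivative (transition c c') (at x) v))"

definition holomorphic_coordinates ::
  "(complex ^ 'n \<Rightarrow> complex ^ 'n \<Rightarrow> complex ^ 'n) \<Rightarrow> (complex ^ 'n) set \<Rightarrow>
     (complex ^ 'n \<Rightarrow> complex ^ 'n) \<Rightarrow> bool" where
  "holomorphic_coordinates J U f \<longleftrightarrow>
     open U \<and> inj_on f U \<and> smooth_on U f \<and>
     (\<forall>x\<in>U. bij (frechet_derivative f (at x)) \<and>
        (\<forall>v. frechet_derivative f (at x) (J x v) = \<i> *s frechet_derivative f (at x) v))"

definition complex_manifold ::
  "'m topology \<Rightarrow> ('m, complex ^ 'n) chart set \<Rightarrow> ('m, complex ^ 'n) endo_field \<Rightarrow> bool" where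
  "complex_manifold X \<A> J \<longleftrightarrow>
     smooth_manifold X \<A> \<and> almost_complex_structure \<A> J \<and>
     (\<forall>c\<in>\<A>. \<forall>x\<in>chart_image c. \<exists>U f.
        x \<in> U \<and> U \<subseteq> chart_image c \<and> holomorphic_coordinates (J c) U f)"

definition smooth_family_of_complex_manifolds ::
  "'s::real_normed_vector set \<Rightarrow> 'm topology \<Rightarrow> ('m, complex ^ 'n) chart set \<Rightarrow>
     ('s \<Rightarrow> ('m, complex ^ 'n) endo_field) \<Rightarrow> bool" where
  "smooth_family_of_complex_manifolds S X \<A> J \<longleftrightarrow>
     open S \<and> (\<forall>s\<in>S. complex_manifold X \<A> (J s)) \<and>
     (\<forall>c\<in>\<A>. \<forall>v. smooth_on (S \<times> chart_image c) (\<lambda>(s, x). J s c x v))"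


section \<open>Differential forms and SKT metrics\<close>

text \<open>A complex-valued \<open>k\<close>-form on an open set is evaluated at a point and a list of \<open>k\<close> real
  tangent vectors.\<close>

type_synonym 'e cform = "'e \<Rightarrow> 'e list \<Rightarrow> complex"

text \<open>The formula \<open>(d\<alpha>)(v_0,...,v_k) = \<Sum>i. (-1)^i v_i(\<alpha>(v_0,...,omit v_i,...,v_k))\<close> for constant
  vector fields, whose brackets vanish.\<close>

definition ext_deriv :: "'e::euclidean_space cform \<Rightarrow> 'e cform" where
  "ext_deriv \<alpha> = (\<lambda>x vs. \<Sum>i<length vs.
     (-1) ^ i * frechet_derivative (\<lambda>y. \<alpha> y (take i vs @ drop (Suc i) vs)) (at x) (vs ! i))"

text \<open>The \<open>(p,q)\<close>-part of a \<open>(p+q)\<close>-form \<open>\<alpha>\<close> is obtained by extending \<open>\<alpha>\<close> complex-multilinearly to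
  complexified tangent vectors and inserting, for every \<open>S\<close> with \<open>card S = p\<close>, the \<open>(1,0)\<close>-part
  \<open>(v - \<i> J v) / 2\<close> of the vectors with index in \<open>S\<close> and the \<open>(0,1)\<close>-part \<open>(v + \<i> J v) / 2\<close> of the others.
  Expanding each factor, \<open>T\<close> is the set of slots in which the summand \<open>\<mp> \<i> J v\<close> is chosen.\<close>

definition pq_part :: "('e \<Rightarrow> 'e \<Rightarrow> 'e) \<Rightarrow> nat \<Rightarrow> nat \<Rightarrow> 'e cform \<Rightarrow> 'e cform" where
  "pq_part J p q \<alpha> = (\<lambda>x vs.
     if length vs = p + q then
       \<Sum>S\<in>{S. S \<subseteq> {..<p + q} \<and> card S = p}. \<Sum>T\<in>Pow {..<p + q}.
         (\<Prod>i\<in>T. if i \<in> S then - \<i> else \<i>) / 2 ^ (p + q) *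
         \<alpha> x (map (\<lambda>i. if i \<in> T then J x (vs ! i) else vs ! i) [0..<p + q])
     else 0)"

text \<open>The operators \<open>\<partial>\<close> and \<open>\<partial>-bar\<close> on forms of type \<open>(p,q)\<close>.\<close>

definition del :: "('e \<Rightarrow> 'e \<Rightarrow> 'e) \<Rightarrow> nat \<Rightarrow> nat \<Rightarrow> 'e::euclidean_space cform \<Rightarrow> 'e cform" where
  "del J p q \<alpha> = pq_part J (Suc p) q (ext_deriv \<alpha>)"

definition delbar :: "('e \<Rightarrow> 'e \<Rightarrow> 'e) \<Rightarrow> nat \<Rightarrow> nat \<Rightarrow> 'e::euclidean_space cform \<Rightarrow> 'e cform" where
  "delbar J p q \<alpha> = pq_part J p (Suc q) (ext_deriv \<alpha>)"

definition riemannian_metric ::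
  "('m, 'e::euclidean_space) chart set \<Rightarrow> ('m, 'e) metric_field \<Rightarrow> bool" where
  "riemannian_metric \<A> g \<longleftrightarrow>
     (\<forall>c\<in>\<A>.
        (\<forall>x\<in>chart_image c. bilinear (g c x) \<and> (\<forall>v w. g c x v w = g c x w v) \<and>
           (\<forall>v. v \<noteq> 0 \<longrightarrow> g c x v v > 0)) \<and>
        (\<forall>v w. smooth_on (chart_image c) (\<lambda>x. g c x v w))) \<and>
     (\<forall>c\<in>\<A>. \<forall>c'\<in>\<A>. \<forall>x\<in>overlap c c'. \<forall>v w.
        g c x v w =
          g c' (transition c c' x) (frechet_derivative (transition c c') (at x) v)
            (frechet_derivative (transition c c') (at x) w))"

definition hermitian_metric ::
  "('m, 'e::euclidean_space) chart set \<Rightarrow> ('m, 'e) endo_field \<Rightarrow> ('m, 'e) metric_field \<Rightarrow> bool" where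
  "hermitian_metric \<A> J g \<longleftrightarrow>
     riemannian_metric \<A> g \<and>
     (\<forall>c\<in>\<A>. \<forall>x\<in>chart_image c. \<forall>v w. g c x (J c x v) (J c x w) = g c x v w)"

definition fundamental_form ::
  "('m, 'e) endo_field \<Rightarrow> ('m, 'e) metric_field \<Rightarrow> ('m, 'e) chart \<Rightarrow> 'e cform" where
  "fundamental_form J g c = (\<lambda>x vs. complex_of_real (g c x (J c x (vs ! 0)) (vs ! 1)))"

definition skt_metric ::
  "('m, 'e::euclidean_space) chart set \<Rightarrow> ('m, 'e) endo_field \<Rightarrow> ('m, 'e) metric_field \<Rightarrow> bool" where
  "skt_metric \<A> J g \<longleftrightarrow>
     hermitian_metric \<A> J g \<and>
     (\<forall>c\<in>\<A>. \<forall>x\<in>chart_image c. \<forall>vs. length vs = 4 \<longrightarrow>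
        del (J c) 1 2 (delbar (J c) 1 1 (fundamental_form J g c)) x vs = 0)"

definition admits_skt_metric ::
  "('m, 'e::euclidean_space) chart set \<Rightarrow> ('m, 'e) endo_field \<Rightarrow> bool" where
  "admits_skt_metric \<A> J \<longleftrightarrow> (\<exists>g. skt_metric \<A> J g)"


section \<open>The Iwasawa manifold\<close>

definition heis_mat :: "complex ^ 3 \<Rightarrow> complex ^ 3 ^ 3" where
  "heis_mat z = vector [vector [1, z $ 1, z $ 3], vector [0, 1, z $ 2], vector [0, 0, 1]]"

definition heis_coord :: "complex ^ 3 ^ 3 \<Rightarrow> complex ^ 3" where
  "heis_coord A = vector [A $ 1 $ 2, A $ 2 $ 3, A $ 1 $ 3]"

definition gaussian_integers :: "complex set" where
  "gaussian_integers = {of_int a + \<i> * of_int b |a b. True}"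

definition GL3_gaussian :: "(complex ^ 3 ^ 3) set" where
  "GL3_gaussian = {A. (\<forall>i j. A $ i $ j \<in> gaussian_integers) \<and>
     (\<exists>B. (\<forall>i j. B $ i $ j \<in> gaussian_integers) \<and> A ** B = mat 1 \<and> B ** A = mat 1)}"

definition Iw_lattice :: "(complex ^ 3 ^ 3) set" where
  "Iw_lattice = range heis_mat \<inter> GL3_gaussian"

text \<open>The projection to the orbit space of the action of the lattice by left multiplication.\<close>

definition Iw_proj :: "complex ^ 3 \<Rightarrow> (complex ^ 3) set" where
  "Iw_proj z = {heis_coord (A ** heis_mat z) |A. A \<in> Iw_lattice}"

definition Iw_top :: "(complex ^ 3) set topology" where
  "Iw_top = topology (\<lambda>U. U \<subseteq> range Iw_proj \<and> open (Iw_proj -` U))"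

text \<open>Charts are the local inverses of the covering projection, so the coordinates of a chart are
  \<open>z_1, z_2, z_3\<close> on an open set of the universal cover.\<close>

definition Iw_charts :: "((complex ^ 3) set, complex ^ 3) chart set" where
  "Iw_charts = {(Iw_proj ` V, inv_into V Iw_proj) |V. open V \<and> inj_on Iw_proj V}"

definition Iw_standard_J :: "((complex ^ 3) set, complex ^ 3) endo_field" where
  "Iw_standard_J = (\<lambda>c z v. \<i> *s v)"


section \<open>Nakamura's deformations\<close>

text \<open>The parameter \<open>t\<close> is a matrix with \<open>t $ i $ j = t_{ij}\<close> (\<open>i = 1, 2, 3\<close> and \<open>j = 1, 2\<close>);
  its norm is the Euclidean norm of the six entries.\<close>

definition Nak_D :: "complex ^ 2 ^ 3 \<Rightarrow> complex" where
  "Nak_D t = t $ 1 $ 1 * t $ 2 $ 2 - t $ 1 $ 2 * t $ 2 $ 1"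

definition Nak_A :: "complex ^ 2 ^ 3 \<Rightarrow> complex ^ 3 \<Rightarrow> complex" where
  "Nak_A t z = 1 / 2 *
     (t $ 1 $ 1 * t $ 2 $ 1 * (cnj (z $ 1))\<^sup>2
      + 2 * t $ 1 $ 1 * t $ 2 $ 2 * cnj (z $ 1) * cnj (z $ 2)
      + t $ 1 $ 2 * t $ 2 $ 2 * (cnj (z $ 2))\<^sup>2)"

definition Nak_zeta :: "complex ^ 2 ^ 3 \<Rightarrow> complex ^ 3 \<Rightarrow> complex ^ 3" where
  "Nak_zeta t z = vector
     [z $ 1 + (t $ 1 $ 1 * cnj (z $ 1) + t $ 1 $ 2 * cnj (z $ 2)),
      z $ 2 + (t $ 2 $ 1 * cnj (z $ 1) + t $ 2 $ 2 * cnj (z $ 2)),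
      z $ 3 + ((t $ 3 $ 1 + t $ 2 $ 1 * z $ 1) * cnj (z $ 1)
               + (t $ 3 $ 2 + t $ 2 $ 2 * z $ 1) * cnj (z $ 2))
        + Nak_A t z - Nak_D t * cnj (z $ 3)]"

text \<open>The complex structure for which the components of \<open>\<zeta> = Nak_zeta t\<close> are holomorphic, i.e.
  \<open>d\<zeta> (J v) = \<i> d\<zeta> v\<close>.  It is meaningful when the real derivative of \<open>\<zeta>\<close> is bijective everywhere.
  Since charts are local inverses of the projection, a lattice-invariant tensor field on the universal
  cover has the same local expression in every chart; that this \<open>J\<close> transforms correctly between charts
  is part of \<open>complex_manifold\<close>.\<close>

definition Nak_J :: "complex ^ 2 ^ 3 \<Rightarrow> ((complex ^ 3) set, complex ^ 3) endo_field" where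
  "Nak_J t = (\<lambda>c z v.
     inv (frechet_derivative (Nak_zeta t) (at z)) (\<i> *s frechet_derivative (Nak_zeta t) (at z) v))"

text \<open>The parameter with \<open>t_{21} = s\<close>, \<open>t_{12} = - s\<close> and all other entries zero.\<close>

definition Nak_line :: "complex \<Rightarrow> complex ^ 2 ^ 3" where
  "Nak_line s = vector [vector [0, - s], vector [s, 0], vector [0, 0]]"

end

theory Submission
  imports Defs
begin

text \<open>The universal cover is the complex Heisenberg group, in which left multiplication by \<open>h\<close> is the affine
map \<open>z \<mapsto> h + shear h\<^sub>1 z\<close>.  After the left trivialization \<open>v \<mapsto> shear (- z\<^sub>1) v\<close> of the tangent bundle, the
differential of Nakamura's coordinates is a constant real-linear map followed by a complex-linear one
(lemma \<open>has_derivative_Nak_zeta\<close>).  So \<open>J_t\<close> is left-invariant, and its \<open>(1,0)\<close>-forms have a left-invariant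
coframe \<open>\<eta>\<^sub>1, \<eta>\<^sub>2, \<theta>\<close> in which \<open>\<eta>\<^sub>1, \<eta>\<^sub>2\<close> are closed and \<open>d\<theta>\<close> is a combination of wedge products of
\<open>\<eta>\<^sub>1, \<eta>\<^sub>2\<close> and their conjugates, with coefficients \<open>A\<close> of \<open>\<eta>\<^sub>1 \<and> \<eta>\<^sub>2\<close> and \<open>B\<^sub>j\<^sub>k\<close> of \<open>\<eta>\<^sub>j \<and> cnj \<eta>\<^sub>k\<close>.

In the fundamental form of a left-invariant Hermitian metric only the summand \<open>(\<i> k / 2) \<theta> \<and> cnj \<theta>\<close>, where \<open>k > 0\<close>,
survives the operator \<open>\<partial> \<partial>-bar\<close>: applied to the summands with at most one factor \<open>\<theta>\<close> or \<open>cnj \<theta>\<close>, the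
first-order operator already gives constant combinations of closed forms.  What remains is
\<open>(\<i> k / 2) \<Phi> \<eta>\<^sub>1 \<and> cnj \<eta>\<^sub>1 \<and> \<eta>\<^sub>2 \<and> cnj \<eta>\<^sub>2\<close> with the real number
\<open>\<Phi> = |A|\<^sup>2 - 2 Re (B\<^sub>1\<^sub>1 cnj B\<^sub>2\<^sub>2) + |B\<^sub>1\<^sub>2|\<^sup>2 + |B\<^sub>2\<^sub>1|\<^sup>2\<close>, which depends only on \<open>t\<close>
(\<open>skt_obstruction\<close>, theorem \<open>ddbar_invariant_form\<close>).

Hence a left-invariant SKT metric exists as soon as \<open>\<Phi> = 0\<close> (theorem \<open>admits_skt_metric_if_no_obstruction\<close>).
If \<open>\<Phi> \<noteq> 0\<close> there is no SKT metric at all (theorem \<open>no_skt_metric_if_obstruction\<close>): pull the fundamental form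
back by the left translations \<open>h\<close> and integrate over \<open>h\<close> in a fundamental domain of the lattice.  Each
pullback is again annihilated by \<open>\<partial> \<partial>-bar\<close>, because left translations are holomorphic; differentiating under the
integral sign shows the same for the average.  The average is left-invariant, because the integral of a
lattice-periodic function is unchanged by right translations, and it is still positive, so the previous
computation would give \<open>k \<Phi> = 0\<close>.

Finally \<open>\<Phi>\<close> is continuous at \<open>t = 0\<close> with value \<open>1\<close>, which gives (a), and for the parameter with \<open>t\<^sub>2\<^sub>1 = s = - t\<^sub>1\<^sub>2\<close>
and the other entries \<open>0\<close> it equals \<open>(|s|\<^sup>4 - 4 |s|\<^sup>2 + 1) / (1 + |s|\<^sup>2)\<^sup>2\<close>, whose zeros are \<open>|s|\<^sup>2 = 2 \<plusminus> sqrt 3\<close>;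
this gives (b) and (c).\<close>

section \<open>Calculus of smooth maps\<close>

lemma frechet_derivative_worksI:
  "f differentiable F \<Longrightarrow> (f has_derivative frechet_derivative f F) F"
  by (simp add: frechet_derivative_works)

lemma Ck_on_cong:
  assumes "open U" "\<And>x. x \<in> U \<Longrightarrow> f x = g x" "Ck_on k U f"
  shows "Ck_on k U g"
  using assms(2,3)
proof (induction k arbitrary: f g)
  case 0
  then show ?case by (simp cong: continuous_on_cong)
next
  case (Suc k)
  have df: "f differentiable (at x)" if "x \<in> U" for x using Suc.prems that by simp
  have dg: "g differentiable (at x)" if "x \<in> U" for x
    using df[OF that] assms(1) Suc.prems(1) that
    unfolding differentiable_def by (meson has_derivative_transform_within_open)
  have "frechet_derivative f (at x) = frechet_derivative g (at x)" if "x \<in> U" for x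
    using frechet_derivative_transform_within_open[OF df[OF that] assms(1) that] Suc.prems(1) by blast
  then have "Ck_on k U (\<lambda>x. frechet_derivative g (at x) v)" for v
    using Suc.IH[of "\<lambda>x. frechet_derivative f (at x) v" "\<lambda>x. frechet_derivative g (at x) v"] Suc.prems(2)
    by simp
  with dg show ?case by simp
qed

lemma Ck_on_local:
  "(\<And>x. x \<in> U \<Longrightarrow> \<exists>V. open V \<and> x \<in> V \<and> Ck_on k V f) \<Longrightarrow> Ck_on k U f"
proof (induction k arbitrary: f)
  case 0
  have "isCont f x" if "x \<in> U" for x
    using 0[OF that] by (auto simp: continuous_on_eq_continuous_at)
  then show ?case by (simp add: continuous_at_imp_continuous_on)
next
  case (Suc k)
  then show ?case by simp metis
qed

lemma Ck_on_Suc_imp: "Ck_on (Suc k) U f \<Longrightarrow> Ck_on k U f"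
proof (induction k arbitrary: f)
  case 0
  then show ?case
    by (auto intro!: continuous_at_imp_continuous_on differentiable_imp_continuous_within)
next
  case (Suc k)
  then show ?case using Ck_on.simps(2) by metis
qed

lemma Ck_on_const: "Ck_on k U (\<lambda>x. c)"
  by (induction k arbitrary: c) (simp_all add: frechet_derivative_const)

text \<open>Computes with any family of derivatives in place of \<open>frechet_derivative\<close>, so that the derivative rules of the
library apply in the inductions below.\<close>

lemma Ck_on_SucI:
  assumes "open U"
    and "\<And>x. x \<in> U \<Longrightarrow> (f has_derivative f' x) (at x)"
    and "\<And>v. Ck_on k U (\<lambda>x. f' x v)"
  shows "Ck_on (Suc k) U f"
proof -
  have "frechet_derivative f (at x) = f' x" if "x \<in> U" for x
    using frechet_derivative_at[OF assms(2)[OF that]] by simp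
  then have "Ck_on k U (\<lambda>x. frechet_derivative f (at x) v)" for v
    using Ck_on_cong[OF assms(1) _ assms(3)[of v]] by simp
  then show ?thesis using assms(2) by (auto simp: differentiable_def)
qed

lemma Ck_on_bounded_linear:
  assumes "open U" "bounded_linear L" "Ck_on k U f"
  shows "Ck_on k U (\<lambda>x. L (f x))"
  using assms(3)
proof (induction k arbitrary: f)
  case 0
  then show ?case by (simp add: bounded_linear.continuous_on[OF assms(2)])
next
  case (Suc k)
  show ?case
  proof (rule Ck_on_SucI[OF assms(1)])
    show "((\<lambda>x. L (f x)) has_derivative (\<lambda>v. L (frechet_derivative f (at x) v))) (at x)"
      if "x \<in> U" for x
      using Suc.prems that
      by (intro bounded_linear.has_derivative[OF assms(2)]) (simp add: frechet_derivative_worksI)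
    show "Ck_on k U (\<lambda>x. L (frechet_derivative f (at x) v))" for v
      using Suc by simp
  qed
qed

lemma Ck_on_ident: "open U \<Longrightarrow> Ck_on k U (\<lambda>x. x)"
proof (cases k)
  case (Suc l)
  assume U: "open U"
  show ?thesis unfolding Suc
    by (rule Ck_on_SucI[OF U, where f' = "\<lambda>x v. v"]) (auto intro: Ck_on_const)
qed simp

lemma Ck_on_add:
  assumes "open U" "Ck_on k U f" "Ck_on k U g"
  shows "Ck_on k U (\<lambda>x. f x + g x)"
  using assms(2,3)
proof (induction k arbitrary: f g)
  case 0
  then show ?case by (simp add: continuous_on_add)
next
  case (Suc k)
  show ?case
    by (rule Ck_on_SucI[OF assms(1), where f' = "\<lambda>x v. frechet_derivative f (at x) v + frechet_derivative g (at x) v"])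
       (use Suc in \<open>auto intro!: has_derivative_add frechet_derivative_worksI\<close>)
qed

lemma Ck_on_bilinear:
  assumes "open U" "bounded_bilinear B" "Ck_on k U f" "Ck_on k U g"
  shows "Ck_on k U (\<lambda>x. B (f x) (g x))"
  using assms(3,4)
proof (induction k arbitrary: f g)
  case 0
  then show ?case by (simp add: bounded_bilinear.continuous_on[OF assms(2)])
next
  case (Suc k)
  show ?case
  proof (rule Ck_on_SucI[OF assms(1)])
    show "((\<lambda>x. B (f x) (g x)) has_derivative
        (\<lambda>v. B (f x) (frechet_derivative g (at x) v) + B (frechet_derivative f (at x) v) (g x))) (at x)"
      if "x \<in> U" for x
      using Suc.prems that
      by (intro bounded_bilinear.FDERIV[OF assms(2)]) (simp_all add: frechet_derivative_worksI)
    show "Ck_on k U (\<lambda>x. B (f x) (frechet_derivative g (at x) v) +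
                       B (frechet_derivative f (at x) v) (g x))" for v
      using Suc.prems Ck_on_Suc_imp[OF Suc.prems(1)] Ck_on_Suc_imp[OF Suc.prems(2)]
      by (intro Ck_on_add[OF assms(1)] Suc.IH) simp_all
  qed
qed

lemma Ck_on_inverse:
  fixes f :: "'a::real_normed_vector \<Rightarrow> 'b::real_normed_field"
  assumes "open U" "\<And>x. x \<in> U \<Longrightarrow> f x \<noteq> 0" "Ck_on k U f"
  shows "Ck_on k U (\<lambda>x. inverse (f x))"
  using assms(3)
proof (induction k)
  case 0
  then show ?case using assms(2) by (simp add: continuous_on_inverse)
next
  case (Suc k)
  show ?case
  proof (rule Ck_on_SucI[OF assms(1)])
    show "((\<lambda>x. inverse (f x)) has_derivative
        (\<lambda>v. - (inverse (f x) * frechet_derivative f (at x) v * inverse (f x)))) (at x)"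
      if "x \<in> U" for x
      using Suc.prems that assms(2)
      by (intro Deriv.has_derivative_inverse) (simp_all add: frechet_derivative_worksI)
    have inv: "Ck_on k U (\<lambda>x. inverse (f x))"
      using Suc.IH Ck_on_Suc_imp[OF Suc.prems] by simp
    show "Ck_on k U (\<lambda>x. - (inverse (f x) * frechet_derivative f (at x) v * inverse (f x)))" for v
      using Suc.prems
      by (intro Ck_on_bounded_linear[OF assms(1) bounded_linear_minus[OF bounded_linear_ident]]
          Ck_on_bilinear[OF assms(1) bounded_bilinear_mult] inv) simp_all
  qed
qed

lemma smooth_on_cong:
  "open U \<Longrightarrow> (\<And>x. x \<in> U \<Longrightarrow> f x = g x) \<Longrightarrow> smooth_on U f \<Longrightarrow> smooth_on U g"
  unfolding smooth_on_def using Ck_on_cong by blast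

lemma smooth_on_local:
  "(\<And>x. x \<in> U \<Longrightarrow> \<exists>V. open V \<and> x \<in> V \<and> smooth_on V f) \<Longrightarrow> smooth_on U f"
  unfolding smooth_on_def using Ck_on_local[of U _ f] by meson

lemma smooth_on_const: "smooth_on U (\<lambda>x. c)"
  and smooth_on_ident: "open U \<Longrightarrow> smooth_on U (\<lambda>x. x)"
  by (simp_all add: smooth_on_def Ck_on_const Ck_on_ident)

lemma smooth_on_bounded_linear:
  "open U \<Longrightarrow> bounded_linear L \<Longrightarrow> smooth_on U f \<Longrightarrow> smooth_on U (\<lambda>x. L (f x))"
  by (simp add: smooth_on_def Ck_on_bounded_linear)

lemma smooth_on_bilinear:
  "open U \<Longrightarrow> bounded_bilinear B \<Longrightarrow> smooth_on U f \<Longrightarrow> smooth_on U g \<Longrightarrow>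
   smooth_on U (\<lambda>x. B (f x) (g x))"
  by (simp add: smooth_on_def Ck_on_bilinear)

lemma smooth_on_add:
  "open U \<Longrightarrow> smooth_on U f \<Longrightarrow> smooth_on U g \<Longrightarrow> smooth_on U (\<lambda>x. f x + g x)"
  by (simp add: smooth_on_def Ck_on_add)

lemma smooth_on_minus: "open U \<Longrightarrow> smooth_on U f \<Longrightarrow> smooth_on U (\<lambda>x. - f x)"
  by (rule smooth_on_bounded_linear[OF _ bounded_linear_minus[OF bounded_linear_ident]])

lemma smooth_on_diff:
  "open U \<Longrightarrow> smooth_on U f \<Longrightarrow> smooth_on U g \<Longrightarrow> smooth_on U (\<lambda>x. f x - g x)"
  using smooth_on_add[OF _ _ smooth_on_minus, of U f g] by simp

lemma smooth_on_mult:
  fixes f g :: "'a::real_normed_vector \<Rightarrow> 'b::real_normed_algebra"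
  shows "open U \<Longrightarrow> smooth_on U f \<Longrightarrow> smooth_on U g \<Longrightarrow> smooth_on U (\<lambda>x. f x * g x)"
  by (rule smooth_on_bilinear[OF _ bounded_bilinear_mult])

lemma smooth_on_scaleR:
  "open U \<Longrightarrow> smooth_on U f \<Longrightarrow> smooth_on U g \<Longrightarrow> smooth_on U (\<lambda>x. f x *\<^sub>R g x)"
  by (rule smooth_on_bilinear[OF _ bounded_bilinear_scaleR])

lemma smooth_on_divide:
  fixes f g :: "'a::real_normed_vector \<Rightarrow> 'b::real_normed_field"
  assumes "open U" "smooth_on U f" "smooth_on U g" "\<And>x. x \<in> U \<Longrightarrow> g x \<noteq> 0"
  shows "smooth_on U (\<lambda>x. f x / g x)"
  using smooth_on_mult[OF assms(1,2), of "\<lambda>x. inverse (g x)"] Ck_on_inverse[OF assms(1,4)] assms(3)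
  by (simp add: smooth_on_def divide_inverse)

lemma smooth_on_power:
  fixes f :: "'a::real_normed_vector \<Rightarrow> 'b::real_normed_field"
  assumes "open U" "smooth_on U f"
  shows "smooth_on U (\<lambda>x. f x ^ n)"
  by (induction n) (auto intro: smooth_on_const smooth_on_mult assms)

lemma smooth_on_sum:
  "open U \<Longrightarrow> (\<And>i. i \<in> I \<Longrightarrow> smooth_on U (f i)) \<Longrightarrow> smooth_on U (\<lambda>x. \<Sum>i\<in>I. f i x)"
  by (induction I rule: infinite_finite_induct) (auto intro: smooth_on_const smooth_on_add)

lemma smooth_on_cnj: "open U \<Longrightarrow> smooth_on U f \<Longrightarrow> smooth_on U (\<lambda>x. cnj (f x))"
  by (rule smooth_on_bounded_linear[OF _ bounded_linear_cnj])

lemma smooth_on_of_real: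
  "open U \<Longrightarrow> smooth_on U f \<Longrightarrow> smooth_on U (\<lambda>x. of_real (f x) :: 'b::{real_normed_algebra_1})"
  by (rule smooth_on_bounded_linear[OF _ bounded_linear_of_real])

lemma smooth_on_nth:
  "open U \<Longrightarrow> smooth_on U f \<Longrightarrow> smooth_on U (\<lambda>x. f x $ i)"
  by (rule smooth_on_bounded_linear[OF _ bounded_linear_vec_nth])

lemma linear_axis: "linear (axis k :: 'a::real_vector \<Rightarrow> 'a ^ 'n)"
  by (rule linearI) (simp_all add: axis_def vec_eq_iff)

lemma bounded_linear_axis: "bounded_linear (axis k :: 'a::euclidean_space \<Rightarrow> 'a ^ 'n)"
  using linear_axis linear_conv_bounded_linear by blast

lemma smooth_on_axis:
  fixes f :: "'a::real_normed_vector \<Rightarrow> 'b::euclidean_space"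
  shows "open U \<Longrightarrow> smooth_on U f \<Longrightarrow> smooth_on U (\<lambda>x. axis k (f x))"
  by (rule smooth_on_bounded_linear[OF _ bounded_linear_axis])

lemma smooth_on_differentiable: "smooth_on U f \<Longrightarrow> x \<in> U \<Longrightarrow> f differentiable (at x)"
  unfolding smooth_on_def using Ck_on.simps(2) by blast

lemma smooth_on_continuous: "smooth_on U f \<Longrightarrow> continuous_on U f"
  unfolding smooth_on_def using Ck_on.simps(1) by blast

lemma smooth_on_frechet_derivative:
  "smooth_on U f \<Longrightarrow> smooth_on U (\<lambda>x. frechet_derivative f (at x) v)"
  unfolding smooth_on_def using Ck_on.simps(2) by blast

lemmas smooth_intros = smooth_on_const smooth_on_ident smooth_on_add smooth_on_minus smooth_on_diff
  smooth_on_mult smooth_on_scaleR smooth_on_power smooth_on_sum smooth_on_cnj smooth_on_of_real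
  smooth_on_nth smooth_on_axis

section \<open>The Iwasawa manifold as a quotient of the Heisenberg group\<close>

text \<open>The differential of a left translation of the Heisenberg group with first coordinate \<open>a\<close>; it is a shear because
the only nonlinear term of the multiplication is the product of a first and a second coordinate.\<close>

definition shear :: "complex \<Rightarrow> complex ^ 3 \<Rightarrow> complex ^ 3" where
  "shear a v = v + axis 3 (a * v $ 2)"

definition heis_mult :: "complex ^ 3 \<Rightarrow> complex ^ 3 \<Rightarrow> complex ^ 3" where
  "heis_mult h z = h + shear (h $ 1) z"

lemma axis_3_nth [simp]:
  "axis (3::3) c $ 1 = 0" "axis (3::3) c $ 2 = 0" "axis (3::3) c $ 3 = c"
  by (simp_all add: axis_def)

lemma shear_nth [simp]:
  "shear a v $ 1 = v $ 1" "shear a v $ 2 = v $ 2" "shear a v $ 3 = v $ 3 + a * v $ 2"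
  by (simp_all add: shear_def)

lemma heis_mult_nth [simp]:
  "heis_mult h z $ 1 = h $ 1 + z $ 1" "heis_mult h z $ 2 = h $ 2 + z $ 2"
  "heis_mult h z $ 3 = h $ 3 + (z $ 3 + h $ 1 * z $ 2)"
  by (simp_all add: heis_mult_def)

lemma vec3_eq_iff: "u = v \<longleftrightarrow> u $ 1 = v $ 1 \<and> u $ 2 = v $ 2 \<and> u $ 3 = (v $ 3 :: 'a)"
  for u v :: "'a ^ 3"
  by (simp add: vec_eq_iff forall_3)

lemma shear_shear [simp]: "shear a (shear b v) = shear (a + b) v"
  and shear_0 [simp]: "shear 0 v = v"
  by (simp_all add: vec3_eq_iff algebra_simps)

lemma linear_shear: "linear (shear a)"
  by (rule linearI) (simp_all add: vec3_eq_iff algebra_simps)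

lemma bounded_linear_shear: "bounded_linear (shear a)"
  using linear_shear linear_conv_bounded_linear by blast

lemma has_derivative_heis_mult: "(heis_mult h has_derivative shear (h $ 1)) (at z)"
  unfolding heis_mult_def
  by (auto intro!: derivative_eq_intros bounded_linear_imp_has_derivative bounded_linear_shear)

lemma smooth_on_heis_mult: "open U \<Longrightarrow> smooth_on U (heis_mult h)"
  unfolding heis_mult_def
  by (intro smooth_intros smooth_on_bounded_linear[OF _ bounded_linear_shear])

lemma continuous_on_heis_mult: "continuous_on UNIV (heis_mult h)"
  by (rule smooth_on_continuous[OF smooth_on_heis_mult]) simp

lemma gaussian_integers_iff: "z \<in> gaussian_integers \<longleftrightarrow> Re z \<in> \<int> \<and> Im z \<in> \<int>"
proof
  assume "Re z \<in> \<int> \<and> Im z \<in> \<int>"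
  then obtain a b where "Re z = of_int a" "Im z = of_int b" by (auto elim!: Ints_cases)
  then have "z = of_int a + \<i> * of_int b" by (simp add: complex_eq_iff)
  then show "z \<in> gaussian_integers" unfolding gaussian_integers_def by blast
qed (auto simp: gaussian_integers_def)

lemma gaussian_integers_closed:
  "0 \<in> gaussian_integers" "1 \<in> gaussian_integers"
  "a \<in> gaussian_integers \<Longrightarrow> b \<in> gaussian_integers \<Longrightarrow> a + b \<in> gaussian_integers"
  "a \<in> gaussian_integers \<Longrightarrow> b \<in> gaussian_integers \<Longrightarrow> a - b \<in> gaussian_integers"
  "a \<in> gaussian_integers \<Longrightarrow> b \<in> gaussian_integers \<Longrightarrow> a * b \<in> gaussian_integers"
  "a \<in> gaussian_integers \<Longrightarrow> - a \<in> gaussian_integers"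
  by (simp_all add: gaussian_integers_iff)

lemma closed_gaussian_integers: "closed gaussian_integers"
proof -
  have "gaussian_integers = Re -` \<int> \<inter> Im -` \<int>"
    by (auto simp: gaussian_integers_iff)
  moreover have "closed \<dots>"
    by (intro closed_Int closed_vimage closed_Ints continuous_intros)
  ultimately show ?thesis by simp
qed

lemma gaussian_integer_small:
  assumes "z \<in> gaussian_integers" "norm z < 1"
  shows "z = 0"
proof -
  have "\<bar>Re z\<bar> < 1" "\<bar>Im z\<bar> < 1"
    using assms(2) abs_Re_le_cmod[of z] abs_Im_le_cmod[of z] by linarith+
  moreover have "Re z \<in> \<int>" "Im z \<in> \<int>" using assms(1) by (auto simp: gaussian_integers_iff)
  ultimately have "Re z = 0" "Im z = 0" using Ints_nonzero_abs_less1 by blast+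
  then show ?thesis by (simp add: complex_eq_iff)
qed

definition gaussian_points :: "(complex ^ 3) set" where
  "gaussian_points = {h. \<forall>i. h $ i \<in> gaussian_integers}"

lemma heis_coord_heis_mat: "heis_coord (heis_mat z) = z"
  by (simp add: heis_coord_def heis_mat_def vec3_eq_iff)

lemma heis_mat_mult: "heis_mat h ** heis_mat z = heis_mat (heis_mult h z)"
  by (simp add: heis_mat_def matrix_matrix_mult_def vec_eq_iff forall_3 sum_3 algebra_simps)

lemma heis_mat_0: "heis_mat 0 = mat 1"
  by (simp add: heis_mat_def mat_def vec_eq_iff forall_3)

lemma heis_mat_gaussian: "(\<forall>i j. heis_mat h $ i $ j \<in> gaussian_integers) \<longleftrightarrow> h \<in> gaussian_points"
  by (auto simp add: heis_mat_def gaussian_points_def forall_3 gaussian_integers_closed)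

lemma Iw_lattice_eq: "Iw_lattice = heis_mat ` gaussian_points"
proof
  show "Iw_lattice \<subseteq> heis_mat ` gaussian_points"
    unfolding Iw_lattice_def GL3_gaussian_def using heis_mat_gaussian by blast
  show "heis_mat ` gaussian_points \<subseteq> Iw_lattice"
  proof
    fix A assume "A \<in> heis_mat ` gaussian_points"
    then obtain h where h: "h \<in> gaussian_points" "A = heis_mat h" by blast
    \<comment> \<open>the inverse of \<open>h\<close> in the Heisenberg group\<close>
    define k :: "complex ^ 3" where "k = vector [- h $ 1, - h $ 2, h $ 1 * h $ 2 - h $ 3]"
    have k: "k \<in> gaussian_points"
      using h(1) unfolding gaussian_points_def k_def
      by (auto simp: forall_3 gaussian_integers_closed)
    have "heis_mult h k = 0" "heis_mult k h = 0"
      by (simp_all add: vec3_eq_iff k_def algebra_simps)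
    then have "A ** heis_mat k = mat 1" "heis_mat k ** A = mat 1"
      by (simp_all add: h(2) heis_mat_mult heis_mat_0)
    moreover have "\<forall>i j. A $ i $ j \<in> gaussian_integers" "\<forall>i j. heis_mat k $ i $ j \<in> gaussian_integers"
      using h k heis_mat_gaussian by auto
    ultimately show "A \<in> Iw_lattice"
      unfolding Iw_lattice_def GL3_gaussian_def h(2) by blast
  qed
qed

lemma Iw_proj_eq: "Iw_proj z = (\<lambda>h. heis_mult h z) ` gaussian_points"
proof -
  have "Iw_proj z = (\<lambda>A. heis_coord (A ** heis_mat z)) ` heis_mat ` gaussian_points"
    unfolding Iw_proj_def Iw_lattice_eq by blast
  then show ?thesis by (simp add: image_image heis_mat_mult heis_coord_heis_mat)
qed

text \<open>The orbit relation of the lattice, written without quantifying over group elements: the element taking \<open>z\<close> to \<open>w\<close>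
is determined by \<open>z\<close> and \<open>w\<close>, and the three numbers below are its coordinates.  In this form the relation is visibly
closed, and this makes the quotient Hausdorff.\<close>

definition orbit_rel :: "((complex ^ 3) \<times> (complex ^ 3)) set" where
  "orbit_rel = {(z, w). w $ 1 - z $ 1 \<in> gaussian_integers \<and> w $ 2 - z $ 2 \<in> gaussian_integers \<and>
     w $ 3 - z $ 3 - (w $ 1 - z $ 1) * z $ 2 \<in> gaussian_integers}"

lemma orbit_rel_iff: "(z, w) \<in> orbit_rel \<longleftrightarrow> (\<exists>h\<in>gaussian_points. w = heis_mult h z)"
proof
  assume *: "(z, w) \<in> orbit_rel"
  let ?h = "vector [w $ 1 - z $ 1, w $ 2 - z $ 2, w $ 3 - z $ 3 - (w $ 1 - z $ 1) * z $ 2] :: complex ^ 3"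
  have "?h \<in> gaussian_points" "w = heis_mult ?h z"
    using * by (auto simp: gaussian_points_def orbit_rel_def forall_3 vec3_eq_iff)
  then show "\<exists>h\<in>gaussian_points. w = heis_mult h z" by blast
qed (auto simp: orbit_rel_def gaussian_points_def)

lemma orbit_rel_refl: "(z, z) \<in> orbit_rel"
  by (simp add: orbit_rel_def gaussian_integers_closed)

lemma orbit_rel_trans:
  assumes "(z, w) \<in> orbit_rel" "(w, x) \<in> orbit_rel"
  shows "(z, x) \<in> orbit_rel"
proof -
  have *: "x $ 1 - z $ 1 = (x $ 1 - w $ 1) + (w $ 1 - z $ 1)"
    "x $ 2 - z $ 2 = (x $ 2 - w $ 2) + (w $ 2 - z $ 2)"
    "x $ 3 - z $ 3 - (x $ 1 - z $ 1) * z $ 2 = ((x $ 3 - w $ 3 - (x $ 1 - w $ 1) * w $ 2)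
      + (w $ 3 - z $ 3 - (w $ 1 - z $ 1) * z $ 2)) + (x $ 1 - w $ 1) * (w $ 2 - z $ 2)"
    by (simp_all add: algebra_simps)
  have "x $ 1 - z $ 1 \<in> gaussian_integers" "x $ 2 - z $ 2 \<in> gaussian_integers"
    unfolding *(1,2)  using assms
    by (intro gaussian_integers_closed(3); simp add: orbit_rel_def)+
  moreover have "x $ 3 - z $ 3 - (x $ 1 - z $ 1) * z $ 2 \<in> gaussian_integers"
    unfolding *(3) using assms
    by (intro gaussian_integers_closed(3) gaussian_integers_closed(5); simp add: orbit_rel_def)
  ultimately show ?thesis by (simp add: orbit_rel_def)
qed

lemma orbit_rel_sym:
  assumes "(z, w) \<in> orbit_rel"
  shows "(w, z) \<in> orbit_rel"
proof -
  have *: "z $ 1 - w $ 1 = - (w $ 1 - z $ 1)" "z $ 2 - w $ 2 = - (w $ 2 - z $ 2)"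
    "z $ 3 - w $ 3 - (z $ 1 - w $ 1) * w $ 2 =
      - (w $ 3 - z $ 3 - (w $ 1 - z $ 1) * z $ 2) + (w $ 1 - z $ 1) * (w $ 2 - z $ 2)"
    by (simp_all add: algebra_simps)
  have "z $ 1 - w $ 1 \<in> gaussian_integers" "z $ 2 - w $ 2 \<in> gaussian_integers"
    unfolding *(1,2) using assms by (auto simp: orbit_rel_def intro!: gaussian_integers_closed(6) simp del: minus_diff_eq)
  moreover have "z $ 3 - w $ 3 - (z $ 1 - w $ 1) * w $ 2 \<in> gaussian_integers"
    unfolding *(3) using assms
    by (auto simp: orbit_rel_def simp del: minus_diff_eq
        intro!: gaussian_integers_closed(4) gaussian_integers_closed(5))
  ultimately show ?thesis by (simp add: orbit_rel_def)
qed

lemma Iw_proj_eq_Image: "Iw_proj z = orbit_rel `` {z}"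
  unfolding Iw_proj_eq by (auto simp: orbit_rel_iff)

lemma Iw_proj_eq_iff: "Iw_proj z = Iw_proj w \<longleftrightarrow> (z, w) \<in> orbit_rel"
  unfolding Iw_proj_eq_Image
  using orbit_rel_refl orbit_rel_sym orbit_rel_trans by blast

lemma Iw_proj_heis_mult: "h \<in> gaussian_points \<Longrightarrow> Iw_proj (heis_mult h z) = Iw_proj z"
  using Iw_proj_eq_iff orbit_rel_iff by metis

lemma Iw_proj_eqD: "Iw_proj z = Iw_proj w \<Longrightarrow> \<exists>h\<in>gaussian_points. w = heis_mult h z"
  using Iw_proj_eq_iff orbit_rel_iff by metis

lemma closed_orbit_rel: "closed orbit_rel"
proof -
  have "orbit_rel = (\<lambda>p. snd p $ 1 - fst p $ 1) -` gaussian_integers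
      \<inter> (\<lambda>p. snd p $ 2 - fst p $ 2) -` gaussian_integers
      \<inter> (\<lambda>p. snd p $ 3 - fst p $ 3 - (snd p $ 1 - fst p $ 1) * fst p $ 2) -` gaussian_integers"
    by (auto simp: orbit_rel_def)
  moreover have "closed \<dots>"
    by (intro closed_Int closed_vimage closed_gaussian_integers continuous_intros)
  ultimately show ?thesis by simp
qed

lemma openin_Iw_top: "openin Iw_top U \<longleftrightarrow> U \<subseteq> range Iw_proj \<and> open (Iw_proj -` U)"
proof -
  have "istopology (\<lambda>U. U \<subseteq> range Iw_proj \<and> open (Iw_proj -` U))"
    unfolding istopology_def by (auto simp: vimage_Union)
  then show ?thesis unfolding Iw_top_def by (simp add: topology_inverse')
qed

lemma topspace_Iw_top: "topspace Iw_top = range Iw_proj"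
proof -
  have "openin Iw_top (range Iw_proj)"
  proof -
    have "Iw_proj -` range Iw_proj = UNIV" by blast
    then show ?thesis by (simp add: openin_Iw_top)
  qed
  then show ?thesis
    by (meson openin_Iw_top openin_subset openin_topspace subset_antisym)
qed

lemma open_heis_mult_vimage: "open V \<Longrightarrow> open (heis_mult h -` V)"
  using continuous_on_heis_mult by (simp add: continuous_on_open_vimage)

lemma open_Iw_proj_saturation:
  assumes "open V"
  shows "open (Iw_proj -` (Iw_proj ` V))"
proof -
  have "Iw_proj -` (Iw_proj ` V) = (\<Union>h\<in>gaussian_points. heis_mult h -` V)"
  proof (intro subset_antisym subsetI)
    fix x assume "x \<in> Iw_proj -` (Iw_proj ` V)"
    then obtain y where y: "y \<in> V" "Iw_proj x = Iw_proj y" by (auto simp: image_iff)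
    obtain h where "h \<in> gaussian_points" "y = heis_mult h x" using Iw_proj_eqD[OF y(2)] by auto
    with y(1) show "x \<in> (\<Union>h\<in>gaussian_points. heis_mult h -` V)" by auto
  next
    fix x assume "x \<in> (\<Union>h\<in>gaussian_points. heis_mult h -` V)"
    then obtain h where "h \<in> gaussian_points" "heis_mult h x \<in> V" by auto
    then show "x \<in> Iw_proj -` (Iw_proj ` V)" using Iw_proj_heis_mult[of h x] by (metis imageI vimageI)
  qed
  then show ?thesis using assms open_heis_mult_vimage by auto
qed

lemma openin_Iw_proj_image: "open V \<Longrightarrow> openin Iw_top (Iw_proj ` V)"
  by (auto simp: openin_Iw_top open_Iw_proj_saturation)

lemma continuous_map_Iw_proj: "continuous_map euclidean Iw_top Iw_proj"
  unfolding continuous_map_def by (simp add: topspace_Iw_top openin_Iw_top vimage_def)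

lemma Hausdorff_Iw_top: "Hausdorff_space Iw_top"
  unfolding Hausdorff_space_def
proof (intro allI impI)
  fix p q assume "p \<in> topspace Iw_top \<and> q \<in> topspace Iw_top \<and> p \<noteq> q"
  then obtain z w where zw: "p = Iw_proj z" "q = Iw_proj w" "Iw_proj z \<noteq> Iw_proj w"
    by (auto simp: topspace_Iw_top)
  then have "(z, w) \<in> - orbit_rel" by (simp add: Iw_proj_eq_iff)
  then obtain U V where UV: "open U" "open V" "z \<in> U" "w \<in> V" "U \<times> V \<subseteq> - orbit_rel"
    using open_prod_elim[OF open_Compl[OF closed_orbit_rel]] by (metis mem_Sigma_iff)
  have "disjnt (Iw_proj ` U) (Iw_proj ` V)"
  proof -
    have "Iw_proj x \<noteq> Iw_proj y" if "x \<in> U" "y \<in> V" for x y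
      using UV(5) that unfolding Iw_proj_eq_iff by blast
    then show ?thesis by (auto simp only: disjnt_def)
  qed
  with UV zw show "\<exists>U V. openin Iw_top U \<and> openin Iw_top V \<and> p \<in> U \<and> q \<in> V \<and> disjnt U V"
    by (intro exI[of _ "Iw_proj ` U"] exI[of _ "Iw_proj ` V"]) (auto intro: openin_Iw_proj_image)
qed

lemma second_countable_euclidean: "second_countable (euclidean :: 'a::second_countable_topology topology)"
proof -
  obtain B :: "'a set set" where "countable B" "topological_basis B"
    using ex_countable_basis by blast
  then show ?thesis unfolding second_countable_def
    by (metis open_openin topological_basisE topological_basis_open)
qed

lemma second_countable_Iw_top: "second_countable Iw_top"
  by (rule second_countable_open_map_image[OF continuous_map_Iw_proj])
     (auto simp: open_map_def openin_Iw_proj_image topspace_Iw_top intro!: second_countable_euclidean)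

definition lift_chart :: "(complex ^ 3) set \<Rightarrow> ((complex ^ 3) set, complex ^ 3) chart" where
  "lift_chart V = (Iw_proj ` V, inv_into V Iw_proj)"

definition evenly_covered :: "(complex ^ 3) set \<Rightarrow> bool" where
  "evenly_covered V \<longleftrightarrow> open V \<and> inj_on Iw_proj V"

lemma Iw_charts_eq: "Iw_charts = lift_chart ` Collect evenly_covered"
  unfolding Iw_charts_def lift_chart_def evenly_covered_def by (rule setcompr_eq_image)

text \<open>Two points of the ball have distance less than \<open>1\<close>, so the differences of their coordinates have norm less than
\<open>1\<close>, whereas for equivalent points the first two, and if these vanish also the third, are Gaussian integers.\<close>

lemma evenly_covered_ball: "evenly_covered (ball z (1 / 4))"
  unfolding evenly_covered_def
proof (intro conjI inj_onI)
  fix x y assume xy: "x \<in> ball z (1 / 4)" "y \<in> ball z (1 / 4)" "Iw_proj x = Iw_proj y"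
  have "dist x y < 1" using xy(1,2) dist_triangle2[of x y z] by (simp add: dist_commute)
  then have lt: "norm (y $ i - x $ i) < 1" for i
    using Finite_Cartesian_Product.norm_nth_le[of "y - x" i] by (simp add: dist_norm norm_minus_commute)
  have R: "(x, y) \<in> orbit_rel" using xy(3) Iw_proj_eq_iff by blast
  have 1: "y $ 1 - x $ 1 = 0" and 2: "y $ 2 - x $ 2 = 0"
    using R gaussian_integer_small[OF _ lt] by (simp_all add: orbit_rel_def)
  then have "y $ 3 - x $ 3 = 0"
    using R lt[of 3] gaussian_integer_small[of "y $ 3 - x $ 3"] by (auto simp: orbit_rel_def)
  with 1 2 show "x = y" by (simp add: vec3_eq_iff)
qed simp

context
  fixes V assumes V: "evenly_covered V"
begin

lemma chart_image_lift: "chart_image (lift_chart V) = V"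
  using V by (auto simp: chart_image_def lift_chart_def evenly_covered_def)

lemma homeomorphic_map_lift:
  "homeomorphic_map (subtopology Iw_top (fst (lift_chart V))) (top_of_set (chart_image (lift_chart V)))
     (snd (lift_chart V))"
proof -
  have inj: "inj_on Iw_proj V" and op: "open V" using V by (auto simp: evenly_covered_def)
  have sub: "topspace (subtopology Iw_top (Iw_proj ` V)) = Iw_proj ` V"
    by (auto simp: topspace_Iw_top)
  have "homeomorphic_maps (top_of_set V) (subtopology Iw_top (Iw_proj ` V)) Iw_proj (inv_into V Iw_proj)"
    unfolding homeomorphic_maps_def
  proof (intro conjI)
    show "continuous_map (top_of_set V) (subtopology Iw_top (Iw_proj ` V)) Iw_proj"
      by (auto simp: continuous_map_in_subtopology continuous_map_Iw_proj
          intro: continuous_map_from_subtopology)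
    have "openin (subtopology Iw_top (Iw_proj ` V)) {x \<in> Iw_proj ` V. inv_into V Iw_proj x \<in> U}"
      if "openin (top_of_set V) U" for U
    proof -
      have U: "open U" "U \<subseteq> V" using that op openin_open_eq by blast+
      have "{x \<in> Iw_proj ` V. inv_into V Iw_proj x \<in> U} = Iw_proj ` U"
        using U inj by (auto simp: inv_into_f_f)
      moreover have "Iw_proj ` U \<subseteq> Iw_proj ` V" using U by blast
      ultimately show ?thesis
        using openin_Iw_proj_image[OF U(1)] openin_Iw_proj_image[OF op]
        by (simp add: openin_open_subtopology)
    qed
    then show "continuous_map (subtopology Iw_top (Iw_proj ` V)) (top_of_set V) (inv_into V Iw_proj)"
      unfolding continuous_map sub by (auto simp: inv_into_into)
  qed (use inj sub in \<open>auto simp: f_inv_into_f\<close>)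
  then have "homeomorphic_map (subtopology Iw_top (Iw_proj ` V)) (top_of_set V) (inv_into V Iw_proj)"
    using homeomorphic_maps_map by blast
  then show ?thesis unfolding chart_image_lift by (simp add: lift_chart_def)
qed

context
  fixes V' assumes V': "evenly_covered V'"
begin

lemma overlap_lift: "overlap (lift_chart V) (lift_chart V') = {x \<in> V. Iw_proj x \<in> Iw_proj ` V'}"
proof -
  have "inv_into V Iw_proj (Iw_proj x) = x" if "x \<in> V" for x
    using V that by (simp add: evenly_covered_def)
  then have "inv_into V Iw_proj ` (Iw_proj ` V \<inter> S) = {x \<in> V. Iw_proj x \<in> S}" for S
    by force
  then show ?thesis by (simp add: overlap_def lift_chart_def)
qed

lemma transition_lift:
  assumes "x \<in> V"
  shows "transition (lift_chart V) (lift_chart V') x = inv_into V' Iw_proj (Iw_proj x)"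
proof -
  have "bij_betw Iw_proj V (Iw_proj ` V)" using V by (simp add: evenly_covered_def bij_betw_def)
  then show ?thesis
    using assms by (simp add: transition_def lift_chart_def inv_into_inv_into_eq)
qed

text \<open>The transition map carries \<open>x\<close> to the unique equivalent point of \<open>V'\<close>.  The lattice element that does this for
one \<open>x\<close> does it for all nearby points.\<close>

lemma transition_locally_translation:
  assumes "x \<in> overlap (lift_chart V) (lift_chart V')"
  shows "\<exists>h\<in>gaussian_points. \<exists>W. open W \<and> x \<in> W \<and> W \<subseteq> V \<and>
    (\<forall>y\<in>W. heis_mult h y \<in> V' \<and> transition (lift_chart V) (lift_chart V') y = heis_mult h y)"
proof -
  obtain x' where x': "x' \<in> V'" "Iw_proj x = Iw_proj x'" and x: "x \<in> V"
    using assms unfolding overlap_lift by blast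
  obtain h where h: "h \<in> gaussian_points" "x' = heis_mult h x" using Iw_proj_eqD[OF x'(2)] by blast
  let ?W = "V \<inter> heis_mult h -` V'"
  have "inv_into V' Iw_proj (Iw_proj y) = heis_mult h y" if "heis_mult h y \<in> V'" for y
    using that V' Iw_proj_heis_mult[OF h(1)] inv_into_f_f[of Iw_proj V' "heis_mult h y"]
    by (simp add: evenly_covered_def)
  then have "open ?W \<and> x \<in> ?W \<and> ?W \<subseteq> V \<and>
    (\<forall>y\<in>?W. heis_mult h y \<in> V' \<and> transition (lift_chart V) (lift_chart V') y = heis_mult h y)"
    using V V' x x' h open_heis_mult_vimage transition_lift by (auto simp: evenly_covered_def)
  with h(1) show ?thesis by blast
qed

lemma transition_derivative:
  assumes "x \<in> overlap (lift_chart V) (lift_chart V')"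
  shows "\<exists>h\<in>gaussian_points. transition (lift_chart V) (lift_chart V') x = heis_mult h x \<and>
    frechet_derivative (transition (lift_chart V) (lift_chart V')) (at x) = shear (h $ 1)"
proof -
  obtain h W where h: "h \<in> gaussian_points" "open W" "x \<in> W"
    "\<And>y. y \<in> W \<Longrightarrow> transition (lift_chart V) (lift_chart V') y = heis_mult h y"
    using transition_locally_translation[OF assms] by meson
  have "(transition (lift_chart V) (lift_chart V') has_derivative shear (h $ 1)) (at x)"
    using has_derivative_transform_within_open[OF has_derivative_heis_mult h(2,3)] h(4) by metis
  then have "frechet_derivative (transition (lift_chart V) (lift_chart V')) (at x) = shear (h $ 1)"
    by (simp add: frechet_derivative_at[symmetric])
  with h show ?thesis by blast
qed

lemma smooth_on_transition:
  "smooth_on (overlap (lift_chart V) (lift_chart V')) (transition (lift_chart V) (lift_chart V'))"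
proof (rule smooth_on_local)
  fix x assume "x \<in> overlap (lift_chart V) (lift_chart V')"
  then obtain h W where "open W" "x \<in> W"
    "\<And>y. y \<in> W \<Longrightarrow> transition (lift_chart V) (lift_chart V') y = heis_mult h y"
    using transition_locally_translation by meson
  then show "\<exists>W. open W \<and> x \<in> W \<and> smooth_on W (transition (lift_chart V) (lift_chart V'))"
    by (metis smooth_on_cong smooth_on_heis_mult)
qed

end
end

theorem smooth_manifold_Iwasawa: "smooth_manifold Iw_top Iw_charts"
  unfolding smooth_manifold_def
proof (intro conjI)
  show "\<Union> (fst ` Iw_charts) = topspace Iw_top"
  proof
    show "topspace Iw_top \<subseteq> \<Union> (fst ` Iw_charts)"
    proof
      fix p assume "p \<in> topspace Iw_top"
      then obtain z where "p = Iw_proj z" by (auto simp: topspace_Iw_top)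
      then have "p \<in> fst (lift_chart (ball z (1 / 4)))" by (simp add: lift_chart_def)
      then show "p \<in> \<Union> (fst ` Iw_charts)"
        using evenly_covered_ball[of z] unfolding Iw_charts_eq by blast
    qed
  qed (auto simp: Iw_charts_eq lift_chart_def topspace_Iw_top)
  show "\<forall>c\<in>Iw_charts. openin Iw_top (fst c) \<and> open (chart_image c) \<and>
    homeomorphic_map (subtopology Iw_top (fst c)) (top_of_set (chart_image c)) (snd c)"
    unfolding Iw_charts_eq
    using homeomorphic_map_lift chart_image_lift
    by (auto simp: lift_chart_def evenly_covered_def openin_Iw_proj_image)
  show "\<forall>c\<in>Iw_charts. \<forall>c'\<in>Iw_charts. smooth_on (overlap c c') (transition c c')"
    unfolding Iw_charts_eq using smooth_on_transition by blast
qed (rule Hausdorff_Iw_top second_countable_Iw_top)+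

section \<open>The complex structures in a left-invariant frame\<close>

text \<open>The value at the origin of the coframe \<open>\<eta>\<^sub>1, \<eta>\<^sub>2, \<theta>\<close>.\<close>

definition Nak_L :: "complex ^ 2 ^ 3 \<Rightarrow> complex ^ 3 \<Rightarrow> complex ^ 3" where
  "Nak_L t u = vector
     [u $ 1 + (t $ 1 $ 1 * cnj (u $ 1) + t $ 1 $ 2 * cnj (u $ 2)),
      u $ 2 + (t $ 2 $ 1 * cnj (u $ 1) + t $ 2 $ 2 * cnj (u $ 2)),
      u $ 3 + (t $ 3 $ 1 * cnj (u $ 1) + t $ 3 $ 2 * cnj (u $ 2)) - Nak_D t * cnj (u $ 3)]"

text \<open>The factor by which \<open>d\<zeta>\<close> differs from the left-invariant coframe:
\<open>d\<zeta>\<^sub>3 = \<theta> + z\<^sub>1 \<eta>\<^sub>2 + (t\<^sub>2\<^sub>1 cnj z\<^sub>1 + t\<^sub>2\<^sub>2 cnj z\<^sub>2) \<eta>\<^sub>1\<close>.  Since it is complex-linear and invertible, \<open>\<zeta>\<close> and the coframe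
define the same complex structure.\<close>

definition Nak_W :: "complex ^ 2 ^ 3 \<Rightarrow> complex ^ 3 \<Rightarrow> complex ^ 3 \<Rightarrow> complex ^ 3" where
  "Nak_W t z p = vector
     [p $ 1, p $ 2, p $ 3 + z $ 1 * p $ 2 + (t $ 2 $ 1 * cnj (z $ 1) + t $ 2 $ 2 * cnj (z $ 2)) * p $ 1]"

text \<open>With \<open>T\<close> the matrix of the \<open>t\<^sub>i\<^sub>j\<close>, \<open>i, j \<in> {1, 2}\<close>, the first two coframe forms are \<open>\<eta> = u + T cnj u\<close>.  Eliminating
\<open>cnj u\<close> gives \<open>M u = \<eta> - T cnj \<eta>\<close> with \<open>M = 1 - T cnj T\<close>, hence \<open>u = P \<eta> + Q cnj \<eta>\<close> with \<open>P = inverse M\<close> and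
\<open>Q = - P T\<close>.  The entries are spelled out so that they are visibly continuous in \<open>t\<close>.\<close>

definition base_M :: "complex ^ 2 ^ 3 \<Rightarrow> complex ^ 2 ^ 2" where
  "base_M t = vector
     [vector [1 - (t $ 1 $ 1 * cnj (t $ 1 $ 1) + t $ 1 $ 2 * cnj (t $ 2 $ 1)),
              - (t $ 1 $ 1 * cnj (t $ 1 $ 2) + t $ 1 $ 2 * cnj (t $ 2 $ 2))],
      vector [- (t $ 2 $ 1 * cnj (t $ 1 $ 1) + t $ 2 $ 2 * cnj (t $ 2 $ 1)),
              1 - (t $ 2 $ 1 * cnj (t $ 1 $ 2) + t $ 2 $ 2 * cnj (t $ 2 $ 2))]]"

definition base_det :: "complex ^ 2 ^ 3 \<Rightarrow> complex" where
  "base_det t = base_M t $ 1 $ 1 * base_M t $ 2 $ 2 - base_M t $ 1 $ 2 * base_M t $ 2 $ 1"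

definition base_P :: "complex ^ 2 ^ 3 \<Rightarrow> complex ^ 2 ^ 2" where
  "base_P t = vector
     [vector [base_M t $ 2 $ 2 / base_det t, - base_M t $ 1 $ 2 / base_det t],
      vector [- base_M t $ 2 $ 1 / base_det t, base_M t $ 1 $ 1 / base_det t]]"

definition base_Q :: "complex ^ 2 ^ 3 \<Rightarrow> complex ^ 2 ^ 2" where
  "base_Q t = vector
     [vector [- (base_P t $ 1 $ 1 * t $ 1 $ 1 + base_P t $ 1 $ 2 * t $ 2 $ 1),
              - (base_P t $ 1 $ 1 * t $ 1 $ 2 + base_P t $ 1 $ 2 * t $ 2 $ 2)],
      vector [- (base_P t $ 2 $ 1 * t $ 1 $ 1 + base_P t $ 2 $ 2 * t $ 2 $ 1),
              - (base_P t $ 2 $ 1 * t $ 1 $ 2 + base_P t $ 2 $ 2 * t $ 2 $ 2)]]"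

text \<open>The first condition makes the first two coframe forms independent; the second makes
\<open>x \<mapsto> x - D cnj x\<close> invertible and so takes care of the third.\<close>

definition nondegenerate :: "complex ^ 2 ^ 3 \<Rightarrow> bool" where
  "nondegenerate t \<longleftrightarrow> base_det t \<noteq> 0 \<and> norm (Nak_D t) \<noteq> 1"

definition Nak_J0 :: "complex ^ 2 ^ 3 \<Rightarrow> complex ^ 3 \<Rightarrow> complex ^ 3" where
  "Nak_J0 t u = inv (Nak_L t) (\<i> *s Nak_L t u)"

lemma Nak_L_nth [simp]:
  "Nak_L t u $ 1 = u $ 1 + (t $ 1 $ 1 * cnj (u $ 1) + t $ 1 $ 2 * cnj (u $ 2))"
  "Nak_L t u $ 2 = u $ 2 + (t $ 2 $ 1 * cnj (u $ 1) + t $ 2 $ 2 * cnj (u $ 2))"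
  "Nak_L t u $ 3 = u $ 3 + (t $ 3 $ 1 * cnj (u $ 1) + t $ 3 $ 2 * cnj (u $ 2)) - Nak_D t * cnj (u $ 3)"
  by (simp_all add: Nak_L_def)

lemma Nak_W_nth [simp]:
  "Nak_W t z p $ 1 = p $ 1" "Nak_W t z p $ 2 = p $ 2"
  "Nak_W t z p $ 3 = p $ 3 + z $ 1 * p $ 2 + (t $ 2 $ 1 * cnj (z $ 1) + t $ 2 $ 2 * cnj (z $ 2)) * p $ 1"
  by (simp_all add: Nak_W_def)

lemma Nak_zeta_nth:
  "Nak_zeta t z $ 1 = z $ 1 + (t $ 1 $ 1 * cnj (z $ 1) + t $ 1 $ 2 * cnj (z $ 2))"
  "Nak_zeta t z $ 2 = z $ 2 + (t $ 2 $ 1 * cnj (z $ 1) + t $ 2 $ 2 * cnj (z $ 2))"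
  "Nak_zeta t z $ 3 = z $ 3 + ((t $ 3 $ 1 + t $ 2 $ 1 * z $ 1) * cnj (z $ 1)
     + (t $ 3 $ 2 + t $ 2 $ 2 * z $ 1) * cnj (z $ 2)) + Nak_A t z - Nak_D t * cnj (z $ 3)"
  by (simp_all add: Nak_zeta_def)

lemma base_inverse:
  assumes "base_det t \<noteq> 0"
    and e1: "e1 = u1 + (t $ 1 $ 1 * cnj u1 + t $ 1 $ 2 * cnj u2)"
    and e2: "e2 = u2 + (t $ 2 $ 1 * cnj u1 + t $ 2 $ 2 * cnj u2)"
  shows "u1 = base_P t $ 1 $ 1 * e1 + base_P t $ 1 $ 2 * e2
           + base_Q t $ 1 $ 1 * cnj e1 + base_Q t $ 1 $ 2 * cnj e2"
    and "u2 = base_P t $ 2 $ 1 * e1 + base_P t $ 2 $ 2 * e2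
           + base_Q t $ 2 $ 1 * cnj e1 + base_Q t $ 2 $ 2 * cnj e2"
proof -
  let ?M = "base_M t"
  \<comment> \<open>the two entries of \<open>\<eta> - T cnj \<eta>\<close>\<close>
  define a where "a = e1 - t $ 1 $ 1 * cnj e1 - t $ 1 $ 2 * cnj e2"
  define b where "b = e2 - t $ 2 $ 1 * cnj e1 - t $ 2 $ 2 * cnj e2"
  have a: "a = ?M $ 1 $ 1 * u1 + ?M $ 1 $ 2 * u2" and b: "b = ?M $ 2 $ 1 * u1 + ?M $ 2 $ 2 * u2"
    by (simp_all add: a_def b_def e1 e2 base_M_def algebra_simps)
  have "base_det t * u1 = ?M $ 2 $ 2 * a - ?M $ 1 $ 2 * b"
    and "base_det t * u2 = ?M $ 1 $ 1 * b - ?M $ 2 $ 1 * a"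
    unfolding a b base_det_def by (simp_all add: algebra_simps)
  then have "u1 = base_P t $ 1 $ 1 * a + base_P t $ 1 $ 2 * b"
    and "u2 = base_P t $ 2 $ 1 * a + base_P t $ 2 $ 2 * b"
    using assms(1) by (simp_all add: base_P_def field_simps)
  then show "u1 = base_P t $ 1 $ 1 * e1 + base_P t $ 1 $ 2 * e2
           + base_Q t $ 1 $ 1 * cnj e1 + base_Q t $ 1 $ 2 * cnj e2"
    and "u2 = base_P t $ 2 $ 1 * e1 + base_P t $ 2 $ 2 * e2
           + base_Q t $ 2 $ 1 * cnj e1 + base_Q t $ 2 $ 2 * cnj e2"
    by (simp_all add: a_def b_def base_Q_def algebra_simps)
qed

lemma eq_mult_cnj_imp_0:
  assumes "norm d \<noteq> 1" "x = d * cnj x"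
  shows "x = 0"
proof -
  have "norm x = norm d * norm x" by (subst assms(2)) (simp add: norm_mult)
  then show ?thesis using assms(1) by simp
qed

lemma linear_Nak_L: "linear (Nak_L t)"
  by (rule linearI) (simp_all add: vec3_eq_iff algebra_simps scaleR_conv_of_real[where 'a = complex])

lemma inj_Nak_L:
  assumes "nondegenerate t"
  shows "inj (Nak_L t)"
  unfolding linear_injective_0[OF linear_Nak_L]
proof (intro allI impI)
  fix u assume 0: "Nak_L t u = 0"
  have L0: "Nak_L t u $ 1 = 0" "Nak_L t u $ 2 = 0" "Nak_L t u $ 3 = 0" using 0 by (simp_all del: Nak_L_nth)
  have det: "base_det t \<noteq> 0" using assms by (simp add: nondegenerate_def)
  have u12: "u $ 1 = 0" "u $ 2 = 0"
    using base_inverse[OF det L0(1)[unfolded Nak_L_nth, symmetric] L0(2)[unfolded Nak_L_nth, symmetric]]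
    by (simp_all only: complex_cnj_zero mult_zero_right add_0)
  have "u $ 3 = Nak_D t * cnj (u $ 3)" using L0(3) by (simp add: u12)
  then have "u $ 3 = 0" using eq_mult_cnj_imp_0 assms unfolding nondegenerate_def by blast
  with u12 show "u = 0" by (simp add: vec3_eq_iff)
qed

lemma bij_Nak_L: "nondegenerate t \<Longrightarrow> bij (Nak_L t)"
  using inj_Nak_L linear_injective_imp_surjective[OF linear_Nak_L] by (simp add: bij_def)

lemma Nak_L_J0: "nondegenerate t \<Longrightarrow> Nak_L t (Nak_J0 t u) = \<i> *s Nak_L t u"
  using bij_Nak_L[of t] by (simp add: Nak_J0_def bij_def surj_f_inv_f)

lemma Nak_J0_J0: "nondegenerate t \<Longrightarrow> Nak_J0 t (Nak_J0 t u) = - u"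
proof -
  assume t: "nondegenerate t"
  have "Nak_L t (Nak_J0 t (Nak_J0 t u)) = Nak_L t (- u)"
    by (simp add: Nak_L_J0[OF t] linear_neg[OF linear_Nak_L] vec3_eq_iff)
  then show ?thesis using inj_Nak_L[OF t] by (simp add: inj_eq)
qed

lemma linear_Nak_J0: "nondegenerate t \<Longrightarrow> linear (Nak_J0 t)"
proof -
  assume t: "nondegenerate t"
  have inj: "Nak_L t x = Nak_L t y \<longleftrightarrow> x = y" for x y using inj_Nak_L[OF t] by (simp add: inj_eq)
  show ?thesis
  proof (rule linearI)
    fix x y and r :: real
    have "Nak_L t (Nak_J0 t (x + y)) = Nak_L t (Nak_J0 t x + Nak_J0 t y)"
      by (simp add: linear_add[OF linear_Nak_L] Nak_L_J0[OF t] vec3_eq_iff algebra_simps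
               del: Nak_L_nth)
    then show "Nak_J0 t (x + y) = Nak_J0 t x + Nak_J0 t y" by (simp only: inj)
    have "Nak_L t (Nak_J0 t (r *\<^sub>R x)) = Nak_L t (r *\<^sub>R Nak_J0 t x)"
      by (simp add: linear_scale[OF linear_Nak_L] Nak_L_J0[OF t] vec3_eq_iff del: Nak_L_nth)
    then show "Nak_J0 t (r *\<^sub>R x) = r *\<^sub>R Nak_J0 t x" by (simp only: inj)
  qed
qed

lemma vec3_axis_sum: "v = axis 1 (v $ 1) + (axis 2 (v $ 2) + axis 3 (v $ 3))"
  for v :: "'a::real_vector ^ 3"
  by (simp add: vec3_eq_iff) (simp add: axis_def)

lemma has_derivative_vec3I:
  fixes f :: "'a::real_normed_vector \<Rightarrow> 'b::euclidean_space ^ 3"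
  assumes "((\<lambda>x. f x $ 1) has_derivative (\<lambda>v. f' v $ 1)) F"
    and "((\<lambda>x. f x $ 2) has_derivative (\<lambda>v. f' v $ 2)) F"
    and "((\<lambda>x. f x $ 3) has_derivative (\<lambda>v. f' v $ 3)) F"
  shows "(f has_derivative f') F"
proof -
  have "((\<lambda>x. axis (1::3) (f x $ 1) + (axis 2 (f x $ 2) + axis 3 (f x $ 3))) has_derivative
      (\<lambda>v. axis (1::3) (f' v $ 1) + (axis 2 (f' v $ 2) + axis 3 (f' v $ 3)))) F"
    by (intro has_derivative_add bounded_linear.has_derivative[OF bounded_linear_axis] assms)
  then show ?thesis by (simp flip: vec3_axis_sum)
qed

lemma smooth_on_vec3I:
  fixes f :: "'a::real_normed_vector \<Rightarrow> 'b::euclidean_space ^ 3"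
  assumes "open U" "smooth_on U (\<lambda>x. f x $ 1)" "smooth_on U (\<lambda>x. f x $ 2)" "smooth_on U (\<lambda>x. f x $ 3)"
  shows "smooth_on U f"
proof -
  have "smooth_on U (\<lambda>x. axis (1::3) (f x $ 1) + (axis 2 (f x $ 2) + axis 3 (f x $ 3)))"
    by (intro smooth_on_add smooth_on_axis assms)
  then show ?thesis by (simp flip: vec3_axis_sum)
qed

lemma has_derivative_nth_within [derivative_intros]:
  "((\<lambda>x. x $ i) has_derivative (\<lambda>v. v $ i)) F"
  by (rule bounded_linear_imp_has_derivative[OF bounded_linear_vec_nth])

lemma has_derivative_cnj_nth [derivative_intros]:
  "((\<lambda>x. cnj (x $ i)) has_derivative (\<lambda>v. cnj (v $ i))) F"
  by (intro bounded_linear.has_derivative[OF bounded_linear_cnj] has_derivative_nth_within)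

text \<open>The quadratic terms of \<open>\<zeta>\<^sub>3\<close> are chosen such that, modulo complex multiples of \<open>\<eta>\<^sub>1\<close> and \<open>\<eta>\<^sub>2\<close>, its differential is
left-invariant.\<close>

lemma has_derivative_Nak_zeta:
  "(Nak_zeta t has_derivative (\<lambda>v. Nak_W t z (Nak_L t (shear (- z $ 1) v)))) (at z)"
  by (rule has_derivative_vec3I; unfold Nak_zeta_nth Nak_A_def)
     (auto intro!: derivative_eq_intros ext
       simp: algebra_simps Nak_D_def power2_eq_square)

lemma frechet_Nak_zeta:
  "frechet_derivative (Nak_zeta t) (at z) = (\<lambda>v. Nak_W t z (Nak_L t (shear (- z $ 1) v)))"
  using frechet_derivative_at[OF has_derivative_Nak_zeta] by simp

lemma bij_shear: "bij (shear a)"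
  by (rule o_bij[of "shear (- a)"]) (simp_all add: fun_eq_iff)

lemma bij_Nak_W: "bij (Nak_W t z)"
  by (rule o_bij[of "\<lambda>p. vector [p $ 1, p $ 2,
    p $ 3 - z $ 1 * p $ 2 - (t $ 2 $ 1 * cnj (z $ 1) + t $ 2 $ 2 * cnj (z $ 2)) * p $ 1]"])
     (simp_all add: fun_eq_iff vec3_eq_iff)

lemma Nak_W_scale: "Nak_W t z (c *s p) = c *s Nak_W t z p"
  by (simp add: vec3_eq_iff algebra_simps)

lemma bij_frechet_Nak_zeta:
  assumes "nondegenerate t"
  shows "bij (frechet_derivative (Nak_zeta t) (at z))"
  using bij_comp[OF bij_comp[OF bij_shear[of "- z $ 1"] bij_Nak_L[OF assms]] bij_Nak_W[of t z]]
  unfolding frechet_Nak_zeta by (simp add: o_def)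

lemma Nak_J_eq:
  assumes "nondegenerate t"
  shows "Nak_J t c z v = shear (z $ 1) (Nak_J0 t (shear (- z $ 1) v))"
proof -
  let ?F = "frechet_derivative (Nak_zeta t) (at z)"
  have "?F (shear (z $ 1) (Nak_J0 t (shear (- z $ 1) v))) = \<i> *s ?F v"
    by (simp add: frechet_Nak_zeta Nak_L_J0[OF assms] Nak_W_scale)
  then show ?thesis
    unfolding Nak_J_def using bij_frechet_Nak_zeta[OF assms] by (metis bij_inv_eq_iff)
qed

lemma smooth_on_shear:
  "open U \<Longrightarrow> smooth_on U f \<Longrightarrow> smooth_on U g \<Longrightarrow> smooth_on U (\<lambda>x. shear (f x) (g x))"
  unfolding shear_def by (intro smooth_intros)

lemma smooth_on_Nak_zeta: "open U \<Longrightarrow> smooth_on U (Nak_zeta t)"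
  by (rule smooth_on_vec3I; (unfold Nak_zeta_nth Nak_A_def)?) (intro smooth_intros | assumption)+

lemma smooth_on_Nak_J:
  assumes "nondegenerate t" "open U"
  shows "smooth_on U (\<lambda>x. Nak_J t c x v)"
proof -
  have "bounded_linear (Nak_J0 t)"
    using linear_Nak_J0[OF assms(1)] linear_conv_bounded_linear by blast
  then show ?thesis unfolding Nak_J_eq[OF assms(1)] using assms(2)
    by (intro smooth_on_shear smooth_on_bounded_linear[of U "Nak_J0 t"] smooth_intros)
qed

text \<open>The coordinates are global: the first two determine \<open>z\<^sub>1, z\<^sub>2\<close>, and then the third determines \<open>z\<^sub>3 - D cnj z\<^sub>3\<close>.\<close>

lemma inj_Nak_zeta:
  assumes "nondegenerate t"
  shows "inj (Nak_zeta t)"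
proof (rule injI)
  fix z w assume eq: "Nak_zeta t z = Nak_zeta t w"
  have det: "base_det t \<noteq> 0" using assms by (simp add: nondegenerate_def)
  have "Nak_zeta t z $ 1 = Nak_zeta t w $ 1" "Nak_zeta t z $ 2 = Nak_zeta t w $ 2"
    using eq by simp_all
  then have zw: "z $ 1 = w $ 1" "z $ 2 = w $ 2"
    using base_inverse[OF det Nak_zeta_nth(1,2)[of t z]] base_inverse[OF det Nak_zeta_nth(1,2)[of t w]]
    by simp_all
  have "Nak_zeta t z $ 3 = Nak_zeta t w $ 3" using eq by simp
  then have "z $ 3 - w $ 3 = Nak_D t * cnj (z $ 3 - w $ 3)"
    by (simp add: Nak_zeta_nth zw Nak_A_def algebra_simps)
  then have "z $ 3 - w $ 3 = 0" using eq_mult_cnj_imp_0 assms unfolding nondegenerate_def by blast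
  with zw show "z = w" by (simp add: vec3_eq_iff)
qed

lemma holomorphic_coordinates_Nak_zeta:
  assumes "nondegenerate t" "open U"
  shows "holomorphic_coordinates (Nak_J t c) U (Nak_zeta t)"
  unfolding holomorphic_coordinates_def
  using assms inj_Nak_zeta[OF assms(1)] smooth_on_Nak_zeta[OF assms(2)] bij_frechet_Nak_zeta[OF assms(1)]
  by (auto intro: inj_on_subset simp: Nak_J_eq frechet_Nak_zeta Nak_L_J0 Nak_W_scale)

lemma linear_Nak_J: "nondegenerate t \<Longrightarrow> linear (Nak_J t c x)"
proof -
  assume t: "nondegenerate t"
  have "Nak_J t c x = (\<lambda>v. shear (x $ 1) (Nak_J0 t (shear (- x $ 1) v)))"
    using Nak_J_eq[OF t] by blast
  then show ?thesis
    using linear_compose[OF linear_compose[OF linear_shear linear_Nak_J0[OF t]] linear_shear]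
    by (simp add: o_def)
qed

lemma Nak_J_J: "nondegenerate t \<Longrightarrow> Nak_J t c x (Nak_J t c' x v) = - v"
  by (simp add: Nak_J_eq Nak_J0_J0 linear_neg[OF linear_shear])

lemma almost_complex_structure_Nak_J:
  assumes t: "nondegenerate t"
  shows "almost_complex_structure Iw_charts (Nak_J t)"
  unfolding almost_complex_structure_def
proof (intro conjI ballI allI)
  fix c c' x v assume "c \<in> Iw_charts" "c' \<in> Iw_charts" "x \<in> overlap c c'"
  then obtain V V' where "evenly_covered V" "evenly_covered V'" "c = lift_chart V" "c' = lift_chart V'"
    unfolding Iw_charts_eq by auto
  then obtain h where "transition c c' x = heis_mult h x"
    "frechet_derivative (transition c c') (at x) = shear (h $ 1)"
    using transition_derivative[of V V' x] \<open>x \<in> overlap c c'\<close> by auto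
  then show "frechet_derivative (transition c c') (at x) (Nak_J t c x v) =
    Nak_J t c' (transition c c' x) (frechet_derivative (transition c c') (at x) v)"
    by (simp add: Nak_J_eq[OF t])
next
  fix c v assume "c \<in> Iw_charts"
  then have "open (chart_image c)"
    by (auto simp: Iw_charts_eq chart_image_lift evenly_covered_def)
  then show "smooth_on (chart_image c) (\<lambda>x. Nak_J t c x v)"
    by (rule smooth_on_Nak_J[OF t])
qed (simp_all add: linear_Nak_J Nak_J_J t)

theorem complex_manifold_Nak_J:
  assumes t: "nondegenerate t"
  shows "complex_manifold Iw_top Iw_charts (Nak_J t)"
  unfolding complex_manifold_def
proof (intro conjI ballI)
  fix c x assume "c \<in> Iw_charts" "x \<in> chart_image c"
  then have "x \<in> chart_image c" "open (chart_image c)"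
    by (auto simp: Iw_charts_eq chart_image_lift evenly_covered_def)
  then show "\<exists>U f. x \<in> U \<and> U \<subseteq> chart_image c \<and> holomorphic_coordinates (Nak_J t c) U f"
    using holomorphic_coordinates_Nak_zeta[OF t] by blast
qed (intro smooth_manifold_Iwasawa almost_complex_structure_Nak_J t)+

section \<open>Types of alternating forms\<close>

text \<open>The type decomposition acts on the value of a form at one point only, so it is studied for a single endomorphism \<open>j\<close>
of a single tangent space.\<close>

definition pq_at :: "('e \<Rightarrow> 'e) \<Rightarrow> nat \<Rightarrow> nat \<Rightarrow> ('e list \<Rightarrow> complex) \<Rightarrow> 'e list \<Rightarrow> complex" where
  "pq_at j p q a vs =
     (if length vs = p + q then
        \<Sum>S\<in>{S. S \<subseteq> {..<p + q} \<and> card S = p}. \<Sum>T\<in>Pow {..<p + q}.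
          (\<Prod>i\<in>T. if i \<in> S then - \<i> else \<i>) / 2 ^ (p + q) *
          a (map (\<lambda>i. if i \<in> T then j (vs ! i) else vs ! i) [0..<p + q])
      else 0)"

lemma pq_part_eq: "pq_part J p q \<alpha> x vs = pq_at (J x) p q (\<alpha> x) vs"
  by (simp add: pq_part_def pq_at_def)

lemma pq_at_cong:
  assumes "\<And>us. length us = p + q \<Longrightarrow> a us = b us"
  shows "pq_at j p q a vs = pq_at j p q b vs"
  unfolding pq_at_def using assms by simp

lemma pq_at_add: "pq_at j p q (\<lambda>us. a us + b us) vs = pq_at j p q a vs + pq_at j p q b vs"
  by (simp add: pq_at_def sum.distrib distrib_left)

lemma pq_at_diff: "pq_at j p q (\<lambda>us. a us - b us) vs = pq_at j p q a vs - pq_at j p q b vs"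
  by (simp add: pq_at_def sum_subtractf right_diff_distrib)

lemma pq_at_cmult: "pq_at j p q (\<lambda>us. c * a us) vs = c * pq_at j p q a vs"
  by (simp add: pq_at_def sum_distrib_left mult_ac)

text \<open>The sum over the index sets \<open>T\<close> is the expansion of a product with factors \<open>1 + (\<mp>\<i>)(\<plusminus>\<i>)\<close>.  The factor of a slot is
\<open>2\<close> if \<open>S\<close> puts it into the \<open>(1,0)\<close>-slots exactly when its functional is complex-linear, and \<open>0\<close> otherwise.  So
only the summand with \<open>S = H\<close> survives.\<close>

lemma pq_at_product:
  assumes len: "length vs = n" and n: "n = p + q" and H: "H \<subseteq> {..<n}"
    and f: "\<And>i v. i < n \<Longrightarrow> f i (j v) = (if i \<in> H then \<i> else - \<i>) * f i v"
  shows "pq_at j p q (\<lambda>us. \<Prod>i<n. f i (us ! i)) vs =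
    (if card H = p then \<Prod>i<n. f i (vs ! i) else 0)"
proof -
  let ?c = "\<lambda>S i. if i \<in> S then - \<i> else \<i>" and ?e = "\<lambda>i. if i \<in> H then \<i> else - \<i>"
  let ?F = "\<Prod>i<n. f i (vs ! i)"
  have inner: "(\<Prod>i<n. f i (map (\<lambda>i. if i \<in> T then j (vs ! i) else vs ! i) [0..<n] ! i)) =
      (\<Prod>i\<in>T. ?e i) * ?F" if "T \<subseteq> {..<n}" for T
  proof -
    have "(\<Prod>i<n. f i (map (\<lambda>i. if i \<in> T then j (vs ! i) else vs ! i) [0..<n] ! i)) =
      (\<Prod>i<n. (if i \<in> T then ?e i else 1) * f i (vs ! i))"
      by (intro prod.cong) (simp_all add: f)
    also have "\<dots> = (\<Prod>i<n. if i \<in> T then ?e i else 1) * ?F" by (rule prod.distrib)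
    also have "(\<Prod>i<n. if i \<in> T then ?e i else 1) = (\<Prod>i\<in>T. ?e i)"
      using prod.inter_restrict[of "{..<n}" ?e T] that by (simp add: Int_absorb1)
    finally show ?thesis .
  qed
  have T_sum: "(\<Sum>T\<in>Pow {..<n}. (\<Prod>i\<in>T. ?c S i * ?e i)) = (if S = H then 2 ^ n else 0)"
    if S: "S \<subseteq> {..<n}" for S
  proof -
    have "(\<Sum>T\<in>Pow {..<n}. (\<Prod>i\<in>T. ?c S i * ?e i)) = (\<Prod>i<n. 1 + ?c S i * ?e i)"
      using prod_add[of "{..<n}" "\<lambda>i. ?c S i * ?e i" "\<lambda>_. 1"] by (simp add: add.commute)
    also have "\<dots> = (\<Prod>i<n. if i \<in> S \<longleftrightarrow> i \<in> H then 2 else 0)"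
      by (intro prod.cong) auto
    also have "\<dots> = (if S = H then 2 ^ n else 0)"
    proof (cases "S = H")
      case False
      then obtain i where "i < n" "\<not> (i \<in> S \<longleftrightarrow> i \<in> H)" using S H by blast
      then show ?thesis using False by (auto intro!: prod_zero)
    qed simp
    finally show ?thesis .
  qed
  have "pq_at j p q (\<lambda>us. \<Prod>i<n. f i (us ! i)) vs =
    (\<Sum>S\<in>{S. S \<subseteq> {..<n} \<and> card S = p}. \<Sum>T\<in>Pow {..<n}.
       (\<Prod>i\<in>T. ?c S i) / 2 ^ n * ((\<Prod>i\<in>T. ?e i) * ?F))"
    unfolding pq_at_def n[symmetric] len if_P[OF refl]
    by (intro sum.cong refl, subst inner) auto
  also have "\<dots> = (\<Sum>S\<in>{S. S \<subseteq> {..<n} \<and> card S = p}. \<Sum>T\<in>Pow {..<n}.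
       (\<Prod>i\<in>T. ?c S i * ?e i) * (?F / 2 ^ n))"
    unfolding prod.distrib by (intro sum.cong) (simp_all add: field_simps)
  also have "\<dots> = (\<Sum>S\<in>{S. S \<subseteq> {..<n} \<and> card S = p}. (if S = H then 2 ^ n else 0) * (?F / 2 ^ n))"
    unfolding sum_distrib_right[symmetric] by (intro sum.cong refl arg_cong2[of _ _ _ _ "(*)"] T_sum) simp
  also have "\<dots> = (\<Sum>S\<in>{S. S \<subseteq> {..<n} \<and> card S = p}. if S = H then ?F else 0)"
    by (intro sum.cong) auto
  also have "\<dots> = (if card H = p then ?F else 0)"
    using H by (simp add: sum.delta)
  finally show ?thesis .
qed

text \<open>A complex-linear (\<open>b\<close> true) or antilinear (\<open>b\<close> false) functional with respect to \<open>j\<close>.\<close>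

definition of_type :: "('e \<Rightarrow> 'e) \<Rightarrow> bool \<Rightarrow> ('e \<Rightarrow> complex) \<Rightarrow> bool" where
  "of_type j b f \<longleftrightarrow> (\<forall>v. f (j v) = (if b then \<i> else - \<i>) * f v)"

text \<open>The wedge products of two functionals, of a 2-form with a functional and of two 2-forms; the last two are meant for
alternating 2-forms, on lists of length 3 and 4.\<close>

definition w2 :: "('e \<Rightarrow> complex) \<Rightarrow> ('e \<Rightarrow> complex) \<Rightarrow> 'e \<Rightarrow> 'e \<Rightarrow> complex" where
  "w2 f g u v = f u * g v - f v * g u"

definition wedge21 :: "('e \<Rightarrow> 'e \<Rightarrow> complex) \<Rightarrow> ('e \<Rightarrow> complex) \<Rightarrow> 'e list \<Rightarrow> complex" where
  "wedge21 \<beta> f vs = \<beta> (vs ! 0) (vs ! 1) * f (vs ! 2) - \<beta> (vs ! 0) (vs ! 2) * f (vs ! 1)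
     + \<beta> (vs ! 1) (vs ! 2) * f (vs ! 0)"

definition wedge22 :: "('e \<Rightarrow> 'e \<Rightarrow> complex) \<Rightarrow> ('e \<Rightarrow> 'e \<Rightarrow> complex) \<Rightarrow> 'e list \<Rightarrow> complex" where
  "wedge22 \<beta> \<gamma> vs =
     \<beta> (vs ! 0) (vs ! 1) * \<gamma> (vs ! 2) (vs ! 3) - \<beta> (vs ! 0) (vs ! 2) * \<gamma> (vs ! 1) (vs ! 3)
     + \<beta> (vs ! 0) (vs ! 3) * \<gamma> (vs ! 1) (vs ! 2) + \<beta> (vs ! 1) (vs ! 2) * \<gamma> (vs ! 0) (vs ! 3)
     - \<beta> (vs ! 1) (vs ! 3) * \<gamma> (vs ! 0) (vs ! 2) + \<beta> (vs ! 2) (vs ! 3) * \<gamma> (vs ! 0) (vs ! 1)"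

lemma pq_at_products_3:
  assumes "of_type j b0 f0" "of_type j b1 f1" "of_type j b2 f2" "p + q = 3" "length vs = 3"
  shows "pq_at j p q (\<lambda>us. f0 (us ! 0) * f1 (us ! 1) * f2 (us ! 2)) vs =
    (if of_bool b0 + of_bool b1 + of_bool b2 = p
     then f0 (vs ! 0) * f1 (vs ! 1) * f2 (vs ! 2) else 0)"
proof -
  let ?f = "\<lambda>i::nat. [f0, f1, f2] ! i" and ?b = "\<lambda>i::nat. [b0, b1, b2] ! i"
  have less3: "{..<3::nat} = {0, 1, 2}" by auto
  have "?f i (j v) = (if i \<in> {i. i < 3 \<and> ?b i} then \<i> else - \<i>) * ?f i v" if "i < 3" for i v
  proof -
    have "i = 0 \<or> i = 1 \<or> i = 2" using that by linarith
    then show ?thesis using assms(1-3) by (auto simp: of_type_def)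
  qed
  moreover have "{i. i < 3 \<and> ?b i} \<subseteq> {..<3}" by auto
  ultimately have *: "pq_at j p q (\<lambda>us. \<Prod>i<3. ?f i (us ! i)) vs =
      (if card {i. i < 3 \<and> ?b i} = p then \<Prod>i<3. ?f i (vs ! i) else 0)"
    using pq_at_product[OF assms(5) assms(4)[symmetric], of "{i. i < 3 \<and> ?b i}" ?f j] by blast
  have "card {i. i < 3 \<and> ?b i} = (\<Sum>i<3. of_bool (?b i))"
    by (simp add: sum.If_cases of_bool_def Int_def)
  also have "\<dots> = of_bool b0 + of_bool b1 + of_bool b2"
    unfolding less3 by simp
  finally have card: "card {i. i < 3 \<and> ?b i} = of_bool b0 + of_bool b1 + of_bool b2" .
  show ?thesis
    using * unfolding card by (simp add: less3 mult.assoc)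
qed

lemma pq_at_products_4:
  assumes "of_type j b0 f0" "of_type j b1 f1" "of_type j b2 f2" "of_type j b3 f3"
    "p + q = 4" "length vs = 4"
  shows "pq_at j p q (\<lambda>us. f0 (us ! 0) * f1 (us ! 1) * f2 (us ! 2) * f3 (us ! 3)) vs =
    (if of_bool b0 + of_bool b1 + of_bool b2 + of_bool b3 = p
     then f0 (vs ! 0) * f1 (vs ! 1) * f2 (vs ! 2) * f3 (vs ! 3) else 0)"
proof -
  let ?f = "\<lambda>i::nat. [f0, f1, f2, f3] ! i" and ?b = "\<lambda>i::nat. [b0, b1, b2, b3] ! i"
  have less4: "{..<4::nat} = {0, 1, 2, 3}" by auto
  have "?f i (j v) = (if i \<in> {i. i < 4 \<and> ?b i} then \<i> else - \<i>) * ?f i v" if "i < 4" for i v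
  proof -
    have "i = 0 \<or> i = 1 \<or> i = 2 \<or> i = 3" using that by linarith
    then show ?thesis using assms(1-4) by (auto simp: of_type_def)
  qed
  moreover have "{i. i < 4 \<and> ?b i} \<subseteq> {..<4}" by auto
  ultimately have *: "pq_at j p q (\<lambda>us. \<Prod>i<4. ?f i (us ! i)) vs =
      (if card {i. i < 4 \<and> ?b i} = p then \<Prod>i<4. ?f i (vs ! i) else 0)"
    using pq_at_product[OF assms(6) assms(5)[symmetric], of "{i. i < 4 \<and> ?b i}" ?f j] by blast
  have "card {i. i < 4 \<and> ?b i} = (\<Sum>i<4. of_bool (?b i))"
    by (simp add: sum.If_cases of_bool_def Int_def)
  also have "\<dots> = of_bool b0 + of_bool b1 + of_bool b2 + of_bool b3"
    unfolding less4 by simp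
  finally have card: "card {i. i < 4 \<and> ?b i} = of_bool b0 + of_bool b1 + of_bool b2 + of_bool b3"
    by (simp only: add.assoc)
  show ?thesis
    using * unfolding card by (simp add: less4 mult.assoc)
qed

lemma pq_at_wedge21:
  assumes "of_type j bf f" "of_type j bg g" "of_type j bh h" "p + q = 3" "length vs = 3"
  shows "pq_at j p q (wedge21 (w2 f g) h) vs =
    (if of_bool bf + of_bool bg + of_bool bh = p then wedge21 (w2 f g) h vs else 0)"
proof -
  note p = pq_at_products_3[OF _ _ _ assms(4,5)]
  have split: "wedge21 (w2 f g) h = (\<lambda>us.
      f (us ! 0) * g (us ! 1) * h (us ! 2) - g (us ! 0) * f (us ! 1) * h (us ! 2)
    - f (us ! 0) * h (us ! 1) * g (us ! 2) + g (us ! 0) * h (us ! 1) * f (us ! 2)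
    + h (us ! 0) * f (us ! 1) * g (us ! 2) - h (us ! 0) * g (us ! 1) * f (us ! 2))"
    by (simp add: fun_eq_iff wedge21_def w2_def algebra_simps)
  show ?thesis
    unfolding split pq_at_add pq_at_diff p[OF assms(1,2,3)] p[OF assms(2,1,3)] p[OF assms(1,3,2)]
      p[OF assms(2,3,1)] p[OF assms(3,1,2)] p[OF assms(3,2,1)]
    by (cases "of_bool bf + of_bool bg + of_bool bh = p") (simp_all add: add_ac)
qed

lemma pq_at_wedge22:
  assumes "of_type j bf f" "of_type j bg g" "of_type j bh h" "of_type j bk k" "p + q = 4" "length vs = 4"
    and "of_bool bf + of_bool bg + of_bool bh + of_bool bk = p"
  shows "pq_at j p q (wedge22 (w2 f g) (w2 h k)) vs = wedge22 (w2 f g) (w2 h k) vs"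
proof -
  have split: "wedge22 (w2 f g) (w2 h k) = (\<lambda>us.
      f (us ! 0) * g (us ! 1) * h (us ! 2) * k (us ! 3) - g (us ! 0) * f (us ! 1) * h (us ! 2) * k (us ! 3)
    - f (us ! 0) * g (us ! 1) * k (us ! 2) * h (us ! 3) + g (us ! 0) * f (us ! 1) * k (us ! 2) * h (us ! 3)
    - f (us ! 0) * h (us ! 1) * g (us ! 2) * k (us ! 3) + g (us ! 0) * h (us ! 1) * f (us ! 2) * k (us ! 3)
    + f (us ! 0) * k (us ! 1) * g (us ! 2) * h (us ! 3) - g (us ! 0) * k (us ! 1) * f (us ! 2) * h (us ! 3)
    + f (us ! 0) * h (us ! 1) * k (us ! 2) * g (us ! 3) - g (us ! 0) * h (us ! 1) * k (us ! 2) * f (us ! 3)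
    - f (us ! 0) * k (us ! 1) * h (us ! 2) * g (us ! 3) + g (us ! 0) * k (us ! 1) * h (us ! 2) * f (us ! 3)
    + h (us ! 0) * f (us ! 1) * g (us ! 2) * k (us ! 3) - h (us ! 0) * g (us ! 1) * f (us ! 2) * k (us ! 3)
    - k (us ! 0) * f (us ! 1) * g (us ! 2) * h (us ! 3) + k (us ! 0) * g (us ! 1) * f (us ! 2) * h (us ! 3)
    - h (us ! 0) * f (us ! 1) * k (us ! 2) * g (us ! 3) + h (us ! 0) * g (us ! 1) * k (us ! 2) * f (us ! 3)
    + k (us ! 0) * f (us ! 1) * h (us ! 2) * g (us ! 3) - k (us ! 0) * g (us ! 1) * h (us ! 2) * f (us ! 3)
    + h (us ! 0) * k (us ! 1) * f (us ! 2) * g (us ! 3) - h (us ! 0) * k (us ! 1) * g (us ! 2) * f (us ! 3)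
    - k (us ! 0) * h (us ! 1) * f (us ! 2) * g (us ! 3) + k (us ! 0) * h (us ! 1) * g (us ! 2) * f (us ! 3))"
    by (simp add: fun_eq_iff wedge22_def w2_def algebra_simps)
  have p: "pq_at j p q (\<lambda>us. f0 (us ! 0) * f1 (us ! 1) * f2 (us ! 2) * f3 (us ! 3)) vs =
     f0 (vs ! 0) * f1 (vs ! 1) * f2 (vs ! 2) * f3 (vs ! 3)"
    if "of_type j b0 f0" "of_type j b1 f1" "of_type j b2 f2" "of_type j b3 f3"
      "of_bool b0 + of_bool b1 + of_bool b2 + of_bool b3 = p" for f0 f1 f2 f3 b0 b1 b2 b3
    using pq_at_products_4[OF that(1-4) assms(5,6)] that(5) by simp
  show ?thesis
    unfolding split pq_at_add pq_at_diff
    by (intro arg_cong2[of _ _ _ _ "(+)"] arg_cong2[of _ _ _ _ "(-)"];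
        rule p, (rule assms(1-4))+, use assms(7) in linarith)
qed

lemma pq_at_wedge21_cmult:
  "pq_at j p q (wedge21 (\<lambda>u v. c * \<beta> u v) h) vs = c * pq_at j p q (wedge21 \<beta> h) vs"
proof -
  have "wedge21 (\<lambda>u v. c * \<beta> u v) h = (\<lambda>us. c * wedge21 \<beta> h us)"
    by (simp add: fun_eq_iff wedge21_def algebra_simps)
  then show ?thesis by (simp add: pq_at_cmult)
qed

lemma pq_at_wedge21_add:
  "pq_at j p q (wedge21 (\<lambda>u v. \<beta> u v + \<gamma> u v) h) vs =
   pq_at j p q (wedge21 \<beta> h) vs + pq_at j p q (wedge21 \<gamma> h) vs"
proof -
  have "wedge21 (\<lambda>u v. \<beta> u v + \<gamma> u v) h = (\<lambda>us. wedge21 \<beta> h us + wedge21 \<gamma> h us)"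
    by (simp add: fun_eq_iff wedge21_def algebra_simps)
  then show ?thesis by (simp add: pq_at_add)
qed

lemma ext_deriv_2_form:
  "ext_deriv \<alpha> x [v0, v1, v2] =
     frechet_derivative (\<lambda>y. \<alpha> y [v1, v2]) (at x) v0
   - frechet_derivative (\<lambda>y. \<alpha> y [v0, v2]) (at x) v1
   + frechet_derivative (\<lambda>y. \<alpha> y [v0, v1]) (at x) v2"
proof -
  have "{..<3::nat} = {0, 1, 2}" by auto
  then show ?thesis by (simp add: ext_deriv_def numeral_2_eq_2)
qed

lemma ext_deriv_3_form:
  "ext_deriv \<alpha> x [v0, v1, v2, v3] =
     frechet_derivative (\<lambda>y. \<alpha> y [v1, v2, v3]) (at x) v0
   - frechet_derivative (\<lambda>y. \<alpha> y [v0, v2, v3]) (at x) v1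
   + frechet_derivative (\<lambda>y. \<alpha> y [v0, v1, v3]) (at x) v2
   - frechet_derivative (\<lambda>y. \<alpha> y [v0, v1, v2]) (at x) v3"
proof -
  have "{..<4::nat} = {0, 1, 2, 3}" by auto
  then show ?thesis by (simp add: ext_deriv_def numeral_2_eq_2 numeral_3_eq_3)
qed

lemma length_3_conv: "length vs = 3 \<longleftrightarrow> (\<exists>a b c. vs = [a, b, c])"
  by (auto simp: length_Suc_conv numeral_eq_Suc)

lemma length_4_conv: "length vs = 4 \<longleftrightarrow> (\<exists>a b c d. vs = [a, b, c, d])"
  by (auto simp: length_Suc_conv numeral_eq_Suc)

section \<open>The structure equations of the invariant coframe\<close>

definition theta :: "complex ^ 2 ^ 3 \<Rightarrow> complex ^ 3 \<Rightarrow> complex ^ 3 \<Rightarrow> complex" where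
  "theta t x v = Nak_L t (shear (- x $ 1) v) $ 3"

text \<open>The derivative of \<open>theta t x v\<close> with respect to \<open>x\<close> in direction \<open>w\<close>; antisymmetrized, it is the exterior derivative of
\<open>\<theta>\<close>.  It does not depend on \<open>x\<close>.\<close>

definition theta_diff :: "complex ^ 2 ^ 3 \<Rightarrow> complex ^ 3 \<Rightarrow> complex ^ 3 \<Rightarrow> complex" where
  "theta_diff t w v = - (w $ 1 * v $ 2) + Nak_D t * cnj (w $ 1 * v $ 2)"

definition dtheta :: "complex ^ 2 ^ 3 \<Rightarrow> complex ^ 3 \<Rightarrow> complex ^ 3 \<Rightarrow> complex" where
  "dtheta t u v = theta_diff t u v - theta_diff t v u"

definition eta :: "complex ^ 2 ^ 3 \<Rightarrow> 3 \<Rightarrow> complex ^ 3 \<Rightarrow> complex" where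
  "eta t i v = Nak_L t v $ i"

abbreviation eta_bar :: "complex ^ 2 ^ 3 \<Rightarrow> 3 \<Rightarrow> complex ^ 3 \<Rightarrow> complex" where
  "eta_bar t i v \<equiv> cnj (eta t i v)"

text \<open>The coefficients of \<open>\<eta>\<^sub>j \<and> cnj \<eta>\<^sub>k\<close> in \<open>dz\<^sub>1 \<and> dz\<^sub>2\<close>.\<close>

definition base_wedge :: "complex ^ 2 ^ 3 \<Rightarrow> complex ^ 2 ^ 2" where
  "base_wedge t =
     (let P = base_P t; Q = base_Q t in
      vector [vector [P $ 1 $ 1 * Q $ 2 $ 1 - Q $ 1 $ 1 * P $ 2 $ 1, P $ 1 $ 1 * Q $ 2 $ 2 - Q $ 1 $ 2 * P $ 2 $ 1],
              vector [P $ 1 $ 2 * Q $ 2 $ 1 - Q $ 1 $ 1 * P $ 2 $ 2, P $ 1 $ 2 * Q $ 2 $ 2 - Q $ 1 $ 2 * P $ 2 $ 2]])"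

text \<open>The coefficients in \<open>d\<theta> = - dz\<^sub>1 \<and> dz\<^sub>2 + D cnj (dz\<^sub>1 \<and> dz\<^sub>2)\<close> of \<open>\<eta>\<^sub>1 \<and> \<eta>\<^sub>2\<close>, of \<open>cnj \<eta>\<^sub>1 \<and> cnj \<eta>\<^sub>2\<close> and of
\<open>\<eta>\<^sub>i \<and> cnj \<eta>\<^sub>j\<close>.  In the last one the indices of the conjugate term are exchanged, and its sign changes, because
\<open>cnj (\<eta>\<^sub>j \<and> cnj \<eta>\<^sub>i) = - \<eta>\<^sub>i \<and> cnj \<eta>\<^sub>j\<close>.\<close>

definition dtheta_A :: "complex ^ 2 ^ 3 \<Rightarrow> complex" where
  "dtheta_A t = - (base_P t $ 1 $ 1 * base_P t $ 2 $ 2 - base_P t $ 1 $ 2 * base_P t $ 2 $ 1)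
     + Nak_D t * cnj (base_Q t $ 1 $ 1 * base_Q t $ 2 $ 2 - base_Q t $ 1 $ 2 * base_Q t $ 2 $ 1)"

definition dtheta_E :: "complex ^ 2 ^ 3 \<Rightarrow> complex" where
  "dtheta_E t = - (base_Q t $ 1 $ 1 * base_Q t $ 2 $ 2 - base_Q t $ 1 $ 2 * base_Q t $ 2 $ 1)
     + Nak_D t * cnj (base_P t $ 1 $ 1 * base_P t $ 2 $ 2 - base_P t $ 1 $ 2 * base_P t $ 2 $ 1)"

definition dtheta_B :: "complex ^ 2 ^ 3 \<Rightarrow> 2 \<Rightarrow> 2 \<Rightarrow> complex" where
  "dtheta_B t i j = - base_wedge t $ i $ j - Nak_D t * cnj (base_wedge t $ j $ i)"

text \<open>The coefficient of \<open>\<eta>\<^sub>1 \<and> cnj \<eta>\<^sub>1 \<and> \<eta>\<^sub>2 \<and> cnj \<eta>\<^sub>2\<close> in \<open>\<partial> \<partial>-bar (\<theta> \<and> cnj \<theta>)\<close>.\<close>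

definition skt_obstruction :: "complex ^ 2 ^ 3 \<Rightarrow> real" where
  "skt_obstruction t = (norm (dtheta_A t))\<^sup>2 - 2 * Re (dtheta_B t 1 1 * cnj (dtheta_B t 2 2))
     + (norm (dtheta_B t 1 2))\<^sup>2 + (norm (dtheta_B t 2 1))\<^sup>2"

text \<open>The antilinear functionals for which the \<open>(1,1)\<close>-part of \<open>d\<theta>\<close> is \<open>\<eta>\<^sub>1 \<and> S\<^sub>1 + \<eta>\<^sub>2 \<and> S\<^sub>2\<close>.\<close>

definition dtheta_S :: "complex ^ 2 ^ 3 \<Rightarrow> 2 \<Rightarrow> complex ^ 3 \<Rightarrow> complex" where
  "dtheta_S t i v = dtheta_B t i 1 * eta_bar t 1 v + dtheta_B t i 2 * eta_bar t 2 v"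

lemma dz1_wedge_dz2:
  assumes "base_det t \<noteq> 0"
  shows "u $ 1 * v $ 2 - v $ 1 * u $ 2 =
      (base_P t $ 1 $ 1 * base_P t $ 2 $ 2 - base_P t $ 1 $ 2 * base_P t $ 2 $ 1) * w2 (eta t 1) (eta t 2) u v
    + base_wedge t $ 1 $ 1 * w2 (eta t 1) (eta_bar t 1) u v
    + base_wedge t $ 1 $ 2 * w2 (eta t 1) (eta_bar t 2) u v
    + base_wedge t $ 2 $ 1 * w2 (eta t 2) (eta_bar t 1) u v
    + base_wedge t $ 2 $ 2 * w2 (eta t 2) (eta_bar t 2) u v
    + (base_Q t $ 1 $ 1 * base_Q t $ 2 $ 2 - base_Q t $ 1 $ 2 * base_Q t $ 2 $ 1) * w2 (eta_bar t 1) (eta_bar t 2) u v"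
proof -
  have e: "eta t 1 w = w $ 1 + (t $ 1 $ 1 * cnj (w $ 1) + t $ 1 $ 2 * cnj (w $ 2))"
    "eta t 2 w = w $ 2 + (t $ 2 $ 1 * cnj (w $ 1) + t $ 2 $ 2 * cnj (w $ 2))" for w
    by (simp_all add: eta_def)
  note inv = base_inverse[OF assms e]
  show ?thesis
    unfolding inv[of u] inv[of v] base_wedge_def Let_def w2_def vector_2
    by (simp add: algebra_simps)
qed

lemma dtheta_expand:
  assumes "base_det t \<noteq> 0"
  shows "dtheta t u v = dtheta_A t * w2 (eta t 1) (eta t 2) u v
    + (w2 (eta t 1) (dtheta_S t 1) u v + w2 (eta t 2) (dtheta_S t 2) u v)
    + dtheta_E t * w2 (eta_bar t 1) (eta_bar t 2) u v"
proof -
  let ?X = "u $ 1 * v $ 2 - v $ 1 * u $ 2"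
  have "dtheta t u v = - ?X + Nak_D t * cnj ?X"
    by (simp add: dtheta_def theta_diff_def algebra_simps)
  then show ?thesis
    unfolding dz1_wedge_dz2[OF assms]
    by (simp add: w2_def dtheta_A_def dtheta_E_def dtheta_B_def dtheta_S_def algebra_simps)
qed

lemma skt_obstruction_complex:
  "complex_of_real (skt_obstruction t) = dtheta_A t * cnj (dtheta_A t)
     - dtheta_B t 1 1 * cnj (dtheta_B t 2 2) - cnj (dtheta_B t 1 1) * dtheta_B t 2 2
     + dtheta_B t 1 2 * cnj (dtheta_B t 1 2) + dtheta_B t 2 1 * cnj (dtheta_B t 2 1)"
proof -
  have "complex_of_real (2 * Re z) = z + cnj z" for z by (simp add: complex_add_cnj)
  from this[of "dtheta_B t 1 1 * cnj (dtheta_B t 2 2)"] show ?thesis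
    unfolding skt_obstruction_def of_real_add of_real_diff complex_norm_square
    by (simp del: Re_complex_of_real times_complex.sel of_real_mult)
qed

lemma wedge22_bilinear:
  "wedge22 (\<lambda>u v. \<beta> u v + \<beta>' u v) \<gamma> vs = wedge22 \<beta> \<gamma> vs + wedge22 \<beta>' \<gamma> vs"
  "wedge22 (\<lambda>u v. c * \<beta> u v) \<gamma> vs = c * wedge22 \<beta> \<gamma> vs"
  "wedge22 \<beta> (\<lambda>u v. \<gamma> u v + \<gamma>' u v) vs = wedge22 \<beta> \<gamma> vs + wedge22 \<beta> \<gamma>' vs"
  "wedge22 \<beta> (\<lambda>u v. c * \<gamma> u v) vs = c * wedge22 \<beta> \<gamma> vs"
  by (simp_all add: wedge22_def algebra_simps)

lemma wedge22_repeated: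
  "wedge22 (w2 f g) (w2 f k) vs = 0" "wedge22 (w2 f g) (w2 h f) vs = 0"
  "wedge22 (w2 f g) (w2 g k) vs = 0" "wedge22 (w2 f g) (w2 h g) vs = 0"
  by (simp_all add: wedge22_def w2_def algebra_simps)

text \<open>The permutations that turn the nonzero products of four distinct factors from \<open>\<eta>\<^sub>1, cnj \<eta>\<^sub>1, \<eta>\<^sub>2, cnj \<eta>\<^sub>2\<close> into the
product in this order.\<close>

lemma wedge22_permuted:
  "wedge22 (w2 f g) (w2 k h) vs = - wedge22 (w2 f g) (w2 h k) vs"
  "wedge22 (w2 h k) (w2 g f) vs = - wedge22 (w2 f g) (w2 h k) vs"
  "wedge22 (w2 f k) (w2 g h) vs = wedge22 (w2 f g) (w2 h k) vs"
  "wedge22 (w2 h g) (w2 k f) vs = wedge22 (w2 f g) (w2 h k) vs"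
  "wedge22 (w2 g k) (w2 f h) vs = - wedge22 (w2 f g) (w2 h k) vs"
  by (simp_all add: wedge22_def w2_def algebra_simps)

text \<open>The left-hand side is what remains of \<open>\<partial> \<partial>-bar (\<theta> \<and> cnj \<theta>)\<close> after differentiating.  It is a 4-form in
\<open>\<eta>\<^sub>1, \<eta>\<^sub>2\<close> and their conjugates, so after bilinear expansion every summand either repeats a factor and vanishes or is
a multiple of the same form.\<close>

lemma wedge_obstruction:
  assumes "base_det t \<noteq> 0"
  shows "wedge22 (\<lambda>u v. w2 (eta t 1) (dtheta_S t 1) u v + w2 (eta t 2) (dtheta_S t 2) u v) (\<lambda>u v. cnj (dtheta t u v)) vs
    - cnj (dtheta_A t) * wedge22 (w2 (eta_bar t 1) (eta_bar t 2)) (dtheta t) vs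
    = of_real (skt_obstruction t) * wedge22 (w2 (eta t 1) (eta_bar t 1)) (w2 (eta t 2) (eta_bar t 2)) vs"
proof -
  let ?e = "eta t" and ?f = "eta_bar t"
  let ?V = "wedge22 (w2 (?e 1) (?f 1)) (w2 (?e 2) (?f 2)) vs"
  have sig: "w2 (?e i) (dtheta_S t j) u v =
      dtheta_B t j 1 * w2 (?e i) (?f 1) u v + dtheta_B t j 2 * w2 (?e i) (?f 2) u v" for i j u v
    by (simp add: w2_def dtheta_S_def algebra_simps)
  have cnj_w2: "cnj (w2 (?e i) (?e j) u v) = w2 (?f i) (?f j) u v"
    "cnj (w2 (?e i) (?f j) u v) = w2 (?f i) (?e j) u v"
    "cnj (w2 (?f i) (?f j) u v) = w2 (?e i) (?e j) u v" for i j u v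
    by (simp_all add: w2_def)
  have perm: "wedge22 (w2 (?e 1) (?f 1)) (w2 (?f 2) (?e 2)) vs = - ?V"
    "wedge22 (w2 (?e 2) (?f 2)) (w2 (?f 1) (?e 1)) vs = - ?V"
    "wedge22 (w2 (?e 1) (?f 2)) (w2 (?f 1) (?e 2)) vs = ?V"
    "wedge22 (w2 (?e 2) (?f 1)) (w2 (?f 2) (?e 1)) vs = ?V"
    "wedge22 (w2 (?f 1) (?f 2)) (w2 (?e 1) (?e 2)) vs = - ?V"
    by (rule wedge22_permuted)+
  show ?thesis
    unfolding skt_obstruction_complex dtheta_expand[OF assms, abs_def] sig complex_cnj_add complex_cnj_mult
      cnj_w2 wedge22_bilinear wedge22_repeated perm
    by (simp add: algebra_simps)
qed

lemma of_type_cnj: "of_type j b f \<Longrightarrow> of_type j (\<not> b) (\<lambda>v. cnj (f v))"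
  by (auto simp: of_type_def)

lemma of_type_eta:
  assumes "nondegenerate t" "i = 1 \<or> i = 2"
  shows "of_type (Nak_J t c x) True (eta t i)"
proof -
  have "eta t i (shear a v) = eta t i v" for a v using assms(2) by (auto simp: eta_def)
  moreover have "eta t i (Nak_J0 t v) = \<i> * eta t i v" for v
    unfolding eta_def Nak_L_J0[OF assms(1)] by simp
  ultimately show ?thesis by (simp add: of_type_def Nak_J_eq[OF assms(1)])
qed

lemma of_type_eta_bar:
  assumes "nondegenerate t" "i = 1 \<or> i = 2"
  shows "of_type (Nak_J t c x) False (eta_bar t i)"
  using of_type_cnj[OF of_type_eta[OF assms]] by simp

lemma of_type_dtheta_S:
  assumes "nondegenerate t"
  shows "of_type (Nak_J t c x) False (dtheta_S t i)"
  using of_type_eta_bar[OF assms] by (simp add: of_type_def dtheta_S_def algebra_simps)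

lemma of_type_theta:
  assumes "nondegenerate t"
  shows "of_type (Nak_J t c x) True (theta t x)"
  by (simp add: of_type_def theta_def Nak_J_eq[OF assms] Nak_L_J0[OF assms] del: Nak_L_nth)

lemma has_derivative_theta:
  "((\<lambda>y. theta t y v) has_derivative (\<lambda>w. theta_diff t w v)) (at x)"
  unfolding theta_def Nak_L_nth shear_nth theta_diff_def
  by (auto intro!: derivative_eq_intros ext simp: algebra_simps)

lemma has_derivative_cnj_theta:
  "((\<lambda>y. cnj (theta t y v)) has_derivative (\<lambda>w. cnj (theta_diff t w v))) (at x)"
  by (intro bounded_linear.has_derivative[OF bounded_linear_cnj] has_derivative_theta)

text \<open>The shape of the fundamental form of an invariant metric: \<open>K\<close> and \<open>\<mu>\<close> do not depend on the point, so only \<open>\<theta>\<close> is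
differentiated.\<close>

lemma ext_deriv_theta_2_form:
  assumes "\<And>y us. length us = 2 \<Longrightarrow> \<alpha> y us = K (us ! 0) (us ! 1)
      + c * w2 (theta t y) (\<lambda>v. cnj (theta t y v)) (us ! 0) (us ! 1)
      + 1 / 2 * (w2 \<mu> (\<lambda>v. cnj (theta t y v)) (us ! 0) (us ! 1) + w2 (\<lambda>v. cnj (\<mu> v)) (theta t y) (us ! 0) (us ! 1))"
    and "length vs = 3"
  shows "ext_deriv \<alpha> x vs =
      c * (wedge21 (dtheta t) (\<lambda>v. cnj (theta t x v)) vs - wedge21 (\<lambda>u v. cnj (dtheta t u v)) (theta t x) vs)
      - 1 / 2 * (wedge21 (\<lambda>u v. cnj (dtheta t u v)) \<mu> vs + wedge21 (dtheta t) (\<lambda>v. cnj (\<mu> v)) vs)"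
proof -
  have "((\<lambda>y. \<alpha> y [u, v]) has_derivative (\<lambda>w.
      c * (theta_diff t w u * cnj (theta t x v) + theta t x u * cnj (theta_diff t w v)
         - theta_diff t w v * cnj (theta t x u) - theta t x v * cnj (theta_diff t w u))
      + 1 / 2 * (\<mu> u * cnj (theta_diff t w v) - \<mu> v * cnj (theta_diff t w u)
         + cnj (\<mu> u) * theta_diff t w v - cnj (\<mu> v) * theta_diff t w u))) (at x)" for u v
  proof -
    have eq: "\<alpha> y [u, v] = K u v
        + c * (theta t y u * cnj (theta t y v) - theta t y v * cnj (theta t y u))
        + 1 / 2 * ((\<mu> u * cnj (theta t y v) - \<mu> v * cnj (theta t y u))
          + (cnj (\<mu> u) * theta t y v - cnj (\<mu> v) * theta t y u))" for y
      using assms(1)[of "[u, v]" y] by (simp add: w2_def)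
    show ?thesis
      unfolding eq
      by (rule derivative_eq_intros has_derivative_theta has_derivative_cnj_theta refl)+
         (simp add: fun_eq_iff algebra_simps)
  qed
  note D = frechet_derivative_at[OF this, symmetric]
  obtain v0 v1 v2 where vs: "vs = [v0, v1, v2]" using iffD1[OF length_3_conv assms(2)] by (elim exE)
  show ?thesis
    unfolding vs ext_deriv_2_form D by (simp add: wedge21_def dtheta_def algebra_simps)
qed

lemma has_derivative_wedge21:
  assumes "\<And>v. ((\<lambda>y. f y v) has_derivative (\<lambda>w. f' w v)) (at x)"
  shows "((\<lambda>y. wedge21 \<beta> (f y) us) has_derivative (\<lambda>w. wedge21 \<beta> (f' w) us)) (at x)"
  unfolding wedge21_def by (intro derivative_intros assms)

lemma ext_deriv_theta_3_form:
  assumes "\<And>y us. length us = 3 \<Longrightarrow> \<alpha> y us = K us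
      + c * (wedge21 \<beta> (\<lambda>v. cnj (theta t y v)) us - d * wedge21 \<gamma> (theta t y) us)"
    and "length vs = 4"
  shows "ext_deriv \<alpha> x vs =
      c * (wedge22 \<beta> (\<lambda>u v. cnj (dtheta t u v)) vs - d * wedge22 \<gamma> (dtheta t) vs)"
proof -
  have "((\<lambda>y. \<alpha> y [u, v, z]) has_derivative (\<lambda>w.
      c * (wedge21 \<beta> (\<lambda>v. cnj (theta_diff t w v)) [u, v, z] - d * wedge21 \<gamma> (theta_diff t w) [u, v, z]))) (at x)"
    for u v z
  proof -
    have eq: "\<alpha> y [u, v, z] = K [u, v, z]
        + c * (wedge21 \<beta> (\<lambda>v. cnj (theta t y v)) [u, v, z] - d * wedge21 \<gamma> (theta t y) [u, v, z])" for y
      using assms(1)[of "[u, v, z]" y] by simp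
    show ?thesis
      unfolding eq
      by (rule derivative_eq_intros has_derivative_wedge21 has_derivative_theta
            has_derivative_cnj_theta refl)+ simp
  qed
  note D = frechet_derivative_at[OF this, symmetric]
  obtain v0 v1 v2 v3 where vs: "vs = [v0, v1, v2, v3]" using iffD1[OF length_4_conv assms(2)] by (elim exE)
  show ?thesis
    unfolding vs ext_deriv_3_form D by (simp add: wedge21_def wedge22_def dtheta_def algebra_simps)
qed

text \<open>Picks, from the wedge product of \<open>d\<theta>\<close> or its conjugate with a functional, the summands with exactly one complex-linear
factor.\<close>

lemma pq_at_dtheta_wedge:
  assumes t: "nondegenerate t" and f: "of_type (Nak_J t c x) b f" and len: "length vs = 3"
  shows "pq_at (Nak_J t c x) 1 2 (wedge21 (dtheta t) f) vs =
      (if b then dtheta_E t * wedge21 (w2 (eta_bar t 1) (eta_bar t 2)) f vs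
       else wedge21 (\<lambda>u v. w2 (eta t 1) (dtheta_S t 1) u v + w2 (eta t 2) (dtheta_S t 2) u v) f vs)"
    and "pq_at (Nak_J t c x) 1 2 (wedge21 (\<lambda>u v. cnj (dtheta t u v)) f) vs =
      (if b then cnj (dtheta_A t) * wedge21 (w2 (eta_bar t 1) (eta_bar t 2)) f vs
       else wedge21 (\<lambda>u v. cnj (w2 (eta t 1) (dtheta_S t 1) u v + w2 (eta t 2) (dtheta_S t 2) u v)) f vs)"
proof -
  have det: "base_det t \<noteq> 0" using t by (simp add: nondegenerate_def)
  have dth: "dtheta t = (\<lambda>u v. dtheta_A t * w2 (eta t 1) (eta t 2) u v
      + (w2 (eta t 1) (dtheta_S t 1) u v + w2 (eta t 2) (dtheta_S t 2) u v)
      + dtheta_E t * w2 (eta_bar t 1) (eta_bar t 2) u v)"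
    using dtheta_expand[OF det] by blast
  have cnj_dth: "(\<lambda>u v. cnj (dtheta t u v)) = (\<lambda>u v. cnj (dtheta_A t) * w2 (eta_bar t 1) (eta_bar t 2) u v
      + (w2 (eta_bar t 1) (\<lambda>v. cnj (dtheta_S t 1 v)) u v + w2 (eta_bar t 2) (\<lambda>v. cnj (dtheta_S t 2 v)) u v)
      + cnj (dtheta_E t) * w2 (eta t 1) (eta t 2) u v)"
    unfolding dth by (simp add: fun_eq_iff w2_def)
  have ty: "of_type (Nak_J t c x) True (eta t 1)" "of_type (Nak_J t c x) True (eta t 2)"
    "of_type (Nak_J t c x) False (eta_bar t 1)" "of_type (Nak_J t c x) False (eta_bar t 2)"
    "of_type (Nak_J t c x) False (dtheta_S t i)" "of_type (Nak_J t c x) True (\<lambda>v. cnj (dtheta_S t i v))" for i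
    using of_type_eta[OF t] of_type_eta_bar[OF t] of_type_dtheta_S[OF t] of_type_cnj[OF of_type_dtheta_S[OF t]]
    by simp_all
  have p: "pq_at (Nak_J t c x) 1 2 (wedge21 (w2 g h) f) vs =
      (if of_bool bg + of_bool bh + of_bool b = (1::nat) then wedge21 (w2 g h) f vs else 0)"
    if "of_type (Nak_J t c x) bg g" "of_type (Nak_J t c x) bh h" for bg bh g h
    using pq_at_wedge21[OF that f _ len] by simp
  show "pq_at (Nak_J t c x) 1 2 (wedge21 (dtheta t) f) vs =
      (if b then dtheta_E t * wedge21 (w2 (eta_bar t 1) (eta_bar t 2)) f vs
       else wedge21 (\<lambda>u v. w2 (eta t 1) (dtheta_S t 1) u v + w2 (eta t 2) (dtheta_S t 2) u v) f vs)"
    unfolding dth pq_at_wedge21_add pq_at_wedge21_cmult p[OF ty(1,2)] p[OF ty(1,5)] p[OF ty(2,5)] p[OF ty(3,4)]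
    by (simp add: wedge21_def algebra_simps)
  show "pq_at (Nak_J t c x) 1 2 (wedge21 (\<lambda>u v. cnj (dtheta t u v)) f) vs =
      (if b then cnj (dtheta_A t) * wedge21 (w2 (eta_bar t 1) (eta_bar t 2)) f vs
       else wedge21 (\<lambda>u v. cnj (w2 (eta t 1) (dtheta_S t 1) u v + w2 (eta t 2) (dtheta_S t 2) u v)) f vs)"
    unfolding cnj_dth pq_at_wedge21_add pq_at_wedge21_cmult p[OF ty(1,2)] p[OF ty(3,6)] p[OF ty(4,6)] p[OF ty(3,4)]
    by (simp add: wedge21_def w2_def algebra_simps)
qed

section \<open>Left-invariant Hermitian forms\<close>

text \<open>All contributions of \<open>\<mu>\<close> to \<open>\<partial>-bar \<alpha>\<close> are wedge products of forms that do not depend on the point, and these are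
closed; only the \<open>\<theta> \<and> cnj \<theta>\<close> summand reaches the second order.\<close>

lemma ddbar_theta_form:
  assumes t: "nondegenerate t"
    and \<mu>: "\<And>x. of_type (Nak_J t c x) True \<mu>"
    and \<alpha>: "\<And>y us. length us = 2 \<Longrightarrow> \<alpha> y us = K (us ! 0) (us ! 1)
      + k * w2 (theta t y) (\<lambda>v. cnj (theta t y v)) (us ! 0) (us ! 1)
      + 1 / 2 * (w2 \<mu> (\<lambda>v. cnj (theta t y v)) (us ! 0) (us ! 1) + w2 (\<lambda>v. cnj (\<mu> v)) (theta t y) (us ! 0) (us ! 1))"
    and len: "length vs = 4"
  shows "del (Nak_J t c) 1 2 (delbar (Nak_J t c) 1 1 \<alpha>) x vs =
    k * of_real (skt_obstruction t) * wedge22 (w2 (eta t 1) (eta_bar t 1)) (w2 (eta t 2) (eta_bar t 2)) vs"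
proof -
  let ?\<kappa> = "\<lambda>u v. w2 (eta t 1) (dtheta_S t 1) u v + w2 (eta t 2) (dtheta_S t 2) u v"
  let ?\<gamma> = "w2 (eta_bar t 1) (eta_bar t 2)"
  let ?A = "cnj (dtheta_A t)"
  let ?V = "wedge22 (w2 (eta t 1) (eta_bar t 1)) (w2 (eta t 2) (eta_bar t 2))"
  have det: "base_det t \<noteq> 0" using t by (simp add: nondegenerate_def)
  have dbar: "delbar (Nak_J t c) 1 1 \<alpha> y us =
      - 1 / 2 * (?A * wedge21 ?\<gamma> \<mu> us + wedge21 ?\<kappa> (\<lambda>v. cnj (\<mu> v)) us)
      + k * (wedge21 ?\<kappa> (\<lambda>v. cnj (theta t y v)) us - ?A * wedge21 ?\<gamma> (theta t y) us)"
    if us: "length us = 3" for y us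
  proof -
    have "delbar (Nak_J t c) 1 1 \<alpha> y us = pq_at (Nak_J t c y) 1 2 (ext_deriv \<alpha> y) us"
      by (simp add: delbar_def pq_part_eq numeral_2_eq_2)
    also have "\<dots> = pq_at (Nak_J t c y) 1 2 (\<lambda>us.
      k * (wedge21 (dtheta t) (\<lambda>v. cnj (theta t y v)) us - wedge21 (\<lambda>u v. cnj (dtheta t u v)) (theta t y) us)
      - 1 / 2 * (wedge21 (\<lambda>u v. cnj (dtheta t u v)) \<mu> us + wedge21 (dtheta t) (\<lambda>v. cnj (\<mu> v)) us)) us"
      by (rule pq_at_cong, rule ext_deriv_theta_2_form[OF \<alpha>]) simp_all
    also have "\<dots> = - 1 / 2 * (?A * wedge21 ?\<gamma> \<mu> us + wedge21 ?\<kappa> (\<lambda>v. cnj (\<mu> v)) us)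
      + k * (wedge21 ?\<kappa> (\<lambda>v. cnj (theta t y v)) us - ?A * wedge21 ?\<gamma> (theta t y) us)"
      unfolding pq_at_diff pq_at_add pq_at_cmult
        pq_at_dtheta_wedge(1)[OF t of_type_cnj[OF \<mu>] us]
        pq_at_dtheta_wedge(2)[OF t \<mu> us]
        pq_at_dtheta_wedge(1)[OF t of_type_cnj[OF of_type_theta[OF t]] us]
        pq_at_dtheta_wedge(2)[OF t of_type_theta[OF t] us]
      by (simp add: algebra_simps)
    finally show ?thesis .
  qed
  have d: "ext_deriv (delbar (Nak_J t c) 1 1 \<alpha>) x us = k * of_real (skt_obstruction t) * ?V us"
    if us: "length us = 4" for us
    using ext_deriv_theta_3_form[OF dbar us] wedge_obstruction[OF det, of us] by simp
  have "del (Nak_J t c) 1 2 (delbar (Nak_J t c) 1 1 \<alpha>) x vs =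
      pq_at (Nak_J t c x) 2 2 (\<lambda>us. (k * of_real (skt_obstruction t)) * ?V us) vs"
    unfolding del_def pq_part_eq Suc_1 using d by (intro pq_at_cong) simp
  also have "\<dots> = k * of_real (skt_obstruction t) * ?V vs"
    unfolding pq_at_cmult
    by (subst pq_at_wedge22[OF of_type_eta of_type_eta_bar of_type_eta of_type_eta_bar])
       (use t len in simp_all)
  finally show ?thesis .
qed

definition invariant_form :: "(complex ^ 3 \<Rightarrow> complex ^ 3 \<Rightarrow> real) \<Rightarrow> (complex ^ 3) cform" where
  "invariant_form a x vs = of_real (a (shear (- x $ 1) (vs ! 0)) (shear (- x $ 1) (vs ! 1)))"

text \<open>The vectors dual to \<open>\<theta>\<close>: at the origin they are annihilated by \<open>\<eta>\<^sub>1\<close> and \<open>\<eta>\<^sub>2\<close>, and \<open>\<theta>\<close> takes the value \<open>c\<close>.\<close>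

definition dual3 :: "complex ^ 2 ^ 3 \<Rightarrow> complex \<Rightarrow> complex ^ 3" where
  "dual3 t c = inv (Nak_L t) (axis 3 c)"

text \<open>The projection along the dual vectors onto the kernel of \<open>\<theta>\<close> at the origin.\<close>

definition horizontal :: "complex ^ 2 ^ 3 \<Rightarrow> complex ^ 3 \<Rightarrow> complex ^ 3" where
  "horizontal t v = inv (Nak_L t) (vector [eta t 1 v, eta t 2 v, 0])"

context
  fixes t :: "complex ^ 2 ^ 3"
  assumes t: "nondegenerate t"
begin

lemma Nak_L_eqI: "Nak_L t u = Nak_L t v \<Longrightarrow> u = v"
  using inj_Nak_L[OF t] by (simp add: inj_eq)

lemma Nak_L_dual3: "Nak_L t (dual3 t c) = axis 3 c"
  and Nak_L_horizontal: "Nak_L t (horizontal t v) = vector [eta t 1 v, eta t 2 v, 0]"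
  using bij_Nak_L[OF t] by (simp_all add: dual3_def horizontal_def bij_def surj_f_inv_f)

lemma dual3_real_imag: "dual3 t c = Re c *\<^sub>R dual3 t 1 + Im c *\<^sub>R dual3 t \<i>"
proof (rule Nak_L_eqI)
  have "Nak_L t (Re c *\<^sub>R dual3 t 1 + Im c *\<^sub>R dual3 t \<i>) =
      Re c *\<^sub>R axis 3 1 + Im c *\<^sub>R axis 3 \<i>"
    by (simp only: linear_add[OF linear_Nak_L] linear_scale[OF linear_Nak_L] Nak_L_dual3)
  also have "\<dots> = axis 3 c"
    by (simp add: vec3_eq_iff complex_eq_iff)
  finally show "Nak_L t (dual3 t c) = Nak_L t (Re c *\<^sub>R dual3 t 1 + Im c *\<^sub>R dual3 t \<i>)"
    by (simp only: Nak_L_dual3)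
qed

lemma Nak_J0_dual3: "Nak_J0 t (dual3 t c) = dual3 t (\<i> * c)"
  by (rule Nak_L_eqI) (simp add: Nak_L_J0[OF t] Nak_L_dual3 vec3_eq_iff del: Nak_L_nth)

lemma horizontal_split: "u = horizontal t u + dual3 t (Nak_L t u $ 3)"
  by (rule Nak_L_eqI)
     (simp only: linear_add[OF linear_Nak_L] Nak_L_dual3 Nak_L_horizontal,
      simp add: vec3_eq_iff eta_def)

lemma horizontal_shear: "horizontal t (shear a v) = horizontal t v"
  by (simp add: horizontal_def eta_def)

lemma horizontal_J: "horizontal t (Nak_J t c x v) = Nak_J0 t (horizontal t v)"
proof (rule Nak_L_eqI)
  have "eta t 1 (Nak_J t c x v) = \<i> * eta t 1 v" "eta t 2 (Nak_J t c x v) = \<i> * eta t 2 v"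
    using of_type_eta[OF t] by (auto simp: of_type_def)
  then show "Nak_L t (horizontal t (Nak_J t c x v)) = Nak_L t (Nak_J0 t (horizontal t v))"
    by (simp add: Nak_L_J0[OF t] Nak_L_horizontal vec3_eq_iff del: Nak_L_nth)
qed

text \<open>Splitting each vector into its horizontal part and a multiple of the dual vectors puts the invariant form into the
shape of the previous computation.  Invariance under the complex structure turns the mixed values into a complex-linear
functional \<open>\<mu>\<close>, and it makes the restriction to the complex line of dual vectors a multiple of the area form.\<close>

theorem ddbar_invariant_form:
  assumes a: "bilinear a" and skew: "\<And>u v. a u v = - a v u"
    and J: "\<And>u v. a (Nak_J0 t u) (Nak_J0 t v) = a u v"
    and len: "length vs = 4"
  shows "del (Nak_J t c) 1 2 (delbar (Nak_J t c) 1 1 (invariant_form a)) x vs =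
    \<i> / 2 * of_real (a (dual3 t 1) (dual3 t \<i>)) * of_real (skt_obstruction t) *
      wedge22 (w2 (eta t 1) (eta_bar t 1)) (w2 (eta t 2) (eta_bar t 2)) vs"
proof -
  \<comment> \<open>chosen such that \<open>Re (cnj q * \<mu> v)\<close> is the value of \<open>a\<close> on the horizontal part of \<open>v\<close> and \<open>dual3 t q\<close>\<close>
  define \<mu> where "\<mu> v = Complex (a (horizontal t v) (dual3 t 1)) (a (horizontal t v) (dual3 t \<i>))" for v
  define k where "k = a (dual3 t 1) (dual3 t \<i>)"
  note bil = bilinear_ladd[OF a] bilinear_radd[OF a] bilinear_lmul[OF a] bilinear_rmul[OF a]
    bilinear_lneg[OF a] bilinear_rneg[OF a]
  have [simp]: "a u u = 0" for u using skew[of u u] by simp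
  have k': "a (dual3 t \<i>) (dual3 t 1) = - k" unfolding k_def by (rule skew)
  have \<mu>_type: "of_type (Nak_J t c x) True \<mu>" for x
  proof -
    have "dual3 t (- 1) = - dual3 t 1" by (subst dual3_real_imag) simp
    then have "a (Nak_J0 t u) (dual3 t 1) = - a u (dual3 t \<i>)" "a (Nak_J0 t u) (dual3 t \<i>) = a u (dual3 t 1)" for u
      using J[of u "dual3 t \<i>"] J[of u "dual3 t 1"] by (simp_all add: Nak_J0_dual3 bil)
    then show ?thesis
      by (simp add: of_type_def \<mu>_def horizontal_J complex_eq_iff)
  qed
  have split: "complex_of_real (a u v) = of_real (a (horizontal t u) (horizontal t v))
      + \<i> / 2 * of_real k * (p * cnj q - q * cnj p)
      + 1 / 2 * ((\<mu> u * cnj q - \<mu> v * cnj p) + (cnj (\<mu> u) * q - cnj (\<mu> v) * p))"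
    if p: "p = Nak_L t u $ 3" and q: "q = Nak_L t v $ 3" for u v p q
  proof -
    have "a u v = a (horizontal t u + dual3 t p) (horizontal t v + dual3 t q)"
      using horizontal_split p q by simp
    also have "\<dots> = a (horizontal t u) (horizontal t v)
        + (Re q * a (horizontal t u) (dual3 t 1) + Im q * a (horizontal t u) (dual3 t \<i>))
        - (Re p * a (horizontal t v) (dual3 t 1) + Im p * a (horizontal t v) (dual3 t \<i>))
        + (Re p * Im q - Im p * Re q) * k"
      unfolding dual3_real_imag[of p] dual3_real_imag[of q] bil k'
        skew[of "dual3 t 1" "horizontal t v"] skew[of "dual3 t \<i>" "horizontal t v"] k_def[symmetric]
      by (simp add: algebra_simps)
    finally show ?thesis
      by (simp add: complex_eq_iff \<mu>_def) (simp add: field_simps)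
  qed
  have "invariant_form a y us = of_real (a (horizontal t (us ! 0)) (horizontal t (us ! 1)))
      + \<i> / 2 * of_real k * w2 (theta t y) (\<lambda>v. cnj (theta t y v)) (us ! 0) (us ! 1)
      + 1 / 2 * (w2 \<mu> (\<lambda>v. cnj (theta t y v)) (us ! 0) (us ! 1) + w2 (\<lambda>v. cnj (\<mu> v)) (theta t y) (us ! 0) (us ! 1))"
    for y us
  proof -
    have "\<mu> (shear b v) = \<mu> v" for b v by (simp add: \<mu>_def horizontal_shear)
    then show ?thesis
      using split[OF refl refl, of "shear (- y $ 1) (us ! 0)" "shear (- y $ 1) (us ! 1)"]
      by (simp only: invariant_form_def w2_def theta_def horizontal_shear)
  qed
  from ddbar_theta_form[OF t \<mu>_type this len] show ?thesis by (simp only: k_def)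
qed

end

text \<open>Differentiability is a local property, so at a point where one map is not differentiable both derivatives are the same
default value, and \<open>\<partial> \<partial>-bar\<close> is a local operator on arbitrary forms.\<close>

lemma frechet_derivative_cong_open:
  assumes "open U" "x \<in> U" "\<And>y. y \<in> U \<Longrightarrow> f y = g y"
  shows "frechet_derivative f (at x) = frechet_derivative g (at x)"
proof -
  have "(f has_derivative f') (at x) \<longleftrightarrow> (g has_derivative f') (at x)" for f'
    using has_derivative_transform_within_open[of f f' x UNIV U g]
      has_derivative_transform_within_open[of g f' x UNIV U f] assms by auto
  then show ?thesis by (simp add: frechet_derivative_def)
qed

lemma ext_deriv_cong_open:
  assumes "open U" "x \<in> U" "length vs = Suc n" "\<And>y us. y \<in> U \<Longrightarrow> length us = n \<Longrightarrow> \<alpha> y us = \<beta> y us"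
  shows "ext_deriv \<alpha> x vs = ext_deriv \<beta> x vs"
proof -
  have "frechet_derivative (\<lambda>y. \<alpha> y (take i vs @ drop (Suc i) vs)) (at x) =
        frechet_derivative (\<lambda>y. \<beta> y (take i vs @ drop (Suc i) vs)) (at x)" if "i < length vs" for i
    using that assms(3) by (intro frechet_derivative_cong_open[OF assms(1,2)] assms(4)) auto
  then show ?thesis by (simp add: ext_deriv_def)
qed

lemma del_delbar_cong_open:
  assumes "open U" "x \<in> U" "\<And>y us. y \<in> U \<Longrightarrow> length us = 2 \<Longrightarrow> \<alpha> y us = \<beta> y us" "length vs = 4"
  shows "del J 1 2 (delbar J 1 1 \<alpha>) x vs = del J 1 2 (delbar J 1 1 \<beta>) x vs"
proof -
  have "delbar J 1 1 \<alpha> y us = delbar J 1 1 \<beta> y us" if "y \<in> U" "length us = 3" for y us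
    unfolding delbar_def pq_part_eq
    by (intro pq_at_cong ext_deriv_cong_open[OF assms(1) that(1), where n = 2] assms(3)) simp_all
  then show ?thesis
    unfolding del_def pq_part_eq
    by (intro pq_at_cong ext_deriv_cong_open[OF assms(1,2), where n = 3]) simp_all
qed

section \<open>Left-invariant SKT metrics\<close>

lemma inner_i_i: "inner (\<i> *s p) (\<i> *s q) = inner p q"
  and inner_i_skew: "inner (\<i> *s p) q = - inner (\<i> *s q) p"
  for p q :: "complex ^ 3"
  by (simp_all add: inner_vec_def sum_3 inner_complex_def algebra_simps)

text \<open>The metric for which the left-invariant coframe is unitary.\<close>

theorem admits_skt_metric_if_no_obstruction:
  assumes t: "nondegenerate t" and obs: "skt_obstruction t = 0"
  shows "admits_skt_metric Iw_charts (Nak_J t)"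
proof -
  define l where "l x v = Nak_L t (shear (- x $ 1) v)" for x :: "complex ^ 3" and v
  define g :: "((complex ^ 3) set, complex ^ 3) metric_field" where "g c x v w = inner (l x v) (l x w)" for c x v w
  define a where "a u w = inner (\<i> *s Nak_L t u) (Nak_L t w)" for u w
  have lin: "linear (l x)" for x
    using linear_compose[OF linear_shear linear_Nak_L] by (simp add: o_def l_def[abs_def])
  have inj: "l x v = 0 \<Longrightarrow> v = 0" for x v
  proof -
    assume "l x v = 0"
    then have "shear (- x $ 1) v = 0"
      using inj_Nak_L[OF t] linear_injective_0[OF linear_Nak_L] unfolding l_def by blast
    then have "shear (x $ 1) (shear (- x $ 1) v) = shear (x $ 1) 0" by simp
    then show "v = 0" by (simp add: linear_0[OF linear_shear])
  qed
  have lJ: "l x (Nak_J t c x v) = \<i> *s l x v" for c x v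
    by (simp add: l_def Nak_J_eq[OF t] Nak_L_J0[OF t])
  have smooth: "smooth_on U (\<lambda>x. g c x v w)" if "open U" for U c v w
  proof -
    have "bounded_linear (Nak_L t)" using linear_Nak_L linear_conv_bounded_linear by blast
    then show ?thesis unfolding g_def l_def using that
      by (intro smooth_on_bilinear[OF _ bounded_bilinear_inner] smooth_on_bounded_linear[of U "Nak_L t"]
          smooth_on_shear smooth_intros)
  qed
  have bil: "bilinear (g c x)" for c x
    unfolding bilinear_def g_def
    by (auto intro!: linearI simp: linear_add[OF lin] linear_scale[OF lin] inner_add_left inner_add_right)
  have op: "open (chart_image c)" if "c \<in> Iw_charts" for c
    using that by (auto simp: Iw_charts_eq chart_image_lift evenly_covered_def)
  have trans: "g c x v w = g c' (transition c c' x) (frechet_derivative (transition c c') (at x) v)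
            (frechet_derivative (transition c c') (at x) w)"
    if cc: "c \<in> Iw_charts" "c' \<in> Iw_charts" "x \<in> overlap c c'" for c c' x v w
  proof -
    obtain V V' where "evenly_covered V" "evenly_covered V'" "c = lift_chart V" "c' = lift_chart V'"
      using cc unfolding Iw_charts_eq by auto
    then obtain h where "transition c c' x = heis_mult h x"
      "frechet_derivative (transition c c') (at x) = shear (h $ 1)"
      using transition_derivative[of V V' x] cc(3) by auto
    then show ?thesis by (simp add: g_def l_def)
  qed
  have "riemannian_metric Iw_charts g"
    unfolding riemannian_metric_def
    using bil trans smooth op inj by (auto simp: g_def inner_commute inner_gt_zero_iff)
  then have "hermitian_metric Iw_charts (Nak_J t) g"
    unfolding hermitian_metric_def by (simp add: g_def lJ inner_i_i)
  moreover have "del (Nak_J t c) 1 2 (delbar (Nak_J t c) 1 1 (fundamental_form (Nak_J t) g c)) x vs = 0"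
    if "length vs = 4" for c x vs
  proof -
    have ff: "fundamental_form (Nak_J t) g c = invariant_form a"
      by (simp add: fun_eq_iff fundamental_form_def invariant_form_def g_def lJ a_def)
         (simp add: l_def)
    have bil_a: "bilinear a"
    proof -
      have "\<i> *s (p + q) = \<i> *s p + \<i> *s q" "\<i> *s (r *\<^sub>R p) = r *\<^sub>R (\<i> *s p)" for p q :: "complex ^ 3" and r
        by (simp_all add: vec3_eq_iff algebra_simps)
      then show ?thesis
        unfolding bilinear_def a_def linear_iff
        by (simp add: linear_add[OF linear_Nak_L] linear_scale[OF linear_Nak_L]
            inner_add_left inner_add_right)
    qed
    have skew: "a u v = - a v u" for u v
      unfolding a_def by (rule inner_i_skew)
    have J: "a (Nak_J0 t u) (Nak_J0 t v) = a u v" for u v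
      by (simp only: a_def Nak_L_J0[OF t] inner_i_i)
    show ?thesis
      unfolding ff ddbar_invariant_form[OF t bil_a skew J that] obs by simp
  qed
  ultimately show ?thesis unfolding admits_skt_metric_def skt_metric_def by blast
qed

lemma Nak_line_nth [simp]:
  "Nak_line s $ 1 $ 1 = 0" "Nak_line s $ 1 $ 2 = - s" "Nak_line s $ 2 $ 1 = s" "Nak_line s $ 2 $ 2 = 0"
  "Nak_line s $ 3 $ 1 = 0" "Nak_line s $ 3 $ 2 = 0"
  by (simp_all add: Nak_line_def)

lemma one_plus_cnj_nonzero: "1 + s * cnj s \<noteq> (0::complex)"
proof -
  have "1 + s * cnj s = of_real (1 + (norm s)\<^sup>2)" by (simp add: complex_mult_cnj cmod_power2)
  moreover have "1 + (norm s)\<^sup>2 \<noteq> 0" by (smt (verit) zero_le_power2)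
  ultimately show ?thesis by (metis of_real_eq_0_iff)
qed

lemma nondegenerate_Nak_line: "nondegenerate (Nak_line s) \<longleftrightarrow> norm s \<noteq> 1"
proof -
  have "base_det (Nak_line s) = (1 + s * cnj s)\<^sup>2"
    by (simp add: base_det_def base_M_def power2_eq_square)
  moreover have "norm (Nak_D (Nak_line s)) = (norm s)\<^sup>2"
    by (simp add: Nak_D_def norm_mult power2_eq_square)
  moreover have "(norm s)\<^sup>2 = 1 \<longleftrightarrow> norm s = 1"
    by (simp add: power2_eq_1_iff) (smt (verit) norm_ge_zero)
  ultimately show ?thesis
    using one_plus_cnj_nonzero[of s] by (simp add: nondegenerate_def)
qed

text \<open>Here \<open>T cnj T = - |s|\<^sup>2\<close>, so that \<open>M\<close> is the scalar \<open>m = 1 + |s|\<^sup>2\<close>; the coefficients are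
\<open>A = (|s|\<^sup>2 - 1) / m\<close> and \<open>B\<^sub>1\<^sub>1 = B\<^sub>2\<^sub>2 = s / m\<close>.\<close>

lemma skt_obstruction_Nak_line:
  "skt_obstruction (Nak_line s) = ((norm s)^4 - 4 * (norm s)\<^sup>2 + 1) / (1 + (norm s)\<^sup>2)\<^sup>2"
proof -
  define m where "m = 1 + s * cnj s"
  have m: "m \<noteq> 0" unfolding m_def by (rule one_plus_cnj_nonzero)
  have det: "base_det (Nak_line s) = m * m"
    by (simp add: base_det_def base_M_def m_def power2_eq_square)
  have P: "base_P (Nak_line s) $ 1 $ 1 = 1 / m" "base_P (Nak_line s) $ 1 $ 2 = 0"
    "base_P (Nak_line s) $ 2 $ 1 = 0" "base_P (Nak_line s) $ 2 $ 2 = 1 / m"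
    using m by (simp_all add: base_P_def det) (simp_all add: base_M_def m_def)
  have Q: "base_Q (Nak_line s) $ 1 $ 1 = 0" "base_Q (Nak_line s) $ 1 $ 2 = s / m"
    "base_Q (Nak_line s) $ 2 $ 1 = - s / m" "base_Q (Nak_line s) $ 2 $ 2 = 0"
    by (simp_all add: base_Q_def P)
  have D: "Nak_D (Nak_line s) = s * s" by (simp add: Nak_D_def)
  have cm: "cnj m = m" by (simp add: m_def mult.commute)
  have A: "dtheta_A (Nak_line s) = (s * cnj s - 1) / m"
  proof -
    have "dtheta_A (Nak_line s) = ((s * cnj s) * (s * cnj s) - 1) / (m * m)"
      unfolding dtheta_A_def P Q D using m by (simp add: cm field_simps)
    also have "(s * cnj s) * (s * cnj s) - 1 = (s * cnj s - 1) * m"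
      by (simp add: m_def algebra_simps)
    finally show ?thesis using m by simp
  qed
  have W: "base_wedge (Nak_line s) $ 1 $ 1 = - s / (m * m)" "base_wedge (Nak_line s) $ 2 $ 2 = - s / (m * m)"
    "base_wedge (Nak_line s) $ 1 $ 2 = 0" "base_wedge (Nak_line s) $ 2 $ 1 = 0"
    by (simp_all add: base_wedge_def Let_def P Q)
  have B: "dtheta_B (Nak_line s) 1 1 = s / m" "dtheta_B (Nak_line s) 2 2 = s / m"
    "dtheta_B (Nak_line s) 1 2 = 0" "dtheta_B (Nak_line s) 2 1 = 0"
  proof -
    have "s / (m * m) + s * s * cnj (s / (m * m)) = s * (1 + s * cnj s) / (m * m)"
      using m by (simp add: cm field_simps)
    also have "\<dots> = s / m" using m unfolding m_def by simp
    finally show "dtheta_B (Nak_line s) 1 1 = s / m" "dtheta_B (Nak_line s) 2 2 = s / m"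
      unfolding dtheta_B_def W D by simp_all
  qed (simp_all add: dtheta_B_def W)
  let ?r = "(norm s)\<^sup>2"
  have mr: "m = of_real (1 + ?r)" and sr: "s * cnj s = of_real ?r"
    by (simp_all add: m_def complex_mult_cnj cmod_power2)
  have "dtheta_A (Nak_line s) = of_real ((?r - 1) / (1 + ?r))"
    unfolding A sr mr by simp
  then have nA: "(norm (dtheta_A (Nak_line s)))\<^sup>2 = ((?r - 1) / (1 + ?r))\<^sup>2"
    by (simp only: norm_of_real power2_abs)
  have "s / m * cnj (s / m) = (s * cnj s) / (m * m)" by (simp add: cm)
  also have "\<dots> = of_real (?r / ((1 + ?r) * (1 + ?r)))" unfolding sr mr by simp
  finally have "Re (s / m * cnj (s / m)) = ?r / ((1 + ?r) * (1 + ?r))" by (simp only: Re_complex_of_real)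
  then have "skt_obstruction (Nak_line s) = ((?r - 1) / (1 + ?r))\<^sup>2 - 2 * (?r / ((1 + ?r) * (1 + ?r)))"
    unfolding skt_obstruction_def nA B by simp
  also have "\<dots> = ((?r - 1)\<^sup>2 - 2 * ?r) / (1 + ?r)\<^sup>2"
    unfolding power_divide power2_eq_square[of "1 + ?r"] by (simp add: diff_divide_distrib)
  also have "(?r - 1)\<^sup>2 - 2 * ?r = ?r * ?r - 4 * ?r + 1"
    by (simp add: power2_eq_square algebra_simps)
  also have "?r * ?r = norm s ^ 4" by (simp add: power2_eq_square power4_eq_xxxx)
  finally show ?thesis .
qed

section \<open>Periodic integrals over a fundamental domain\<close>

text \<open>By periodicity the shift may be assumed to lie in \<open>[0, 1)\<close>; then the part of the shifted interval beyond \<open>1\<close> is moved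
back to its beginning.\<close>

lemma integral_periodic_shift:
  fixes f :: "real \<Rightarrow> 'a::euclidean_space"
  assumes cont: "continuous_on UNIV f" and per: "\<And>x. f (x + 1) = f x"
  shows "integral {0..1} (\<lambda>x. f (x + c)) = integral {0..1} f"
proof -
  have int: "f integrable_on {a..b}" for a b
    using continuous_on_subset[OF cont] by (intro integrable_continuous_real) auto
  have per_int: "f (x + of_int n) = f x" for x and n :: int
  proof (induction n rule: int_induct[where k = 0])
    case (step1 i)
    then show ?case using per[of "x + of_int i"] by (simp add: ac_simps)
  next
    case (step2 i)
    then show ?case using per[of "x + of_int i - 1"] by (simp add: algebra_simps)
  qed simp
  define d where "d = frac c"
  have d: "0 \<le> d" "d \<le> 1" unfolding d_def by (simp_all add: frac_ge_0 less_imp_le frac_lt_1)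
  have "f (x + c) = f (x + d)" for x
    using per_int[of "x + d" "\<lfloor>c\<rfloor>"] by (simp add: d_def frac_def)
  then have "integral {0..1} (\<lambda>x. f (x + c)) = integral {d..1 + d} f"
    using integral_shift_real_ivl[where a = d and c = d and b = "1 + d" and f = f] by simp
  also have "\<dots> = integral {d..1} f + integral {1..1 + d} f"
    using Henstock_Kurzweil_Integration.integral_combine[of d 1 "1 + d" f] d int by simp
  also have "integral {1..1 + d} f = integral {0..d} f"
    using integral_shift_real_ivl[where a = 1 and c = 1 and b = "1 + d" and f = f] per by simp
  also have "integral {d..1} f + integral {0..d} f = integral {0..1} f"
    using Henstock_Kurzweil_Integration.integral_combine[of 0 d 1 f] d int by (simp add: add.commute)
  finally show ?thesis .
qed

abbreviation unit_square :: "(real \<times> real) set" where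
  "unit_square \<equiv> cbox (0, 0) (1, 1)"

lemma integral_biperiodic_shift:
  fixes f :: "real \<times> real \<Rightarrow> 'a::euclidean_space"
  assumes cont: "continuous_on UNIV f"
    and per: "\<And>p. f (p + (1, 0)) = f p" "\<And>p. f (p + (0, 1)) = f p"
  shows "integral unit_square (\<lambda>p. f (p + c)) = integral unit_square f"
proof -
  have cont_c: "continuous_on S (\<lambda>p. f (p + c))" for S and c
    by (rule continuous_on_compose2[OF cont]) (auto intro!: continuous_intros)
  have cont_y: "continuous_on UNIV (\<lambda>y. f (x, y))" for x
    by (rule continuous_on_compose2[OF cont]) (auto intro!: continuous_intros)
  define F where "F x = integral {0..1} (\<lambda>y. f (x, y))" for x
  have shift_y: "integral {0..1} (\<lambda>y. f (x, y + c2)) = F x" for x c2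
    unfolding F_def using integral_periodic_shift[OF cont_y, of x c2] per(2)[of "(x, _)"] by simp
  have "continuous_on (UNIV \<times> cbox 0 1) (\<lambda>(x, y). f (x, y))"
    using continuous_on_subset[OF cont] by (simp add: case_prod_unfold)
  then have F_cont: "continuous_on UNIV F"
    using integral_continuous_on_param[of UNIV 0 1 "\<lambda>x y. f (x, y)"] unfolding F_def by simp
  have F_per: "F (x + 1) = F x" for x
    unfolding F_def using per(1)[of "(x, _)"] by simp
  have fub: "integral unit_square (\<lambda>p. f (p + c)) = integral {0..1} (\<lambda>x. F (x + fst c))" for c
  proof -
    have "integral unit_square (\<lambda>p. f (p + c)) =
        integral {0..1} (\<lambda>x. integral {0..1} (\<lambda>y. f (x + fst c, y + snd c)))"
      using integral_prod_continuous[OF cont_c[of "unit_square" c]] by (cases c) simp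
    then show ?thesis unfolding shift_y .
  qed
  show ?thesis
    using fub[of c] fub[of 0] integral_periodic_shift[OF F_cont F_per, of "fst c"] by simp
qed

definition cpx :: "real \<times> real \<Rightarrow> complex" where
  "cpx p = of_real (fst p) + \<i> * of_real (snd p)"

lemma cpx_add: "cpx (p + q) = cpx p + cpx q"
  by (simp add: cpx_def algebra_simps)

lemma cpx_Re_Im: "cpx (Re z, Im z) = z"
  by (simp add: cpx_def complex_eq_iff)

lemma continuous_on_cpx [continuous_intros]:
  "continuous_on S f \<Longrightarrow> continuous_on S (\<lambda>x. cpx (f x))"
  unfolding cpx_def by (intro continuous_intros)

lemma axis_12_nth [simp]:
  "axis (1::3) c $ 1 = c" "axis (1::3) c $ 2 = 0" "axis (1::3) c $ 3 = 0"
  "axis (2::3) c $ 1 = 0" "axis (2::3) c $ 2 = c" "axis (2::3) c $ 3 = 0"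
  by (simp_all add: axis_def)

definition vec3 :: "complex \<Rightarrow> complex \<Rightarrow> complex \<Rightarrow> complex ^ 3" where
  "vec3 a b c = axis 1 a + (axis 2 b + axis 3 c)"

lemma vec3_nth [simp]: "vec3 a b c $ 1 = a" "vec3 a b c $ 2 = b" "vec3 a b c $ 3 = c"
  by (simp_all add: vec3_def)

lemma continuous_on_vec3 [continuous_intros]:
  "continuous_on S f \<Longrightarrow> continuous_on S g \<Longrightarrow> continuous_on S h \<Longrightarrow>
   continuous_on S (\<lambda>x. vec3 (f x) (g x) (h x))"
  unfolding vec3_def
  by (intro continuous_intros bounded_linear.continuous_on[OF bounded_linear_axis])

lemma vec3_gaussian_points:
  "g \<in> gaussian_integers \<Longrightarrow> vec3 g 0 0 \<in> gaussian_points"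
  "g \<in> gaussian_integers \<Longrightarrow> vec3 0 g 0 \<in> gaussian_points"
  "g \<in> gaussian_integers \<Longrightarrow> vec3 0 0 g \<in> gaussian_points"
  by (simp_all add: gaussian_points_def forall_3 gaussian_integers_closed)

lemma gaussian_units: "cpx (1, 0) \<in> gaussian_integers" "cpx (0, 1) \<in> gaussian_integers"
  by (simp_all add: gaussian_integers_iff cpx_def)

text \<open>Real coordinates of \<open>z\<^sub>1, z\<^sub>2, z\<^sub>3\<close>.  Nested pairs are used so that integrals over boxes can be iterated; the unit box is a
fundamental domain of the lattice.\<close>

type_synonym heis_param = "(real \<times> real) \<times> (real \<times> real) \<times> (real \<times> real)"

definition heis_point :: "heis_param \<Rightarrow> complex ^ 3" where
  "heis_point p = vec3 (cpx (fst p)) (cpx (fst (snd p))) (cpx (snd (snd p)))"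

abbreviation unit_box :: "heis_param set" where
  "unit_box \<equiv> cbox ((0, 0), (0, 0), (0, 0)) ((1, 1), (1, 1), (1, 1))"

lemma continuous_on_heis_point [continuous_intros]:
  "continuous_on S f \<Longrightarrow> continuous_on S (\<lambda>x. heis_point (f x))"
  unfolding heis_point_def by (intro continuous_intros)

lemma integral_unit_box:
  fixes f :: "heis_param \<Rightarrow> 'a::euclidean_space"
  assumes "continuous_on UNIV f"
  shows "integral unit_box f =
    integral unit_square (\<lambda>a. integral unit_square (\<lambda>b. integral unit_square (\<lambda>c. f (a, b, c))))"
proof -
  have "continuous_on S (\<lambda>q. f (a, q))" for S a
    by (rule continuous_on_compose2[OF assms]) (auto intro!: continuous_intros)
  from integral_prod_continuous[OF this] show ?thesis
    using integral_prod_continuous[OF continuous_on_subset[OF assms subset_UNIV]] by simp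
qed

lemma heis_mult_0: "heis_mult h 0 = h"
  by (simp add: vec3_eq_iff)

text \<open>The Heisenberg group is unimodular.  The integral is iterated with \<open>z\<^sub>3\<close> innermost: for fixed \<open>z\<^sub>1, z\<^sub>2\<close> the
translation only shifts \<open>z\<^sub>3\<close>, after that it only shifts \<open>z\<^sub>2\<close>, and then \<open>z\<^sub>1\<close>.\<close>

lemma integral_translation_invariant:
  fixes \<phi> :: "complex ^ 3 \<Rightarrow> 'a::euclidean_space"
  assumes cont: "continuous_on UNIV \<phi>"
    and inv: "\<And>k z. k \<in> gaussian_points \<Longrightarrow> \<phi> (heis_mult k z) = \<phi> z"
  shows "integral unit_box (\<lambda>p. \<phi> (heis_mult (heis_point p) x)) = integral unit_box (\<lambda>p. \<phi> (heis_point p))"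
proof -
  have contI: "continuous_on S (\<lambda>y. \<phi> (f y))" if "continuous_on S f" for S and f :: "'b::topological_space \<Rightarrow> _"
    by (rule continuous_on_compose2[OF cont that]) auto
  have per1: "\<phi> (vec3 (a + g) b (c + g * b)) = \<phi> (vec3 a b c)" if "g \<in> gaussian_integers" for a b c g
  proof -
    have "heis_mult (vec3 g 0 0) (vec3 a b c) = vec3 (a + g) b (c + g * b)" by (simp add: vec3_eq_iff)
    then show ?thesis using inv[OF vec3_gaussian_points(1)[OF that], of "vec3 a b c"] by simp
  qed
  have per2: "\<phi> (vec3 a (b + g) c) = \<phi> (vec3 a b c)" if "g \<in> gaussian_integers" for a b c g
  proof -
    have "heis_mult (vec3 0 g 0) (vec3 a b c) = vec3 a (b + g) c" by (simp add: vec3_eq_iff)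
    then show ?thesis using inv[OF vec3_gaussian_points(2)[OF that], of "vec3 a b c"] by simp
  qed
  have per3: "\<phi> (vec3 a b (c + g)) = \<phi> (vec3 a b c)" if "g \<in> gaussian_integers" for a b c g
  proof -
    have "heis_mult (vec3 0 0 g) (vec3 a b c) = vec3 a b (c + g)" by (simp add: vec3_eq_iff)
    then show ?thesis using inv[OF vec3_gaussian_points(3)[OF that], of "vec3 a b c"] by simp
  qed
  define \<phi>3 where "\<phi>3 a b = integral unit_square (\<lambda>p. \<phi> (vec3 a b (cpx p)))" for a b
  define \<phi>2 where "\<phi>2 a = integral unit_square (\<lambda>p. \<phi>3 a (cpx p))" for a
  have shift3: "integral unit_square (\<lambda>p. \<phi> (vec3 a b (cpx p + c))) = \<phi>3 a b" for a b c
    using integral_biperiodic_shift[of "\<lambda>p. \<phi> (vec3 a b (cpx p))" "(Re c, Im c)"] per3 gaussian_units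
    unfolding \<phi>3_def by (simp add: cpx_add cpx_Re_Im contI continuous_intros)
  have fst_cont: "continuous_on (S \<times> T) (\<lambda>x. f (fst x))"
    if "continuous_on S f" for S T and f :: "'b::topological_space \<Rightarrow> complex"
    by (rule continuous_on_compose2[OF that continuous_on_fst[OF continuous_on_id]]) auto
  have cont3: "continuous_on S (\<lambda>y. \<phi>3 (f y) (h y))"
    if "continuous_on S f" "continuous_on S h" for S and f h :: "'b::topological_space \<Rightarrow> _"
    unfolding \<phi>3_def
    by (rule integral_continuous_on_param)
       (auto intro!: contI continuous_intros fst_cont that simp: case_prod_unfold)
  have cont2: "continuous_on S (\<lambda>y. \<phi>2 (f y))"
    if "continuous_on S f" for S and f :: "'b::topological_space \<Rightarrow> _"
    unfolding \<phi>2_def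
    by (rule integral_continuous_on_param)
       (auto intro!: cont3 continuous_intros fst_cont that simp: case_prod_unfold)
  have shift2: "integral unit_square (\<lambda>p. \<phi>3 a (cpx p + c)) = \<phi>2 a" for a c
    using integral_biperiodic_shift[of "\<lambda>p. \<phi>3 a (cpx p)" "(Re c, Im c)"] per2 gaussian_units
    unfolding \<phi>2_def by (simp add: cpx_add cpx_Re_Im cont3 continuous_intros) (simp add: \<phi>3_def)
  \<comment> \<open>Shifting \<open>z\<^sub>1\<close> by a lattice element also shifts \<open>z\<^sub>3\<close> by \<open>g * z\<^sub>2\<close>; this has no effect on the inner integral.\<close>
  have per_\<phi>2: "\<phi>2 (a + g) = \<phi>2 a" if "g \<in> gaussian_integers" for a g
  proof -
    have "\<phi>3 (a + g) b = \<phi>3 a b" for b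
      using shift3[of "a + g" b "g * b"] per1[OF that] by (simp add: \<phi>3_def)
    then show ?thesis by (simp add: \<phi>2_def)
  qed
  have shift1: "integral unit_square (\<lambda>p. \<phi>2 (cpx p + c)) = integral unit_square (\<lambda>p. \<phi>2 (cpx p))" for c
    using integral_biperiodic_shift[of "\<lambda>p. \<phi>2 (cpx p)" "(Re c, Im c)"] per_\<phi>2 gaussian_units
    by (simp add: cpx_add cpx_Re_Im cont2 continuous_intros)
  have "integral unit_box (\<lambda>p. \<phi> (heis_mult (heis_point p) x)) =
      integral unit_square (\<lambda>a. integral unit_square (\<lambda>b. integral unit_square (\<lambda>c.
        \<phi> (vec3 (cpx a + x $ 1) (cpx b + x $ 2) (cpx c + (x $ 3 + cpx a * x $ 2))))))" for x
  proof -
    have "heis_mult (heis_point p) x = vec3 (cpx (fst p) + x $ 1) (cpx (fst (snd p)) + x $ 2)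
        (cpx (snd (snd p)) + (x $ 3 + cpx (fst p) * x $ 2))" for p
      by (simp add: heis_point_def vec3_eq_iff)
    then show ?thesis
      by (subst integral_unit_box) (auto intro!: contI continuous_intros)
  qed
  then have "integral unit_box (\<lambda>p. \<phi> (heis_mult (heis_point p) x)) = integral unit_square (\<lambda>a. \<phi>2 (cpx a))" for x
    unfolding shift3 shift2 shift1 .
  from this[of x] this[of 0] show ?thesis by (simp add: heis_mult_0)
qed

section \<open>Smooth tensor fields\<close>

text \<open>Covariant tensor fields of rank \<open>n\<close> on the whole space.  Their arguments are written as values of a function on
\<open>{0..<n}\<close>, because updating one slot of a function is simpler than updating a list.\<close>

definition smooth_tensor :: "nat \<Rightarrow> 'e::euclidean_space cform \<Rightarrow> bool" where
  "smooth_tensor n \<beta> \<longleftrightarrow>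
     (\<forall>x f i. i < n \<longrightarrow> linear (\<lambda>v. \<beta> x (map (f(i := v)) [0..<n]))) \<and>
     (\<forall>f. smooth_on UNIV (\<lambda>x. \<beta> x (map f [0..<n])))"

lemma smooth_tensor_linear:
  "smooth_tensor n \<beta> \<Longrightarrow> i < n \<Longrightarrow> linear (\<lambda>v. \<beta> x (map (f(i := v)) [0..<n]))"
  and smooth_tensor_smooth: "smooth_tensor n \<beta> \<Longrightarrow> smooth_on UNIV (\<lambda>x. \<beta> x (map f [0..<n]))"
  by (simp_all add: smooth_tensor_def)

lemma map_nth_upt: "length vs = n \<Longrightarrow> map (\<lambda>i. vs ! i) [0..<n] = vs"
  using map_nth by blast

text \<open>Inserting vectors that depend on a parameter: replace the slots one after the other, expanding the new vector in a basis.
The predicate \<open>R\<close> stands for the regularity in question; it is used for smoothness in the point and for continuity in further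
parameters.\<close>

lemma smooth_tensor_insert:
  fixes V :: "nat \<Rightarrow> 'p \<Rightarrow> 'e::euclidean_space"
  assumes \<beta>: "smooth_tensor n \<beta>"
    and sum: "\<And>F. (\<And>b::'e. b \<in> Basis \<Longrightarrow> R (F b)) \<Longrightarrow> R (\<lambda>p. \<Sum>b\<in>Basis. F b p)"
    and coeff: "\<And>F i b. i < n \<Longrightarrow> R F \<Longrightarrow> R (\<lambda>p. inner (V i p) b *\<^sub>R F p)"
    and const: "\<And>f. R (\<lambda>p. \<beta> (\<phi> p) (map f [0..<n]))"
  shows "R (\<lambda>p. \<beta> (\<phi> p) (map (\<lambda>i. V i p) [0..<n]))"
proof -
  have main: "R (\<lambda>p. \<beta> (\<phi> p) (map (\<lambda>i. if i < m then V i p else f i) [0..<n]))" if "m \<le> n" for m f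
    using that
  proof (induction m arbitrary: f)
    case 0
    then show ?case using const by simp
  next
    case (Suc m)
    let ?g = "\<lambda>p. (\<lambda>i. if i < m then V i p else f i)"
    have expand: "\<beta> (\<phi> p) (map (\<lambda>i. if i < Suc m then V i p else f i) [0..<n]) =
        (\<Sum>b\<in>Basis. inner (V m p) b *\<^sub>R
          \<beta> (\<phi> p) (map (\<lambda>i. if i < m then V i p else (f(m := b)) i) [0..<n]))" for p
    proof -
      have lin: "linear (\<lambda>v. \<beta> (\<phi> p) (map ((?g p)(m := v)) [0..<n]))"
        using smooth_tensor_linear[OF \<beta>] Suc.prems by simp
      have "(\<lambda>i. if i < Suc m then V i p else f i) = (?g p)(m := \<Sum>b\<in>Basis. inner (V m p) b *\<^sub>R b)"
        by (auto simp: fun_eq_iff euclidean_representation less_Suc_eq)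
      then have "\<beta> (\<phi> p) (map (\<lambda>i. if i < Suc m then V i p else f i) [0..<n]) =
          (\<Sum>b\<in>Basis. inner (V m p) b *\<^sub>R \<beta> (\<phi> p) (map ((?g p)(m := b)) [0..<n]))"
        by (simp only: linear_sum[OF lin] linear_scale[OF lin])
      moreover have "(?g p)(m := b) = (\<lambda>i. if i < m then V i p else (f(m := b)) i)" for b
        by (auto simp: fun_eq_iff)
      ultimately show ?thesis by simp
    qed
    show ?case
      unfolding expand by (rule sum, rule coeff[of m], use Suc.prems in simp, rule Suc.IH, use Suc.prems in simp)
  qed
  have full: "map (\<lambda>i. if i < n then V i p else 0) [0..<n] = map (\<lambda>i. V i p) [0..<n]" for p
    by (intro map_cong) auto
  show ?thesis using main[of n "\<lambda>_. 0"] unfolding full by simp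
qed

lemma smooth_tensor_insert_smooth:
  fixes V :: "nat \<Rightarrow> 'e \<Rightarrow> 'e::euclidean_space"
  assumes "smooth_tensor n \<beta>" "\<And>i. i < n \<Longrightarrow> smooth_on UNIV (V i)"
  shows "smooth_on UNIV (\<lambda>x. \<beta> x (map (\<lambda>i. V i x) [0..<n]))"
proof (rule smooth_tensor_insert[OF assms(1), where R = "smooth_on UNIV"])
  show "smooth_on UNIV (\<lambda>p. inner (V i p) b *\<^sub>R F p)" if "i < n" "smooth_on UNIV F"
    for F :: "'e \<Rightarrow> complex" and i b
    using that assms(2) smooth_on_bounded_linear[OF open_UNIV bounded_linear_inner_left]
    by (intro smooth_on_scaleR) auto
qed (auto intro: smooth_on_sum smooth_tensor_smooth[OF assms(1)])

lemma smooth_tensor_insert_continuous: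
  fixes V :: "nat \<Rightarrow> 'p::topological_space \<Rightarrow> 'e::euclidean_space"
  assumes "smooth_tensor n \<beta>" "\<And>i. i < n \<Longrightarrow> continuous_on S (V i)" "continuous_on S \<phi>"
  shows "continuous_on S (\<lambda>p. \<beta> (\<phi> p) (map (\<lambda>i. V i p) [0..<n]))"
proof (rule smooth_tensor_insert[OF assms(1), of "continuous_on S"])
  show "continuous_on S (\<lambda>p. \<beta> (\<phi> p) (map f [0..<n]))" for f
    using smooth_on_continuous[OF smooth_tensor_smooth[OF assms(1)]]
    by (rule continuous_on_compose2) (use assms(3) in auto)
qed (use assms(2) in \<open>auto intro!: continuous_intros\<close>)

lemma smooth_tensor_add:
  "smooth_tensor n \<beta> \<Longrightarrow> smooth_tensor n \<gamma> \<Longrightarrow> smooth_tensor n (\<lambda>x vs. \<beta> x vs + \<gamma> x vs)"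
  unfolding smooth_tensor_def
  by (auto intro!: linear_compose_add smooth_on_add)

lemma smooth_tensor_cmult:
  "smooth_tensor n \<beta> \<Longrightarrow> smooth_tensor n (\<lambda>x vs. c * \<beta> x vs)"
  unfolding smooth_tensor_def
  by (auto intro!: smooth_on_mult smooth_on_const simp: linear_iff algebra_simps)

lemma smooth_tensor_zero: "smooth_tensor n (\<lambda>x vs. 0)"
  by (simp add: smooth_tensor_def linear_iff smooth_on_const)

lemma smooth_tensor_sum:
  "(\<And>k. k \<in> I \<Longrightarrow> smooth_tensor n (\<beta> k)) \<Longrightarrow> smooth_tensor n (\<lambda>x vs. \<Sum>k\<in>I. \<beta> k x vs)"
  by (induction I rule: infinite_finite_induct) (auto intro: smooth_tensor_zero smooth_tensor_add)

lemma smooth_tensor_cong: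
  assumes "\<And>x vs. length vs = n \<Longrightarrow> \<beta> x vs = \<gamma> x vs"
  shows "smooth_tensor n \<beta> \<longleftrightarrow> smooth_tensor n \<gamma>"
  unfolding smooth_tensor_def using assms by simp

lemma smooth_tensor_reindex:
  fixes \<beta> :: "'e::euclidean_space cform"
  assumes \<beta>: "smooth_tensor n \<beta>" and \<sigma>: "bij_betw \<sigma> {..<n} {..<n}"
  shows "smooth_tensor n (\<lambda>x vs. \<beta> x (map (\<lambda>j. vs ! \<sigma> j) [0..<n]))"
  unfolding smooth_tensor_def
proof (intro conjI allI impI)
  have \<sigma>n: "\<sigma> j < n" if "j < n" for j using bij_betwE[OF \<sigma>] that by auto
  have eq: "map (\<lambda>j. map f [0..<n] ! \<sigma> j) [0..<n] = map (\<lambda>j. f (\<sigma> j)) [0..<n]" for f :: "nat \<Rightarrow> 'e"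
    using \<sigma>n by auto
  show "smooth_on UNIV (\<lambda>x. \<beta> x (map (\<lambda>j. map f [0..<n] ! \<sigma> j) [0..<n]))" for f
    unfolding eq by (rule smooth_tensor_smooth[OF \<beta>])
  fix x and f :: "nat \<Rightarrow> 'e" and i assume "i < n"
  then obtain j where j: "j < n" "\<sigma> j = i" using \<sigma> by (metis bij_betw_iff_bijections lessThan_iff)
  have "(f(i := v)) (\<sigma> k) = ((\<lambda>k. f (\<sigma> k))(j := v)) k" if "k < n" for k v
    using that j \<sigma> by (auto simp: bij_betw_def inj_on_def)
  then have upd: "map (\<lambda>k. (f(i := v)) (\<sigma> k)) [0..<n] = map ((\<lambda>k. f (\<sigma> k))(j := v)) [0..<n]" for v
    by (intro map_cong) auto
  show "linear (\<lambda>v. \<beta> x (map (\<lambda>j. map (f(i := v)) [0..<n] ! \<sigma> j) [0..<n]))"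
    unfolding eq upd by (rule smooth_tensor_linear[OF \<beta> j(1)])
qed

text \<open>The derivative of the components of a tensor field with respect to constant vector fields, the direction being the first
argument.\<close>

definition nabla :: "'e::euclidean_space cform \<Rightarrow> 'e cform" where
  "nabla \<beta> x ws = frechet_derivative (\<lambda>y. \<beta> y (tl ws)) (at x) (hd ws)"

lemma nabla_map: "nabla \<beta> x (map f [0..<Suc n]) =
    frechet_derivative (\<lambda>y. \<beta> y (map (\<lambda>i. f (Suc i)) [0..<n])) (at x) (f 0)"
  unfolding nabla_def map_upt_Suc by simp

lemma smooth_tensor_differentiable:
  assumes "smooth_tensor n \<beta>"
  shows "(\<lambda>y. \<beta> y (map f [0..<n])) differentiable (at x)"
  using smooth_on_differentiable[OF smooth_tensor_smooth[OF assms]] by simp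

lemma smooth_tensor_nabla:
  assumes \<beta>: "smooth_tensor n \<beta>"
  shows "smooth_tensor (Suc n) (nabla \<beta>)"
  unfolding smooth_tensor_def
proof (intro conjI allI impI)
  show "smooth_on UNIV (\<lambda>x. nabla \<beta> x (map f [0..<Suc n]))" for f
    unfolding nabla_map by (intro smooth_on_frechet_derivative smooth_tensor_smooth[OF \<beta>])
  fix x f i assume i: "i < Suc n"
  show "linear (\<lambda>v. nabla \<beta> x (map (f(i := v)) [0..<Suc n]))"
  proof (cases i)
    case 0
    then show ?thesis
      unfolding nabla_map using linear_frechet_derivative[OF smooth_tensor_differentiable[OF \<beta>]] by simp
  next
    case (Suc j)
    define B where "B v y = \<beta> y (map ((\<lambda>k. f (Suc k))(j := v)) [0..<n])" for v y
    have upd: "(\<lambda>k. (f(i := v)) (Suc k)) = (\<lambda>k. f (Suc k))(j := v)" for v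
      by (auto simp: fun_eq_iff Suc)
    have lin: "linear (\<lambda>v. B v y)" for y
      unfolding B_def using smooth_tensor_linear[OF \<beta>] i Suc by simp
    have D: "(B v has_derivative frechet_derivative (B v) (at x)) (at x)" for v
      unfolding B_def by (intro frechet_derivative_worksI smooth_tensor_differentiable[OF \<beta>])
    have "frechet_derivative (B (v + w)) (at x) = (\<lambda>u. frechet_derivative (B v) (at x) u + frechet_derivative (B w) (at x) u)"
      for v w
    proof -
      have "B (v + w) = (\<lambda>y. B v y + B w y)" using linear_add[OF lin] by blast
      then show ?thesis
        using frechet_derivative_at[OF has_derivative_add[OF D D], of v w] by simp
    qed
    moreover have "frechet_derivative (B (r *\<^sub>R v)) (at x) = (\<lambda>u. r *\<^sub>R frechet_derivative (B v) (at x) u)"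
      for r v
    proof -
      have "B (r *\<^sub>R v) = (\<lambda>y. r *\<^sub>R B v y)" using linear_scale[OF lin] by blast
      then show ?thesis
        using frechet_derivative_at[OF has_derivative_scaleR_right[OF D], of r v] by simp
    qed
    moreover have "nabla \<beta> x (map (f(i := v)) [0..<Suc n]) = frechet_derivative (B v) (at x) (f 0)" for v
      unfolding nabla_map upd B_def[abs_def] using Suc by simp
    ultimately show ?thesis by (simp add: linear_iff)
  qed
qed

lemma ext_deriv_nabla:
  "ext_deriv \<beta> x vs = (\<Sum>i<length vs. (-1) ^ i * nabla \<beta> x (vs ! i # take i vs @ drop (Suc i) vs))"
  by (simp add: ext_deriv_def nabla_def)

lemma smooth_tensor_ext_deriv:
  assumes \<beta>: "smooth_tensor n \<beta>"
  shows "smooth_tensor (Suc n) (ext_deriv \<beta>)"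
proof -
  \<comment> \<open>lists slot \<open>i\<close> first and then the others in order\<close>
  define \<sigma> where "\<sigma> i j = (case j of 0 \<Rightarrow> i | Suc k \<Rightarrow> if k < i then k else Suc k)" for i j :: nat
  have bij: "bij_betw (\<sigma> i) {..<Suc n} {..<Suc n}" if "i < Suc n" for i
  proof (rule bij_betw_byWitness[where f' = "\<lambda>k. if k = i then 0 else if k < i then Suc k else k"])
  qed (use that in \<open>auto simp: \<sigma>_def split: nat.splits if_splits\<close>)
  have eq: "vs ! i # take i vs @ drop (Suc i) vs = map (\<lambda>j. vs ! \<sigma> i j) [0..<Suc n]"
    if "length vs = Suc n" "i < Suc n" for vs :: "'a list" and i
  proof (rule nth_equalityI)
    fix k assume "k < length (vs ! i # take i vs @ drop (Suc i) vs)"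
    then have "k < Suc n" using that by simp
    then show "(vs ! i # take i vs @ drop (Suc i) vs) ! k = map (\<lambda>j. vs ! \<sigma> i j) [0..<Suc n] ! k"
      using that by (cases k) (auto simp: \<sigma>_def nth_append simp del: upt_Suc)
  qed (use that in simp)
  have "smooth_tensor (Suc n) (\<lambda>x vs. \<Sum>i<Suc n. (-1) ^ i * nabla \<beta> x (map (\<lambda>j. vs ! \<sigma> i j) [0..<Suc n]))"
    by (intro smooth_tensor_sum smooth_tensor_cmult smooth_tensor_reindex smooth_tensor_nabla \<beta> bij) simp
  then show ?thesis
    by (rule iffD1[OF smooth_tensor_cong, rotated]) (simp add: ext_deriv_nabla eq del: upt_Suc)
qed

definition smooth_endo :: "('e::euclidean_space \<Rightarrow> 'e \<Rightarrow> 'e) \<Rightarrow> bool" where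
  "smooth_endo J \<longleftrightarrow> (\<forall>x. linear (J x)) \<and> (\<forall>v. smooth_on UNIV (\<lambda>x. J x v))"

lemma smooth_tensor_apply_endo:
  assumes \<beta>: "smooth_tensor n \<beta>" and J: "smooth_endo J"
  shows "smooth_tensor n (\<lambda>x vs. \<beta> x (map (\<lambda>i. if i \<in> T then J x (vs ! i) else vs ! i) [0..<n]))"
  unfolding smooth_tensor_def
proof (intro conjI allI impI)
  have eq: "map (\<lambda>i. if i \<in> T then J x (map f [0..<n] ! i) else map f [0..<n] ! i) [0..<n] =
      map (\<lambda>i. if i \<in> T then J x (f i) else f i) [0..<n]" for x f
    by (intro map_cong) auto
  have "smooth_on UNIV (\<lambda>x. if i \<in> T then J x (f i) else f i)" for f and i
    using J by (cases "i \<in> T") (auto simp: smooth_endo_def intro: smooth_on_const)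
  then show "smooth_on UNIV (\<lambda>x. \<beta> x (map (\<lambda>i. if i \<in> T then J x (map f [0..<n] ! i) else map f [0..<n] ! i) [0..<n]))"
    for f unfolding eq by (intro smooth_tensor_insert_smooth[OF \<beta>])
  fix x f i assume i: "i < n"
  have "(\<lambda>k. if k \<in> T then J x ((f(i := v)) k) else (f(i := v)) k) =
      (\<lambda>k. if k \<in> T then J x (f k) else f k)(i := if i \<in> T then J x v else v)" for v
    by (auto simp: fun_eq_iff)
  moreover have "linear (\<lambda>v. if i \<in> T then J x v else v)"
    using J by (auto simp: smooth_endo_def linear_iff)
  ultimately show "linear (\<lambda>v. \<beta> x (map (\<lambda>k. if k \<in> T then J x (map (f(i := v)) [0..<n] ! k)
      else map (f(i := v)) [0..<n] ! k) [0..<n]))"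
    unfolding eq using linear_compose[OF _ smooth_tensor_linear[OF \<beta> i]] by (simp add: o_def)
qed

lemma smooth_tensor_pq_part:
  assumes \<beta>: "smooth_tensor n \<beta>" and J: "smooth_endo J" and n: "n = p + q"
  shows "smooth_tensor n (pq_part J p q \<beta>)"
proof -
  have "smooth_tensor n (\<lambda>x vs. \<Sum>S\<in>{S. S \<subseteq> {..<n} \<and> card S = p}. \<Sum>T\<in>Pow {..<n}.
          (\<Prod>i\<in>T. if i \<in> S then - \<i> else \<i>) / 2 ^ n *
          \<beta> x (map (\<lambda>i. if i \<in> T then J x (vs ! i) else vs ! i) [0..<n]))"
    by (intro smooth_tensor_sum smooth_tensor_cmult smooth_tensor_apply_endo \<beta> J)
  then show ?thesis
    by (rule iffD1[OF smooth_tensor_cong, rotated]) (simp add: pq_part_def n)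
qed

section \<open>Averaging over left translations\<close>

text \<open>The mean over \<open>h\<close> in the unit box of the pullbacks of \<open>\<beta>\<close> under the left translations by \<open>h\<close>.\<close>

definition average :: "(complex ^ 3) cform \<Rightarrow> (complex ^ 3) cform" where
  "average \<beta> x vs = integral unit_box (\<lambda>p.
     \<beta> (heis_mult (heis_point p) x) (map (shear (heis_point p $ 1)) vs))"

lemma continuous_on_shear [continuous_intros]:
  "continuous_on S f \<Longrightarrow> continuous_on S g \<Longrightarrow> continuous_on S (\<lambda>x. shear (f x) (g x))"
  unfolding shear_def
  by (intro continuous_intros bounded_linear.continuous_on[OF bounded_linear_axis])

lemma continuous_on_heis_mult_param [continuous_intros]:
  "continuous_on S f \<Longrightarrow> continuous_on S g \<Longrightarrow> continuous_on S (\<lambda>x. heis_mult (f x) (g x))"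
  unfolding heis_mult_def by (intro continuous_intros)

lemma average_integrand_continuous:
  assumes "smooth_tensor n \<beta>" "length vs = n" "continuous_on S f" "continuous_on S g"
  shows "continuous_on S (\<lambda>p. \<beta> (heis_mult (heis_point (f p)) (g p)) (map (shear (heis_point (f p) $ 1)) vs))"
proof -
  have "map (shear a) vs = map (\<lambda>i. shear a (vs ! i)) [0..<n]" for a
    by (subst map_nth_upt[OF assms(2), symmetric]) (simp add: o_def)
  then show ?thesis
    using smooth_tensor_insert_continuous[OF assms(1), of S "\<lambda>i p. shear (heis_point (f p) $ 1) (vs ! i)"
        "\<lambda>p. heis_mult (heis_point (f p)) (g p)"] assms(3,4)
    by (simp add: continuous_intros)
qed

lemma average_integrable:
  assumes "smooth_tensor n \<beta>" "length vs = n"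
  shows "(\<lambda>p. \<beta> (heis_mult (heis_point p) x) (map (shear (heis_point p $ 1)) vs)) integrable_on unit_box"
  by (intro integrable_continuous average_integrand_continuous[OF assms] continuous_intros)

text \<open>Differentiation under the integral sign.  Left translations are affine, so the derivative of a pullback is the pullback of the
derivative.\<close>

lemma has_derivative_average:
  assumes \<beta>: "smooth_tensor n \<beta>" and len: "length vs = n"
  shows "((\<lambda>x. average \<beta> x vs) has_derivative (\<lambda>w. average (nabla \<beta>) x (w # vs))) (at x)"
proof -
  \<comment> \<open>the derivative of the integrand, packaged as a bounded linear map\<close>
  define F where "F y p = Blinfun (\<lambda>w. nabla \<beta> (heis_mult (heis_point p) y) (map (shear (heis_point p $ 1)) (w # vs)))"
    for y p
  have sm: "smooth_on UNIV (\<lambda>y. \<beta> y ws)" if "length ws = n" for ws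
    using smooth_tensor_smooth[OF \<beta>, of "\<lambda>i. ws ! i"] map_nth_upt[OF that] by simp
  have D: "((\<lambda>y. \<beta> (heis_mult h y) ws) has_derivative
      (\<lambda>w. nabla \<beta> (heis_mult h y) (shear (h $ 1) w # ws))) (at y)" if "length ws = n" for h y ws
  proof -
    have "((\<lambda>z. \<beta> z ws) has_derivative (\<lambda>w. nabla \<beta> (heis_mult h y) (w # ws))) (at (heis_mult h y))"
      using frechet_derivative_worksI[OF smooth_on_differentiable[OF sm[OF that]]] by (simp add: nabla_def)
    from has_derivative_compose[OF has_derivative_heis_mult this] show ?thesis by simp
  qed
  have F_apply: "blinfun_apply (F y p) w =
      nabla \<beta> (heis_mult (heis_point p) y) (map (shear (heis_point p $ 1)) (w # vs))" for y p w
    unfolding F_def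
    using has_derivative_bounded_linear[OF D[of "map (shear (heis_point p $ 1)) vs" "heis_point p" y]] len
    by (simp add: bounded_linear_Blinfun_apply)
  have F_cont: "continuous_on S (\<lambda>p. F (g p) (f p))" if "continuous_on S f" "continuous_on S g"
    for S and f :: "'b::t2_space \<Rightarrow> heis_param" and g
  proof (rule continuous_on_blinfun_componentwise)
    fix w show "continuous_on S (\<lambda>p. blinfun_apply (F (g p) (f p)) w)"
      unfolding F_apply
      by (rule average_integrand_continuous[OF smooth_tensor_nabla[OF \<beta>] _ that]) (simp add: len)
  qed
  have "((\<lambda>x. average \<beta> x vs) has_derivative integral unit_box (F x)) (at x within UNIV)"
    unfolding average_def
  proof (rule leibniz_rule)
    show "((\<lambda>x. \<beta> (heis_mult (heis_point p) x) (map (shear (heis_point p $ 1)) vs)) has_derivative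
        blinfun_apply (F x p)) (at x within UNIV)" for x p
      unfolding F_apply[abs_def] using D[of "map (shear (heis_point p $ 1)) vs"] len by simp
    show "continuous_on (UNIV \<times> unit_box) (\<lambda>(x, p). F x p)"
      unfolding case_prod_unfold by (intro F_cont continuous_intros)
  qed (simp_all add: average_integrable[OF \<beta> len])
  moreover have "blinfun_apply (integral unit_box (F x)) = (\<lambda>w. average (nabla \<beta>) x (w # vs))"
  proof
    fix w
    have "F x integrable_on unit_box"
      by (intro integrable_continuous F_cont continuous_intros)
    from integral_linear[OF this blinfun.bounded_linear_left[of w]]
    show "blinfun_apply (integral unit_box (F x)) w = average (nabla \<beta>) x (w # vs)"
      unfolding average_def F_apply[symmetric] by (simp add: o_def)
  qed
  ultimately show ?thesis by simp
qed

lemma ext_deriv_average: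
  assumes \<beta>: "smooth_tensor n \<beta>" and len: "length vs = Suc n"
  shows "ext_deriv (average \<beta>) x vs = average (ext_deriv \<beta>) x vs"
proof -
  let ?omit = "\<lambda>i vs. take i vs @ drop (Suc i) vs"
  have "frechet_derivative (\<lambda>y. average \<beta> y (?omit i vs)) (at x) (vs ! i) =
      average (nabla \<beta>) x (vs ! i # ?omit i vs)" if "i < Suc n" for i
  proof -
    have "length (?omit i vs) = n" using that len by simp
    from frechet_derivative_at[OF has_derivative_average[OF \<beta> this], of x] show ?thesis by metis
  qed
  then have "ext_deriv (average \<beta>) x vs = (\<Sum>i<Suc n. (-1) ^ i * average (nabla \<beta>) x (vs ! i # ?omit i vs))"
    unfolding ext_deriv_def len by simp
  also have "\<dots> = integral unit_box (\<lambda>p. \<Sum>i<Suc n. (-1) ^ i *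
      nabla \<beta> (heis_mult (heis_point p) x) (map (shear (heis_point p $ 1)) (vs ! i # ?omit i vs)))"
    unfolding average_def integral_mult_right[symmetric]
    by (subst integral_sum)
       (use len in \<open>auto intro!: integrable_on_mult_right average_integrable[OF smooth_tensor_nabla[OF \<beta>]] simp del: list.map\<close>)
  also have "\<dots> = average (ext_deriv \<beta>) x vs"
    unfolding average_def ext_deriv_nabla length_map len
    by (intro integral_cong sum.cong refl) (use len in \<open>simp add: take_map drop_map\<close>)
  finally show ?thesis .
qed

lemma pq_part_average:
  assumes \<beta>: "smooth_tensor n \<beta>" and n: "n = p + q" and len: "length vs = n" and J: "smooth_endo J"
    and equi: "\<And>h x v. shear (h $ 1) (J x v) = J (heis_mult h x) (shear (h $ 1) v)"
  shows "pq_part J p q (average \<beta>) x vs = average (pq_part J p q \<beta>) x vs"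
proof -
  let ?A = "\<lambda>T x vs. map (\<lambda>i. if i \<in> T then J x (vs ! i) else vs ! i) [0..<p + q]"
  have eq: "map (shear (h $ 1)) (?A T x vs) = ?A T (heis_mult h x) (map (shear (h $ 1)) vs)" for T h
    using len n by (auto simp: equi)
  have int: "(\<lambda>y. \<beta> (heis_mult (heis_point y) x) (?A T (heis_mult (heis_point y) x) (map (shear (heis_point y $ 1)) vs)))
      integrable_on unit_box" for T
  proof -
    have "length (?A T x vs) = n" by (simp add: n)
    from average_integrable[OF \<beta> this, of x] show ?thesis unfolding eq .
  qed
  show ?thesis
    unfolding pq_part_def average_def length_map len n if_P[OF refl] eq
      integral_mult_right[symmetric]
    by (subst integral_sum, use int in \<open>auto intro!: integrable_sum integrable_on_mult_right sum.cong\<close>)+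
qed

section \<open>Nonexistence of SKT metrics\<close>

text \<open>Left translations are holomorphic, so averaging commutes with the exterior derivative and with the type decomposition.\<close>

lemma ddbar_average:
  assumes \<omega>: "smooth_tensor 2 \<omega>" and J: "smooth_endo J"
    and equi: "\<And>h x v. shear (h $ 1) (J x v) = J (heis_mult h x) (shear (h $ 1) v)"
    and len: "length vs = 4"
  shows "del J 1 2 (delbar J 1 1 (average \<omega>)) x vs = average (del J 1 2 (delbar J 1 1 \<omega>)) x vs"
proof -
  have d\<omega>: "smooth_tensor 3 (ext_deriv \<omega>)" using smooth_tensor_ext_deriv[OF \<omega>] by (simp add: numeral_3_eq_3 numeral_2_eq_2)
  have \<tau>: "smooth_tensor 3 (delbar J 1 1 \<omega>)"
    unfolding delbar_def by (rule smooth_tensor_pq_part[OF d\<omega> J]) simp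
  have d\<tau>: "smooth_tensor 4 (ext_deriv (delbar J 1 1 \<omega>))"
    using smooth_tensor_ext_deriv[OF \<tau>] by simp
  have *: "delbar J 1 1 (average \<omega>) y us = average (delbar J 1 1 \<omega>) y us" if "length us = 3" for y us
  proof -
    have "delbar J 1 1 (average \<omega>) y us = pq_part J 1 (Suc 1) (average (ext_deriv \<omega>)) y us"
      unfolding delbar_def pq_part_eq by (intro pq_at_cong ext_deriv_average[OF \<omega>]) simp
    also have "\<dots> = average (pq_part J 1 (Suc 1) (ext_deriv \<omega>)) y us"
      by (rule pq_part_average[OF d\<omega> _ that J equi]) simp
    finally show ?thesis by (simp only: delbar_def)
  qed
  have "ext_deriv (delbar J 1 1 (average \<omega>)) x us = average (ext_deriv (delbar J 1 1 \<omega>)) x us"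
    if "length us = 4" for us
  proof -
    have "ext_deriv (delbar J 1 1 (average \<omega>)) x us = ext_deriv (average (delbar J 1 1 \<omega>)) x us"
      by (rule ext_deriv_cong_open[OF open_UNIV UNIV_I, where n = 3]) (use that * in simp_all)
    also have "\<dots> = average (ext_deriv (delbar J 1 1 \<omega>)) x us"
      by (rule ext_deriv_average[OF \<tau>]) (simp add: that)
    finally show ?thesis .
  qed
  then have "del J 1 2 (delbar J 1 1 (average \<omega>)) x vs =
      pq_part J (Suc 1) 2 (average (ext_deriv (delbar J 1 1 \<omega>))) x vs"
    unfolding del_def pq_part_eq by (intro pq_at_cong) simp
  also have "\<dots> = average (pq_part J (Suc 1) 2 (ext_deriv (delbar J 1 1 \<omega>))) x vs"
    by (rule pq_part_average[OF d\<tau> _ len J equi]) simp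
  finally show ?thesis by (simp only: del_def)
qed

text \<open>In the left-invariant frame the components of an invariant form are lattice-periodic functions, and the pullback under
\<open>h\<close> at \<open>x\<close> has as components the values of these functions at \<open>h\<close> times \<open>x\<close>.\<close>

lemma average_left_invariant:
  assumes \<beta>: "smooth_tensor n \<beta>" and len: "length vs = n"
    and inv: "\<And>k z vs. k \<in> gaussian_points \<Longrightarrow> length vs = n \<Longrightarrow>
      \<beta> (heis_mult k z) (map (shear (k $ 1)) vs) = \<beta> z vs"
  shows "average \<beta> x vs = average \<beta> 0 (map (shear (- x $ 1)) vs)"
proof -
  \<comment> \<open>the components of the arguments in the left-invariant frame\<close>
  define us where "us = map (shear (- x $ 1)) vs"
  have us: "length us = n" by (simp add: us_def len)
  define \<phi> where "\<phi> z = \<beta> z (map (shear (z $ 1)) us)" for z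
  have map_us: "map (shear a) us = map (\<lambda>i. shear a (us ! i)) [0..<n]" for a
    by (subst map_nth_upt[OF us, symmetric]) (simp add: o_def)
  have "continuous_on UNIV \<phi>"
    unfolding \<phi>_def map_us
    by (intro smooth_tensor_insert_continuous[OF \<beta>] continuous_intros)
  moreover have "\<phi> (heis_mult k z) = \<phi> z" if "k \<in> gaussian_points" for k z
    using inv[OF that, of "map (shear (z $ 1)) us" z] us by (simp add: \<phi>_def o_def)
  ultimately have "integral unit_box (\<lambda>p. \<phi> (heis_mult (heis_point p) x)) = integral unit_box (\<lambda>p. \<phi> (heis_point p))"
    by (rule integral_translation_invariant)
  moreover have "\<phi> (heis_mult (heis_point p) x) = \<beta> (heis_mult (heis_point p) x) (map (shear (heis_point p $ 1)) vs)" for p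
    by (simp add: \<phi>_def us_def o_def)
  ultimately show ?thesis
    by (simp add: average_def \<phi>_def us_def heis_mult_0)
qed

lemma integral_unit_box_pos:
  fixes f :: "heis_param \<Rightarrow> real"
  assumes cont: "continuous_on unit_box f" and pos: "\<And>p. f p > 0"
  shows "integral unit_box f > 0"
proof -
  have "(0, 0, 0) \<in> unit_box" by (simp add: zero_prod_def cbox_Pair_eq)
  then obtain q where q: "\<And>p. p \<in> unit_box \<Longrightarrow> f q \<le> f p"
    using continuous_attains_inf[OF compact_cbox _ cont] by blast
  have "measure lborel unit_box = 1" by (simp add: content_Pair)
  then have "f q = integral unit_box (\<lambda>_. f q)" by simp
  also have "\<dots> \<le> integral unit_box f"
    using q by (intro integral_le integrable_continuous cont continuous_on_const)
  finally show ?thesis using pos[of q] by linarith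
qed

text \<open>Vectors at the origin which \<open>\<theta>\<close> annihilates and on which \<open>\<eta>\<^sub>1 \<and> cnj \<eta>\<^sub>1 \<and> \<eta>\<^sub>2 \<and> cnj \<eta>\<^sub>2\<close> does not vanish.\<close>

definition frame :: "complex ^ 2 ^ 3 \<Rightarrow> (complex ^ 3) list" where
  "frame t = map (inv (Nak_L t)) [axis 1 1, axis 1 \<i>, axis 2 1, axis 2 \<i>]"

lemma wedge22_frame:
  assumes "nondegenerate t"
  shows "wedge22 (w2 (eta t 1) (eta_bar t 1)) (w2 (eta t 2) (eta_bar t 2)) (frame t) = - 4"
proof -
  have "Nak_L t (inv (Nak_L t) u) = u" for u
    using bij_Nak_L[OF assms] by (simp add: bij_def surj_f_inv_f)
  then have "eta t i (inv (Nak_L t) u) = u $ i" for i u by (simp add: eta_def del: Nak_L_nth)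
  then show ?thesis by (simp add: frame_def wedge22_def w2_def)
qed

lemma heis_mult_left_cancel: "heis_mult k z = heis_mult h z \<Longrightarrow> k = h"
  by (auto simp: vec3_eq_iff)

lemma bilinear_of_real_tensor:
  assumes bil: "\<And>x. bilinear (G x)" and sm: "\<And>v w. smooth_on UNIV (\<lambda>x. G x v w)"
  shows "smooth_tensor 2 (\<lambda>x vs. complex_of_real (G x (vs ! 0) (vs ! 1)))"
  unfolding smooth_tensor_def
proof (intro conjI allI impI)
  show "smooth_on UNIV (\<lambda>x. complex_of_real (G x (map f [0..<2] ! 0) (map f [0..<2] ! 1)))" for f
    by (intro smooth_on_of_real sm) simp
  fix x f and i :: nat assume "i < 2"
  then consider "i = 0" | "i = 1" by linarith
  then show "linear (\<lambda>v. complex_of_real (G x (map (f(i := v)) [0..<2] ! 0) (map (f(i := v)) [0..<2] ! 1)))"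
    by cases (simp_all add: linear_iff bilinear_ladd[OF bil] bilinear_radd[OF bil] bilinear_lmul[OF bil]
        bilinear_rmul[OF bil] scaleR_conv_of_real[where 'a = complex])
qed

text \<open>An SKT metric is lifted to the universal cover, its fundamental form is averaged, and the invariant form obtained is
evaluated on \<open>frame t\<close>: this would give \<open>a (dual3 t 1) (dual3 t \<i>) = 0\<close>, against positivity.\<close>

theorem no_skt_metric_if_obstruction:
  assumes t: "nondegenerate t" and obs: "skt_obstruction t \<noteq> 0"
  shows "\<not> admits_skt_metric Iw_charts (Nak_J t)"
proof
  assume "admits_skt_metric Iw_charts (Nak_J t)"
  then obtain g where skt: "skt_metric Iw_charts (Nak_J t) g" unfolding admits_skt_metric_def by blast
  then have herm: "hermitian_metric Iw_charts (Nak_J t) g" and riem: "riemannian_metric Iw_charts g"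
    by (simp_all add: skt_metric_def hermitian_metric_def)
  \<comment> \<open>The lift \<open>G\<close> of the metric to the universal cover, read off in a small chart around each point.\<close>
  define B where "B z = lift_chart (ball z (1 / 4))" for z :: "complex ^ 3"
  define G where "G z = g (B z) z" for z
  define J where "J = Nak_J t undefined"
  have J_eq: "Nak_J t c = J" for c by (simp add: J_def Nak_J_def)
  have B: "B z \<in> Iw_charts" "chart_image (B z) = ball z (1 / 4)" for z
    unfolding B_def using evenly_covered_ball by (auto simp: Iw_charts_eq chart_image_lift)

  have transform: "g c x v w = g c' (transition c c' x)
      (frechet_derivative (transition c c') (at x) v) (frechet_derivative (transition c c') (at x) w)"
    if "c \<in> Iw_charts" "c' \<in> Iw_charts" "x \<in> overlap c c'" for c c' x v w
    using riem that unfolding riemannian_metric_def by blast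
  have gG: "g (lift_chart V) z v w = G (heis_mult h z) (shear (h $ 1) v) (shear (h $ 1) w)"
    if V: "evenly_covered V" "z \<in> V" and h: "h \<in> gaussian_points" for V z v w h
  proof -
    let ?y = "heis_mult h z"
    let ?c = "lift_chart V" and ?c' = "B ?y"
    have y: "?y \<in> ball ?y (1 / 4)" by simp
    have ov: "z \<in> overlap ?c ?c'"
      unfolding B_def overlap_lift[OF V(1) evenly_covered_ball]
      using V(2) Iw_proj_heis_mult[OF h, of z] y by (metis (mono_tags, lifting) imageI mem_Collect_eq)
    obtain k where k: "transition ?c ?c' z = heis_mult k z"
      "frechet_derivative (transition ?c ?c') (at z) = shear (k $ 1)"
      using transition_derivative[OF V(1) evenly_covered_ball ov[unfolded B_def]] unfolding B_def by blast
    have "transition ?c ?c' z = inv_into (ball ?y (1 / 4)) Iw_proj (Iw_proj ?y)"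
      unfolding B_def transition_lift[OF V(1) evenly_covered_ball V(2)] Iw_proj_heis_mult[OF h] ..
    also have "\<dots> = ?y"
      using evenly_covered_ball y unfolding evenly_covered_def by (intro inv_into_f_f) auto
    \<comment> \<open>Both \<open>k\<close> and \<open>h\<close> take \<open>z\<close> to the same point, and the action is free.\<close>
    finally have "k = h" using k(1) heis_mult_left_cancel by metis
    moreover have "g ?c z v w = g ?c' (transition ?c ?c' z)
        (frechet_derivative (transition ?c ?c') (at z) v) (frechet_derivative (transition ?c ?c') (at z) w)"
      by (rule transform[OF _ B(1) ov]) (use V(1) in \<open>simp add: Iw_charts_eq\<close>)
    ultimately show ?thesis by (simp add: k G_def)
  qed
  have G_chart: "g (B z) y = G y" if "y \<in> ball z (1 / 4)" for y z
  proof -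
    have "(0 :: complex ^ 3) \<in> gaussian_points" by (simp add: gaussian_points_def gaussian_integers_closed)
    from gG[OF evenly_covered_ball that this] show ?thesis
      by (simp add: fun_eq_iff B_def heis_mult_def)
  qed
  have G_inv: "G (heis_mult h z) (shear (h $ 1) v) (shear (h $ 1) w) = G z v w" if "h \<in> gaussian_points" for h z v w
    using gG[OF evenly_covered_ball _ that, of z z v w] by (simp add: G_def B_def)
  have z_in: "z \<in> chart_image (B z)" for z by (simp add: B)
  have bil: "bilinear (G z)" and sym: "G z v w = G z w v" and pos: "v \<noteq> 0 \<Longrightarrow> G z v v > 0" for z v w
    using riem B(1)[of z] z_in[of z] unfolding riemannian_metric_def G_def by blast+
  have G_J: "G z (J z v) (J z w) = G z v w" for z v w
    using herm B(1)[of z] z_in[of z] unfolding hermitian_metric_def G_def J_eq by blast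
  have G_smooth: "smooth_on UNIV (\<lambda>z. G z v w)" for v w
  proof (rule smooth_on_local)
    fix z :: "complex ^ 3"
    have "smooth_on (ball z (1 / 4)) (\<lambda>y. g (B z) y v w)"
      using riem B[of z] unfolding riemannian_metric_def by metis
    then have "smooth_on (ball z (1 / 4)) (\<lambda>y. G y v w)"
      by (rule smooth_on_cong[rotated 2]) (simp_all add: G_chart)
    then show "\<exists>V. open V \<and> z \<in> V \<and> smooth_on V (\<lambda>y. G y v w)"
      by (intro exI[of _ "ball z (1 / 4)"]) simp
  qed

  have J_lin: "linear (J x)" for x unfolding J_def by (rule linear_Nak_J[OF t])
  have J_smooth: "smooth_endo J"
    unfolding smooth_endo_def using J_lin smooth_on_Nak_J[OF t open_UNIV] by (simp add: J_def)
  have J_J: "J x (J x v) = - v" for x v unfolding J_def by (rule Nak_J_J[OF t])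
  have equi: "shear (h $ 1) (J x v) = J (heis_mult h x) (shear (h $ 1) v)" for h x v
    by (simp add: J_def Nak_J_eq[OF t])

  define \<omega> :: "(complex ^ 3) cform" where "\<omega> x vs = of_real (G x (J x (vs ! 0)) (vs ! 1))" for x vs
  have \<omega>: "smooth_tensor 2 \<omega>"
    using smooth_tensor_apply_endo[OF bilinear_of_real_tensor[OF bil G_smooth] J_smooth, of "{0}"]
    by (rule iffD1[OF smooth_tensor_cong, rotated]) (simp add: \<omega>_def)
  have \<omega>_ddbar: "del J 1 2 (delbar J 1 1 \<omega>) z vs = 0" if "length vs = 4" for z vs
  proof -
    have "del J 1 2 (delbar J 1 1 \<omega>) z vs = del J 1 2 (delbar J 1 1 (fundamental_form (Nak_J t) g (B z))) z vs"
      by (rule del_delbar_cong_open[OF open_ball _ _ that, of z z "1 / 4"])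
         (simp_all add: \<omega>_def fundamental_form_def J_eq G_chart)
    also have "\<dots> = 0"
      using skt B(1)[of z] z_in[of z] that unfolding skt_metric_def by (metis J_eq)
    finally show ?thesis .
  qed
  have ave_ddbar: "del J 1 2 (delbar J 1 1 (average \<omega>)) x vs = 0" if "length vs = 4" for x vs
    unfolding ddbar_average[OF \<omega> J_smooth equi that] average_def using \<omega>_ddbar that by simp

  \<comment> \<open>the integrand and the value of the average of \<open>\<omega>\<close> at the origin\<close>
  define I where "I p u v = G (heis_point p) (J (heis_point p) (shear (heis_point p $ 1) u)) (shear (heis_point p $ 1) v)" for p u v
  define a where "a u v = integral unit_box (\<lambda>p. I p u v)" for u v
  have I_cont: "continuous_on unit_box (\<lambda>p. I p u v)" for u v
  proof -
    have "continuous_on unit_box (\<lambda>p. \<omega> (heis_mult (heis_point p) 0) (map (shear (heis_point p $ 1)) [u, v]))"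
      by (rule average_integrand_continuous[OF \<omega>]) (simp_all add: continuous_intros)
    then have "continuous_on unit_box (\<lambda>p. Re (complex_of_real (I p u v)))"
      unfolding \<omega>_def I_def heis_mult_0 by (intro continuous_on_Re) simp
    then show ?thesis by simp
  qed
  have I_int: "(\<lambda>p. I p u v) integrable_on unit_box" for u v
    by (rule integrable_continuous[OF I_cont])
  have I_bil: "bilinear (I p)" for p
    unfolding bilinear_def I_def
    using linear_compose[OF linear_compose[OF linear_shear J_lin], of "\<lambda>u. G (heis_point p) u w" for w]
      linear_compose[OF linear_shear, of "G (heis_point p) u" for u] bil
    by (simp add: bilinear_def o_def)
  have a_bil: "bilinear a"
    unfolding bilinear_def linear_iff a_def
    by (auto simp: bilinear_ladd[OF I_bil] bilinear_radd[OF I_bil] bilinear_lmul[OF I_bil] bilinear_rmul[OF I_bil]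
        integral_add[OF I_int I_int])
  have "I p u v = - I p v u" for p u v
  proof -
    let ?h = "heis_point p"
    have "G ?h (J ?h v') w' = - G ?h (J ?h w') v'" for v' w'
    proof -
      have "G ?h (J ?h v') w' = G ?h (J ?h (J ?h v')) (J ?h w')" by (simp add: G_J)
      also have "\<dots> = - G ?h v' (J ?h w')" by (simp add: J_J bilinear_lneg[OF bil])
      finally show ?thesis by (simp add: sym[of ?h v'])
    qed
    then show ?thesis unfolding I_def .
  qed
  then have a_skew: "a u v = - a v u" for u v
    unfolding a_def by (metis (no_types, lifting) Henstock_Kurzweil_Integration.integral_neg integral_cong)
  have shear_J0: "shear (h $ 1) (Nak_J0 t u) = J h (shear (h $ 1) u)" for h u
    by (simp add: J_def Nak_J_eq[OF t])
  have a_J0: "a (Nak_J0 t u) (Nak_J0 t v) = a u v" for u v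
    unfolding a_def I_def shear_J0 by (simp add: G_J)
  have a_pos: "a u (Nak_J0 t u) > 0" if "u \<noteq> 0" for u
    unfolding a_def
  proof (rule integral_unit_box_pos[OF I_cont])
    fix p
    have "shear (heis_point p $ 1) u \<noteq> 0"
    proof
      assume "shear (heis_point p $ 1) u = 0"
      then have "shear (- heis_point p $ 1) (shear (heis_point p $ 1) u) = 0"
        by (simp only: linear_0[OF linear_shear])
      with that show False by simp
    qed
    then show "I p u (Nak_J0 t u) > 0" unfolding I_def shear_J0 G_J by (rule pos)
  qed

  have "average \<omega> x vs = invariant_form a x vs" if "length vs = 2" for x vs
  proof -
    have "\<omega> (heis_mult k z) (map (shear (k $ 1)) us) = \<omega> z us" if "k \<in> gaussian_points" "length us = 2" for k z us
      using that G_inv[OF that(1)] by (simp add: \<omega>_def equi[symmetric])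
    from average_left_invariant[OF \<omega> that this]
    have "average \<omega> x vs = average \<omega> 0 (map (shear (- x $ 1)) vs)" by blast
    also have "\<dots> = integral unit_box (\<lambda>p. complex_of_real (I p (shear (- x $ 1) (vs ! 0)) (shear (- x $ 1) (vs ! 1))))"
      unfolding average_def \<omega>_def I_def heis_mult_0 using that by simp
    also have "\<dots> = invariant_form a x vs"
      unfolding invariant_form_def a_def
      using integral_linear[OF I_int bounded_linear_of_real] by (simp add: o_def)
    finally show ?thesis .
  qed
  moreover have len: "length (frame t) = 4" by (simp add: frame_def)
  ultimately have "del J 1 2 (delbar J 1 1 (average \<omega>)) 0 (frame t) =
      del J 1 2 (delbar J 1 1 (invariant_form a)) 0 (frame t)"
    by (intro del_delbar_cong_open[OF open_UNIV UNIV_I]) simp_all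
  also have "\<dots> = \<i> / 2 * of_real (a (dual3 t 1) (dual3 t \<i>)) * of_real (skt_obstruction t) * - 4"
    unfolding J_def ddbar_invariant_form[OF t a_bil a_skew a_J0 len] wedge22_frame[OF t] ..
  finally have "a (dual3 t 1) (dual3 t \<i>) = 0"
    unfolding ave_ddbar[OF len] using obs by simp
  moreover have "dual3 t 1 \<noteq> 0"
  proof
    assume "dual3 t 1 = 0"
    then have "axis (3::3) 1 = Nak_L t 0" using Nak_L_dual3[OF t, of 1] by simp
    then have "axis (3::3) 1 $ 3 = (0 :: complex ^ 3) $ 3" by (simp only: linear_0[OF linear_Nak_L])
    then show False by simp
  qed
  ultimately show False
    using a_pos[of "dual3 t 1"] by (simp add: Nak_J0_dual3[OF t])
qed

section \<open>The parameter space near the origin and along the line\<close>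

lemma base_0:
  "base_M 0 $ 1 $ 1 = 1" "base_M 0 $ 1 $ 2 = 0" "base_M 0 $ 2 $ 1 = 0" "base_M 0 $ 2 $ 2 = 1"
  "base_det 0 = 1"
  "base_P 0 $ 1 $ 1 = 1" "base_P 0 $ 1 $ 2 = 0" "base_P 0 $ 2 $ 1 = 0" "base_P 0 $ 2 $ 2 = 1"
  "base_Q 0 $ 1 $ 1 = 0" "base_Q 0 $ 1 $ 2 = 0" "base_Q 0 $ 2 $ 1 = 0" "base_Q 0 $ 2 $ 2 = 0"
  "Nak_D 0 = 0"
proof -
  show M: "base_M 0 $ 1 $ 1 = 1" "base_M 0 $ 1 $ 2 = 0" "base_M 0 $ 2 $ 1 = 0" "base_M 0 $ 2 $ 2 = 1"
    by (simp_all add: base_M_def)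
  show d: "base_det 0 = 1" by (simp add: base_det_def M)
  show "base_P 0 $ 1 $ 1 = 1" "base_P 0 $ 1 $ 2 = 0" "base_P 0 $ 2 $ 1 = 0" "base_P 0 $ 2 $ 2 = 1"
    by (simp_all add: base_P_def M d)
qed (simp_all add: base_Q_def Nak_D_def)

lemma skt_obstruction_0: "skt_obstruction 0 = 1"
  by (simp add: skt_obstruction_def dtheta_A_def dtheta_B_def base_wedge_def base_0)

lemma tendsto_skt_data:
  shows tendsto_base_det: "(base_det \<longlongrightarrow> base_det 0) (at 0)"
    and tendsto_Nak_D: "(Nak_D \<longlongrightarrow> Nak_D 0) (at 0)"
    and tendsto_skt_obstruction: "(skt_obstruction \<longlongrightarrow> skt_obstruction 0) (at 0)"
proof -
  note field_limits = tendsto_const tendsto_add tendsto_diff tendsto_minus tendsto_mult tendsto_cnj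
  have t: "((\<lambda>t. t $ i $ j) \<longlongrightarrow> 0 $ i $ j) (at 0)" for i :: 3 and j :: 2
    by (intro tendsto_vec_nth tendsto_ident_at)
  show D: "(Nak_D \<longlongrightarrow> Nak_D 0) (at 0)"
    unfolding Nak_D_def[abs_def] by (intro field_limits t)
  have M: "((\<lambda>t. base_M t $ 1 $ 1) \<longlongrightarrow> base_M 0 $ 1 $ 1) (at 0)" "((\<lambda>t. base_M t $ 1 $ 2) \<longlongrightarrow> base_M 0 $ 1 $ 2) (at 0)"
    "((\<lambda>t. base_M t $ 2 $ 1) \<longlongrightarrow> base_M 0 $ 2 $ 1) (at 0)" "((\<lambda>t. base_M t $ 2 $ 2) \<longlongrightarrow> base_M 0 $ 2 $ 2) (at 0)"
    unfolding base_M_def vector_2 by (intro field_limits t)+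
  show det: "(base_det \<longlongrightarrow> base_det 0) (at 0)"
    unfolding base_det_def[abs_def] by (intro field_limits M)
  have det0: "base_det 0 \<noteq> 0" by (simp add: base_0)
  have P: "((\<lambda>t. base_P t $ 1 $ 1) \<longlongrightarrow> base_P 0 $ 1 $ 1) (at 0)" "((\<lambda>t. base_P t $ 1 $ 2) \<longlongrightarrow> base_P 0 $ 1 $ 2) (at 0)"
    "((\<lambda>t. base_P t $ 2 $ 1) \<longlongrightarrow> base_P 0 $ 2 $ 1) (at 0)" "((\<lambda>t. base_P t $ 2 $ 2) \<longlongrightarrow> base_P 0 $ 2 $ 2) (at 0)"
    unfolding base_P_def vector_2 by (intro field_limits tendsto_divide M det det0)+
  have Q: "((\<lambda>t. base_Q t $ 1 $ 1) \<longlongrightarrow> base_Q 0 $ 1 $ 1) (at 0)" "((\<lambda>t. base_Q t $ 1 $ 2) \<longlongrightarrow> base_Q 0 $ 1 $ 2) (at 0)"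
    "((\<lambda>t. base_Q t $ 2 $ 1) \<longlongrightarrow> base_Q 0 $ 2 $ 1) (at 0)" "((\<lambda>t. base_Q t $ 2 $ 2) \<longlongrightarrow> base_Q 0 $ 2 $ 2) (at 0)"
    unfolding base_Q_def vector_2 by (intro field_limits P t)+
  show "(skt_obstruction \<longlongrightarrow> skt_obstruction 0) (at 0)"
    unfolding skt_obstruction_def[abs_def] dtheta_A_def dtheta_B_def base_wedge_def Let_def vector_2
    by (intro field_limits tendsto_power tendsto_norm tendsto_Re P Q D)
qed

text \<open>All conditions are open and hold at \<open>0\<close>, where the coframe is \<open>dz\<^sub>1, dz\<^sub>2, dz\<^sub>3 - z\<^sub>1 dz\<^sub>2\<close> and \<open>A = -1\<close>, \<open>B = 0\<close>.\<close>

lemma obstructed_near_0: "\<exists>\<epsilon>>0. \<forall>t. norm t < \<epsilon> \<longrightarrow> nondegenerate t \<and> skt_obstruction t \<noteq> 0"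
proof -
  have "\<forall>\<^sub>F t in at 0. base_det t \<noteq> 0"
    by (rule tendsto_imp_eventually_ne[OF tendsto_base_det]) (simp add: base_0)
  moreover have "\<forall>\<^sub>F t in at 0. norm (Nak_D t) \<noteq> 1"
    by (rule tendsto_imp_eventually_ne[OF tendsto_norm[OF tendsto_Nak_D]]) (simp add: base_0)
  moreover have "\<forall>\<^sub>F t in at 0. skt_obstruction t \<noteq> 0"
    by (rule tendsto_imp_eventually_ne[OF tendsto_skt_obstruction]) (simp add: skt_obstruction_0)
  ultimately have "\<forall>\<^sub>F t in at 0. nondegenerate t \<and> skt_obstruction t \<noteq> 0"
    by eventually_elim (simp add: nondegenerate_def)
  then obtain \<epsilon> where "\<epsilon> > 0" and
    \<epsilon>: "\<And>t. t \<noteq> 0 \<Longrightarrow> dist t 0 < \<epsilon> \<Longrightarrow> nondegenerate t \<and> skt_obstruction t \<noteq> 0"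
    unfolding eventually_at by blast
  moreover have "nondegenerate 0 \<and> skt_obstruction 0 \<noteq> 0"
    by (simp add: nondegenerate_def base_0 skt_obstruction_0)
  ultimately show ?thesis by (metis dist_0_norm dist_commute)
qed

text \<open>The complex structure at the origin along the line, solved for explicitly so that its smooth dependence on \<open>s\<close> can
be read off.\<close>

definition line_J0 :: "complex \<Rightarrow> complex ^ 3 \<Rightarrow> complex ^ 3" where
  "line_J0 s u = axis 1 (\<i> * ((1 - s * cnj s) * u $ 1 - 2 * s * cnj (u $ 2)) / (1 + s * cnj s))
     + (axis 2 (\<i> * ((1 - s * cnj s) * u $ 2 + 2 * s * cnj (u $ 1)) / (1 + s * cnj s))
     + axis 3 (\<i> * ((1 + (s * cnj s)\<^sup>2) * u $ 3 - 2 * s\<^sup>2 * cnj (u $ 3)) / (1 - (s * cnj s)\<^sup>2)))"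

lemma one_minus_cnj_sq_nonzero: "norm s \<noteq> 1 \<Longrightarrow> 1 - (s * cnj s)\<^sup>2 \<noteq> (0::complex)"
proof
  assume s: "norm s \<noteq> 1" and "1 - (s * cnj s)\<^sup>2 = 0"
  then have "(1 - s * cnj s) * (1 + s * cnj s) = 0" by (simp add: power2_eq_square algebra_simps)
  then have "s * cnj s = 1" using one_plus_cnj_nonzero[of s] by simp
  then have "norm s * norm s = 1" by (metis complex_mod_cnj norm_mult norm_one)
  with s show False by (metis norm_ge_zero abs_of_nonneg abs_1 power2_eq_1_iff power2_eq_square abs_minus_cancel)
qed

lemma Nak_J0_line:
  assumes s: "norm s \<noteq> 1"
  shows "Nak_J0 (Nak_line s) u = line_J0 s u"
proof -
  have t: "nondegenerate (Nak_line s)" using s by (simp add: nondegenerate_Nak_line)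
  define m where "m = 1 + s * cnj s"
  define k where "k = 1 - (s * cnj s)\<^sup>2"
  have m: "m \<noteq> 0" and k: "k \<noteq> 0"
    unfolding m_def k_def by (rule one_plus_cnj_nonzero one_minus_cnj_sq_nonzero[OF s])+
  have cm: "cnj m = m" "cnj k = k" by (simp_all add: m_def k_def mult.commute)
  have D: "Nak_D (Nak_line s) = s\<^sup>2" by (simp add: Nak_D_def power2_eq_square)
  let ?u = "line_J0 s u"
  have u: "?u $ 1 = \<i> * ((1 - s * cnj s) * u $ 1 - 2 * s * cnj (u $ 2)) / m"
    "?u $ 2 = \<i> * ((1 - s * cnj s) * u $ 2 + 2 * s * cnj (u $ 1)) / m"
    "?u $ 3 = \<i> * ((1 + (s * cnj s)\<^sup>2) * u $ 3 - 2 * s\<^sup>2 * cnj (u $ 3)) / k"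
    by (simp_all add: line_J0_def m_def k_def)
  have "?u $ 1 - s * cnj (?u $ 2) = \<i> * (u $ 1 - s * cnj (u $ 2))"
    unfolding u using m by (simp add: cm field_simps) (simp add: m_def algebra_simps)
  moreover have "?u $ 2 + s * cnj (?u $ 1) = \<i> * (u $ 2 + s * cnj (u $ 1))"
    unfolding u using m by (simp add: cm field_simps) (simp add: m_def algebra_simps)
  moreover have "?u $ 3 - s\<^sup>2 * cnj (?u $ 3) = \<i> * (u $ 3 - s\<^sup>2 * cnj (u $ 3))"
    unfolding u power2_eq_square using k by (simp add: cm field_simps) (simp add: k_def power2_eq_square algebra_simps)
  ultimately have "Nak_L (Nak_line s) ?u = Nak_L (Nak_line s) (Nak_J0 (Nak_line s) u)"
    unfolding Nak_L_J0[OF t] by (simp add: vec3_eq_iff D)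
  then show ?thesis using inj_Nak_L[OF t] by (simp add: inj_eq)
qed

lemma smooth_on_line_J0:
  assumes "open U" "smooth_on U f" "smooth_on U g" "\<And>x. x \<in> U \<Longrightarrow> norm (f x) \<noteq> 1"
  shows "smooth_on U (\<lambda>x. line_J0 (f x) (g x))"
  unfolding line_J0_def
  by (intro smooth_on_add smooth_on_axis smooth_on_divide smooth_on_mult smooth_on_diff smooth_on_const
      smooth_on_nth smooth_on_cnj smooth_on_power assms one_plus_cnj_nonzero one_minus_cnj_sq_nonzero)

theorem smooth_family_Nak_line:
  "smooth_family_of_complex_manifolds {s. norm s \<noteq> 1} Iw_top Iw_charts (\<lambda>s. Nak_J (Nak_line s))"
  unfolding smooth_family_of_complex_manifolds_def
proof (intro conjI ballI allI)
  show op: "open {s :: complex. norm s \<noteq> 1}"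
    by (intro open_Collect_neq continuous_intros)
  show "complex_manifold Iw_top Iw_charts (Nak_J (Nak_line s))" if "s \<in> {s. norm s \<noteq> 1}" for s
    using that by (intro complex_manifold_Nak_J) (simp add: nondegenerate_Nak_line)
  fix c v assume "c \<in> Iw_charts"
  then have "open (chart_image c)"
    by (auto simp: Iw_charts_eq chart_image_lift evenly_covered_def)
  with op have U: "open ({s :: complex. norm s \<noteq> 1} \<times> chart_image c)" (is "open ?U")
    by (rule open_Times)
  have "smooth_on ?U (\<lambda>p. shear (snd p $ 1) (line_J0 (fst p) (shear (- snd p $ 1) v)))"
    using U by (intro smooth_on_shear smooth_on_line_J0 smooth_intros
        smooth_on_bounded_linear[OF _ bounded_linear_snd] smooth_on_bounded_linear[OF _ bounded_linear_fst]) auto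
  then show "smooth_on ?U (\<lambda>(s, x). Nak_J (Nak_line s) c x v)"
    by (rule smooth_on_cong[OF U, rotated])
       (auto simp: Nak_J_eq nondegenerate_Nak_line Nak_J0_line)
qed

lemma Nak_J_line_0: "Nak_J (Nak_line 0) = Iw_standard_J"
proof (intro ext)
  fix c z v
  have "line_J0 0 u = \<i> *s u" for u by (simp add: line_J0_def vec3_eq_iff)
  then show "Nak_J (Nak_line 0) c z v = Iw_standard_J c z v"
    by (simp add: Nak_J_eq nondegenerate_Nak_line Nak_J0_line Iw_standard_J_def vec3_eq_iff algebra_simps)
qed

lemma admits_skt_metric_circle:
  assumes "(norm s)\<^sup>2 = 2 - sqrt 3 \<or> (norm s)\<^sup>2 = 2 + sqrt 3"
  shows "norm s \<noteq> 1" "admits_skt_metric Iw_charts (Nak_J (Nak_line s))"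
proof -
  have root: "norm s ^ 4 - 4 * (norm s)\<^sup>2 + 1 = 0"
  proof -
    have "norm s ^ 4 = (norm s)\<^sup>2 * (norm s)\<^sup>2" by (simp flip: power_add)
    moreover have "(2 - sqrt 3) * (2 - sqrt 3) - 4 * (2 - sqrt 3) + 1 = 0"
      "(2 + sqrt 3) * (2 + sqrt 3) - 4 * (2 + sqrt 3) + 1 = (0::real)"
      by (simp_all add: algebra_simps)
    ultimately show ?thesis using assms by metis
  qed
  then show n: "norm s \<noteq> 1" by auto
  show "admits_skt_metric Iw_charts (Nak_J (Nak_line s))"
    using n root
    by (intro admits_skt_metric_if_no_obstruction) (simp_all add: nondegenerate_Nak_line skt_obstruction_Nak_line)
qed

theorem theorem1p2:
  shows
    \<comment> \<open>(a)\<close>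
    "(\<exists>\<epsilon>>0. \<forall>t. norm t < \<epsilon> \<longrightarrow>
        complex_manifold Iw_top Iw_charts (Nak_J t) \<and> \<not> admits_skt_metric Iw_charts (Nak_J t))
     \<and>
     \<comment> \<open>(b)\<close>
     (smooth_family_of_complex_manifolds {s. norm s \<noteq> 1} Iw_top Iw_charts (\<lambda>s. Nak_J (Nak_line s)) \<and>
      Nak_J (Nak_line 0) = Iw_standard_J \<and>
      (\<forall>s. (norm s)\<^sup>2 = 2 - sqrt 3 \<longrightarrow>
         path_component {s. norm s \<noteq> 1} 0 s \<and> admits_skt_metric Iw_charts (Nak_J (Nak_line s))))
     \<and>
     \<comment> \<open>(c)\<close>
     (\<forall>s. (norm s)\<^sup>2 = 2 + sqrt 3 \<longrightarrow>
        norm s \<noteq> 1 \<and> admits_skt_metric Iw_charts (Nak_J (Nak_line s)))"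
proof (intro conjI allI impI)
  show "\<exists>\<epsilon>>0. \<forall>t. norm t < \<epsilon> \<longrightarrow>
        complex_manifold Iw_top Iw_charts (Nak_J t) \<and> \<not> admits_skt_metric Iw_charts (Nak_J t)"
    using obstructed_near_0 complex_manifold_Nak_J no_skt_metric_if_obstruction by metis
next
  fix s :: complex assume s: "(norm s)\<^sup>2 = 2 - sqrt 3"
  have "1 < sqrt (3::real)" by simp
  then have "(norm s)\<^sup>2 < 1\<^sup>2" using s by simp
  then have "norm s < 1" by (rule power_less_imp_less_base) simp
  then have "path_component (ball 0 1) 0 s"
    using path_connected_component convex_imp_path_connected[OF convex_ball] by (metis centre_in_ball mem_ball_0 zero_less_one)
  then show "path_component {s. norm s \<noteq> 1} 0 s"
    by (rule path_component_of_subset[rotated]) auto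
qed (use smooth_family_Nak_line Nak_J_line_0 admits_skt_metric_circle in auto)

end
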